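(* Let $r>0$ and let $u\in C^3(B_r(0))$, $B_r(0)\subset\mathbb{R}^n$, be a positive admissible solution of the prescribed curvature equation $$F(A)=f(\boldsymbol{\lambda}(A))=\psi\big(x,u(x),\boldsymbol{\nu}(x)\big),\qquad \boldsymbol{\nu}=\Big(-\frac{Du}{w},\frac{1}{w}\Big),$$ in $B_r(0)$ (interpreted, at points where $\boldsymbol{\lambda}(A)\in\partial\Gamma$, in the form $\tilde F(A)=h\circ\psi$ described in the context). Assume $f$ satisfies the structure conditions (i)–(v) and that $\psi$ satisfies, for all its arguments with $u>0$, $$\psi_u-\frac{\psi-f(\mathbf 0)}{u}\ \ge\ 0,\qquad f(\mathbf 0):=\limsup_{\boldsymbol\lambda\to\mathbf 0,\ \boldsymbol\lambda\in\Gamma}f(\boldsymbol\lambda).$$ Let $M:=\sup_{B_r(0)}u$. Then $$|Du(0)|\le \exp\Big(C\Big(M+\frac{M^2}{r^2}+1\Big)\Big),$$ where $C>0$ is a constant depending only on $n$, $r$, $f$, $\Gamma$ (through $\delta$ in condition (iii) and the cone), and on upper bounds for $|\psi|$ and $|D\psi|$ (the full gradient of $\psi$ in all of its arguments $(x,u,\boldsymbol\nu)$) over the set of values $\{(x,u(x),\boldsymbol\nu(x)):x\in B_r(0)\}$ (in the degenerate case also on $h$).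
   Context: Hyperbolic space is taken in the half-space model $\mathbb{H}^{n+1}=\{(x,x_{n+1})\in\mathbb{R}^{n+1}: x_{n+1}>0\}$ with metric $ds^2=x_{n+1}^{-2}\sum_{i=1}^{n+1}dx_i^2$. For a positive $C^2$ function $u$ on a domain in $\mathbb{R}^n$, set $w=\sqrt{1+|Du|^2}$, $\gamma^{ik}=\delta_{ik}-\frac{u_iu_k}{w(w+1)}$, and let $A=(a_{ij})$ with $$a_{ij}=\frac1w\sum_{k,l}\gamma^{ik}(\delta_{kl}+u_ku_l+u\,u_{kl})\gamma^{lj};$$ its eigenvalues $\boldsymbol\lambda(A)=(\lambda_1,\dots,\lambda_n)$ are the hyperbolic principal curvatures of the vertical graph of $u$ (upward normal). $\Gamma\subset\mathbb{R}^n$ is an open symmetric convex cone with vertex at the origin containing the positive cone $\Gamma_n=\{\lambda_i>0\ \forall i\}$, and $f$ is a symmetric $C^1$ function on $\Gamma$. $u$ is called admissible if $\boldsymbol\lambda(A)\in\bar\Gamma$ everywhere; on $\partial\Gamma$, $f(\boldsymbol\lambda(A)):=\limsup_{\boldsymbol\lambda\in\Gamma,\boldsymbol\lambda\to\boldsymbol\lambda(A)}f(\boldsymbol\lambda)$. The function $\psi(x,u,\boldsymbol\nu)$ is a given $C^1$ function. Structure conditions on $f$ in $\Gamma$: (i) $\partial f/\partial\lambda_i\ge0$ for all $i$; (ii) $f$ is concave; (iii) there is $\delta\in(0,\tfrac12)$ such that $\partial f/\partial\lambda_j>2\delta\sum_i\partial f/\partial\lambda_i$ whenever $\lambda_j<0$;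 (iv) $t\mapsto f(t\boldsymbol\lambda)$ is increasing for $t>0$; (v) $\lim_{t\to+\infty}f(t,\dots,t)>\sup_{B_r(0)}\psi$ (supremum of $\psi$ evaluated along $u$). Degenerate case: at points where $\boldsymbol\lambda(A)\in\partial\Gamma$, the equation is understood as $\tilde F(A)=h\circ\psi$, where $\tilde F(A):=\limsup_{\boldsymbol\lambda\in\Gamma,\boldsymbol\lambda\to\boldsymbol\lambda(A)}g(\boldsymbol\lambda)$, $h:\mathbb{R}\to\mathbb{R}$ is strictly increasing and $C^1$, $g$ is $C^1$ on $\bar\Gamma\setminus(\partial\Gamma_n\cap\partial\Gamma)$, $g=h\circ f$ in $\Gamma$, and $\sum_i\partial g/\partial\lambda_i>0$ on $\partial\Gamma\setminus\partial\Gamma_n$. *)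

theory Defs
  imports "HOL-Analysis.Analysis"
begin

text \<open>Hyperbolic curvature data for the vertical graph of u in the half-space model.
  Here p stands for Du(x), z for u(x), S for the Hessian D^2u(x).\<close>

definition wfun :: "real^'n \<Rightarrow> real" where
  "wfun p = sqrt (1 + (norm p)^2)"

definition gam :: "real^'n \<Rightarrow> real^'n^'n" where
  "gam p = (\<chi> i k. (if i = k then 1 else 0) - p$i * p$k / (wfun p * (wfun p + 1)))"

definition curv_mat :: "real \<Rightarrow> real^'n \<Rightarrow> real^'n^'n \<Rightarrow> real^'n^'n" where
  "curv_mat z p S = (1 / wfun p) *\<^sub>R
     (gam p ** (mat 1 + (\<chi> k l. p$k * p$l) + z *\<^sub>R S) ** gam p)"

definition upnormal :: "real^'n \<Rightarrow> (real^'n) \<times> real" where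
  "upnormal p = (- ((1 / wfun p) *\<^sub>R p), 1 / wfun p)"

definition eigvals_are :: "real^'n^'n \<Rightarrow> real^'n \<Rightarrow> bool" where
  "eigvals_are A lam \<longleftrightarrow>
     (\<exists>Q. orthogonal_matrix Q \<and> A = Q ** (\<chi> i j. if i = j then lam$i else 0) ** transpose Q)"

definition pos_cone :: "(real^'n) set" where
  "pos_cone = {l. \<forall>i. 0 < l$i}"

definition admissible_cone :: "(real^'n) set \<Rightarrow> bool" where
  "admissible_cone G \<longleftrightarrow> open G \<and> convex G \<and> 0 \<notin> G \<and> pos_cone \<subseteq> G \<and>
     (\<forall>l\<in>G. \<forall>t>0. t *\<^sub>R l \<in> G) \<and>
     (\<forall>l\<in>G. \<forall>\<sigma>. \<sigma> permutes (UNIV::'n set) \<longrightarrow> (\<chi> i. l$(\<sigma> i)) \<in> G)"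

definition C3_with :: "(real^'n) set \<Rightarrow> (real^'n \<Rightarrow> real) \<Rightarrow> (real^'n \<Rightarrow> real^'n)
    \<Rightarrow> (real^'n \<Rightarrow> real^'n^'n) \<Rightarrow> bool" where
  "C3_with S u Du D2u \<longleftrightarrow>
     (\<forall>x\<in>S. (u has_derivative (\<lambda>h. Du x \<bullet> h)) (at x)) \<and>
     (\<forall>x\<in>S. (Du has_derivative (\<lambda>h. D2u x *v h)) (at x)) \<and>
     (\<exists>D3u. (\<forall>x\<in>S. (D2u has_derivative D3u x) (at x)) \<and>
            (\<forall>h. continuous_on S (\<lambda>x. D3u x h)))"

end

theory Submission
  imports Defs
begin

text \<open>At a maximum of \<open>\<alpha> ln w + ln \<zeta>(x, u)\<close>, with \<open>w\<^sup>2 = 1 + |Du|\<^sup>2\<close>, the second-order condition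
  is tested in the directions \<open>\<gamma> q\<close>, \<open>q\<close> an eigenvector of \<open>A\<close>, and combined with the equation
  differentiated along \<open>Du\<close>. The good terms are \<open>\<alpha> \<tau> / u\<close> and \<open>\<alpha> w D / u\<close>, where \<open>\<tau> = \<Sum> f\<^sub>i\<close> and
  \<open>D = u \<psi>\<^sub>u - \<Sum> f\<^sub>i \<lambda>\<^sub>i \<ge> 0\<close>; concavity gives \<open>\<tau> + D \<ge> f(1, \<dots>, 1) - f(0) > 0\<close>.
  The height term of \<open>\<zeta>\<close> costs \<open>\<tau> \<partial>\<^sub>u ln \<zeta>\<close>, but once
  \<open>u \<partial>\<^sub>u ln \<zeta> > \<alpha>\<close> the curvature in direction \<open>Du\<close> is negative and (iii) produces a quadratic good
  term. Where \<open>u\<close> is small and the cutoff is not, the good terms suffice without a height term; elsewhere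
  the quadratic term is used. The intermediate range, where neither works, is skipped by taking the
  maximum of two test functions, one without and one with height dependence.

  Where the curvatures lie on the boundary of the cone, the linearised equation comes from \<open>g\<close> if
  some curvature is negative, and otherwise from a supporting hyperplane of the cone.\<close>

section \<open>Second-order calculus\<close>

text \<open>Third derivatives of \<open>u\<close> enter through \<open>ln w\<close> only along
  \<open>Du\<close>, so one derivative of the equation is enough, and eigenvalues are followed along
  sequences instead of smooth frames. The derivative of \<psi> costs \<open>H * K\<close> times a
  factor of order 1/\<zeta>, with no lower bound on \<tau> alone. It is split by
  \<open>H * gap \<le> \<tau> + D\<close>: \<alpha> w D / u beats the D part, \<alpha> \<tau> / u or
  the quadratic term the \<tau> part. The exponent \<alpha> is small for two reasons: eliminating
  the gradient of ln \<zeta> by the first-order condition costs \<alpha>^2 against a good term of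
  order \<alpha>, and at the maximum 1/\<zeta> is at most a multiple of w^\<alpha> exp (m u), which
  must stay below w. The two test functions are w^\<alpha> times 2 \<rho> and times exp (m u)
  (\<rho> + \<beta> u), where \<rho> = R - |x|^2. If the first is larger, then \<rho> \<ge> \<beta>
  u, so that u is small and \<rho> is at least a multiple of u. Otherwise m u \<ge> 1/4 or \<rho>
  \<le> 3 \<beta> u, and either way the slope reaches the threshold 4 \<alpha>.\<close>

lemma second_difference_limit:
  fixes f :: "'a::real_normed_vector \<Rightarrow> real"
  assumes e: "e > 0"
    and df: "\<And>x. x \<in> ball x0 e \<Longrightarrow> (f has_derivative Df x) (at x)"
    and d2: "((\<lambda>x. Df x a) has_derivative (\<lambda>h. B h)) (at x0)"
  shows "((\<lambda>t. (f (x0 + t *\<^sub>R a + t *\<^sub>R b) - f (x0 + t *\<^sub>R a) - f (x0 + t *\<^sub>R b) + f x0) / t\<^sup>2)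
            \<longlongrightarrow> B b) (at_right 0)"
proof (rule tendstoI)
  fix \<epsilon> :: real assume eps: "\<epsilon> > 0"
  define N where "N = norm a + norm b + 1"
  have N: "N > 0" unfolding N_def by (simp add: add_nonneg_pos)
  define \<eta> where "\<eta> = \<epsilon> / (3 * N)"
  have eta: "\<eta> > 0" using eps N by (simp add: \<eta>_def)
  interpret B: bounded_linear B using d2 by (rule has_derivative_bounded_linear)
  obtain d where d: "d > 0" and dd: "\<And>y. norm (y - x0) < d \<Longrightarrow>
      norm (Df y a - Df x0 a - B (y - x0)) \<le> \<eta> * norm (y - x0)"
    using d2 eta unfolding has_derivative_at_alt by blast
  have "0 < min d e / N" using d e N by simp
  then have "\<forall>\<^sub>F t in at_right 0. 0 < t \<and> t < min d e / N"
    by (rule eventually_mono[OF eventually_at_right_real]) auto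
  then show "\<forall>\<^sub>F t in at_right 0. dist ((f (x0 + t *\<^sub>R a + t *\<^sub>R b) - f (x0 + t *\<^sub>R a) - f (x0 + t *\<^sub>R b) + f x0) / t\<^sup>2) (B b) < \<epsilon>"
  proof (rule eventually_mono)
    fix t :: real assume t: "0 < t \<and> t < min d e / N"
    then have tN: "t * N < d" "t * N < e" "t > 0" using N by (simp_all add: field_simps)
    have small: "norm (s *\<^sub>R a + c *\<^sub>R b) \<le> t * (norm a + norm b)" if "\<bar>s\<bar> \<le> t" "\<bar>c\<bar> \<le> t" for s c
    proof -
      have "norm (s *\<^sub>R a + c *\<^sub>R b) \<le> \<bar>s\<bar> * norm a + \<bar>c\<bar> * norm b"
        using norm_triangle_ineq[of "s *\<^sub>R a" "c *\<^sub>R b"] by simp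
      also have "\<dots> \<le> t * norm a + t * norm b"
        using that by (intro add_mono mult_right_mono) auto
      finally show ?thesis by (simp add: algebra_simps)
    qed
    have lt: "t * (norm a + norm b) < t * N" using tN by (simp add: N_def)
    \<comment> \<open>The difference in the direction \<open>b\<close> is treated by the mean value
      theorem as a function of the displacement along \<open>a\<close>. Both points that then occur
      are within O(t) of \<open>x0\<close>, so differentiability of the first derivative at the
      single point \<open>x0\<close> suffices.\<close>
    define g where "g s = f (x0 + s *\<^sub>R a + t *\<^sub>R b) - f (x0 + s *\<^sub>R a)" for s
    have inb: "x0 + s *\<^sub>R a + c *\<^sub>R b \<in> ball x0 e" if "\<bar>s\<bar> \<le> t" "\<bar>c\<bar> \<le> t" for s c
    proof -
      have "norm (s *\<^sub>R a + c *\<^sub>R b) < e" using small[OF that] lt tN by linarith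
      then show ?thesis by (metis add.assoc add_diff_cancel_left' dist_norm mem_ball dist_commute)
    qed
    have scal: "Df x (s *\<^sub>R a) = s * Df x a" if "x \<in> ball x0 e" for x s
      using linear_cmul[OF has_derivative_linear[OF df[OF that]]] by simp
    have gder: "(g has_real_derivative (Df (x0 + s *\<^sub>R a + t *\<^sub>R b) a - Df (x0 + s *\<^sub>R a) a)) (at s)"
      if s: "0 \<le> s" "s \<le> t" for s
    proof -
      have in1: "x0 + s *\<^sub>R a + t *\<^sub>R b \<in> ball x0 e" and in2: "x0 + s *\<^sub>R a \<in> ball x0 e"
        using inb[of s t] inb[of s 0] s tN by auto
      have "((\<lambda>s. x0 + s *\<^sub>R a + t *\<^sub>R b) has_derivative (\<lambda>h. h *\<^sub>R a)) (at s)"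
        by (auto intro!: derivative_eq_intros)
      from has_derivative_compose[OF this df[OF in1]]
      have 1: "((\<lambda>s. f (x0 + s *\<^sub>R a + t *\<^sub>R b)) has_derivative (\<lambda>h. h * Df (x0 + s *\<^sub>R a + t *\<^sub>R b) a)) (at s)"
        by (simp add: scal[OF in1])
      have "((\<lambda>s. x0 + s *\<^sub>R a) has_derivative (\<lambda>h. h *\<^sub>R a)) (at s)"
        by (auto intro!: derivative_eq_intros)
      from has_derivative_compose[OF this df[OF in2]]
      have 2: "((\<lambda>s. f (x0 + s *\<^sub>R a)) has_derivative (\<lambda>h. h * Df (x0 + s *\<^sub>R a) a)) (at s)"
        by (simp add: scal[OF in2])
      show ?thesis unfolding g_def has_field_derivative_def
        by (rule has_derivative_eq_rhs[OF has_derivative_diff[OF 1 2]]) (auto simp: algebra_simps)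
    qed
    obtain \<theta> where th: "0 < \<theta>" "\<theta> < t" and gd: "g t - g 0 = (t - 0) * (Df (x0 + \<theta> *\<^sub>R a + t *\<^sub>R b) a - Df (x0 + \<theta> *\<^sub>R a) a)"
      using MVT2[OF tN(3), of g "\<lambda>s. Df (x0 + s *\<^sub>R a + t *\<^sub>R b) a - Df (x0 + s *\<^sub>R a) a"] gder by auto
    have n1: "norm (\<theta> *\<^sub>R a + t *\<^sub>R b) \<le> t * N" "norm (\<theta> *\<^sub>R a) \<le> t * N"
    proof -
      have "\<bar>\<theta>\<bar> \<le> t" "\<bar>t\<bar> \<le> t" "\<bar>0\<bar> \<le> t" using th by auto
      from small[OF this(1,2)] small[OF this(1,3)] lt
      show "norm (\<theta> *\<^sub>R a + t *\<^sub>R b) \<le> t * N" "norm (\<theta> *\<^sub>R a) \<le> t * N"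
        unfolding scaleR_zero_left add_0_right by linarith+
    qed
    have a1: "\<bar>Df (x0 + \<theta> *\<^sub>R a + t *\<^sub>R b) a - Df x0 a - B (\<theta> *\<^sub>R a + t *\<^sub>R b)\<bar> \<le> \<eta> * (t * N)"
    proof -
      have eq: "x0 + \<theta> *\<^sub>R a + t *\<^sub>R b - x0 = \<theta> *\<^sub>R a + t *\<^sub>R b" by (simp add: algebra_simps)
      have "norm (\<theta> *\<^sub>R a + t *\<^sub>R b) < d" using n1 tN by linarith
      then have "norm (Df (x0 + \<theta> *\<^sub>R a + t *\<^sub>R b) a - Df x0 a - B (\<theta> *\<^sub>R a + t *\<^sub>R b)) \<le> \<eta> * norm (\<theta> *\<^sub>R a + t *\<^sub>R b)"
        using dd[of "x0 + \<theta> *\<^sub>R a + t *\<^sub>R b"] unfolding eq by blast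
      also have "\<dots> \<le> \<eta> * (t * N)" using n1 eta by simp
      finally show ?thesis by simp
    qed
    have a2: "\<bar>Df (x0 + \<theta> *\<^sub>R a) a - Df x0 a - B (\<theta> *\<^sub>R a)\<bar> \<le> \<eta> * (t * N)"
    proof -
      have "norm (\<theta> *\<^sub>R a) < d" using n1 tN by linarith
      then have "norm (Df (x0 + \<theta> *\<^sub>R a) a - Df x0 a - B (\<theta> *\<^sub>R a)) \<le> \<eta> * norm (\<theta> *\<^sub>R a)"
        using dd[of "x0 + \<theta> *\<^sub>R a"] by simp
      also have "\<dots> \<le> \<eta> * (t * N)" using n1 eta by (meson less_imp_le mult_left_mono)
      finally show ?thesis by simp
    qed
    have Bl: "B (\<theta> *\<^sub>R a + t *\<^sub>R b) = B (\<theta> *\<^sub>R a) + t * B b" by (simp add: B.add B.scaleR)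
    have "(g t - g 0) / t = Df (x0 + \<theta> *\<^sub>R a + t *\<^sub>R b) a - Df (x0 + \<theta> *\<^sub>R a) a"
      using gd tN(3) by simp
    then have "\<bar>(g t - g 0) / t - t * B b\<bar> \<le> 2 * (\<eta> * (t * N))"
      using a1 a2 unfolding Bl abs_le_iff by linarith
    then have "\<bar>(g t - g 0) / t - t * B b\<bar> / t \<le> 2 * (\<eta> * N)"
      using tN(3) by (simp add: field_simps)
    moreover have "\<bar>(g t - g 0) / t - t * B b\<bar> / t = \<bar>(g t - g 0) / t\<^sup>2 - B b\<bar>"
    proof -
      have "(g t - g 0) / t\<^sup>2 - B b = ((g t - g 0) / t - t * B b) / t"
        using tN(3) by (simp add: field_simps power2_eq_square)
      then show ?thesis using tN(3) by simp
    qed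
    moreover have "2 * (\<eta> * N) < \<epsilon>" using eps N by (simp add: \<eta>_def)
    ultimately show "dist ((f (x0 + t *\<^sub>R a + t *\<^sub>R b) - f (x0 + t *\<^sub>R a) - f (x0 + t *\<^sub>R b) + f x0) / t\<^sup>2) (B b) < \<epsilon>"
      by (simp add: dist_real_def g_def algebra_simps)
  qed
qed

text \<open>Both sides are limits of the same second difference, which is symmetric in
  \<open>a\<close> and \<open>b\<close>. It serves for \<open>u\<close> and, one order higher, for
  the components of \<open>Du\<close>.\<close>

lemma second_derivative_symmetric:
  fixes f :: "'a::real_normed_vector \<Rightarrow> real"
  assumes e: "e > 0"
    and df: "\<And>x. x \<in> ball x0 e \<Longrightarrow> (f has_derivative Df x) (at x)"
    and da: "((\<lambda>x. Df x a) has_derivative A) (at x0)"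
    and db: "((\<lambda>x. Df x b) has_derivative B) (at x0)"
  shows "A b = B a"
proof -
  have 1: "((\<lambda>t. (f (x0 + t *\<^sub>R a + t *\<^sub>R b) - f (x0 + t *\<^sub>R a) - f (x0 + t *\<^sub>R b) + f x0) / t\<^sup>2)
            \<longlongrightarrow> A b) (at_right 0)"
    using second_difference_limit[OF e df da] by blast
  have 2: "((\<lambda>t. (f (x0 + t *\<^sub>R a + t *\<^sub>R b) - f (x0 + t *\<^sub>R a) - f (x0 + t *\<^sub>R b) + f x0) / t\<^sup>2)
            \<longlongrightarrow> B a) (at_right 0)"
    using second_difference_limit[OF e df db, of a] by (simp add: algebra_simps)
  show ?thesis by (rule tendsto_unique[OF _ 1 2]) simp
qed

lemma second_derivative_local_max:
  fixes f f' :: "real \<Rightarrow> real"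
  assumes "d > 0" and der: "\<And>t. \<bar>t\<bar> < d \<Longrightarrow> (f has_real_derivative f' t) (at t)"
    and der2: "(f' has_real_derivative l) (at 0)"
    and max: "\<And>t. \<bar>t\<bar> < d \<Longrightarrow> f t \<le> f 0"
  shows "f' 0 = 0" "l \<le> 0"
proof -
  show z: "f' 0 = 0"
    using DERIV_local_max[OF der[of 0] \<open>d > 0\<close>] max \<open>d > 0\<close> by auto
  show "l \<le> 0"
  proof (rule ccontr)
    assume "\<not> l \<le> 0"
    then obtain c where c: "c > 0" "\<And>h. h > 0 \<Longrightarrow> h < c \<Longrightarrow> f' 0 < f' (0 + h)"
      using DERIV_pos_inc_right[OF der2] by auto
    define t where "t = min c d / 2"
    have t: "0 < t" "t < c" "t < d" using c \<open>d > 0\<close> by (auto simp: t_def)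
    have "f 0 < f t"
    proof (rule DERIV_pos_imp_increasing_open[OF t(1)])
      fix x assume "0 < x" "x < t"
      then show "\<exists>y. (f has_real_derivative y) (at x) \<and> 0 < y"
        using der[of x] c(2)[of x] t z by (intro exI[of _ "f' x"]) auto
    next
      show "continuous_on {0..t} f"
        using der t by (intro DERIV_continuous_on[where D=f']) (auto intro: has_field_derivative_at_within)
    qed
    with max[of t] t show False by auto
  qed
qed

text \<open>The sequence need only be asymptotic to the direction \<open>v\<close>. This fits
  eigenvalues, which are controlled along subsequences only, and the function \<open>g\<close> of
  the degenerate case, which is differentiable only relative to a set.\<close>

lemma has_derivative_sequentially:
  fixes f :: "'a::real_normed_vector \<Rightarrow> 'b::real_normed_vector"
  assumes der: "(f has_derivative D) (at x within S)"
    and xs: "\<And>k. X k \<in> S" and t: "\<And>k. t k > 0" "t \<longlonglongrightarrow> 0"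
    and lim: "(\<lambda>k. (X k - x) /\<^sub>R t k) \<longlonglongrightarrow> v"
  shows "(\<lambda>k. (f (X k) - f x) /\<^sub>R t k) \<longlonglongrightarrow> D v"
proof -
  interpret D: bounded_linear D using der by (rule has_derivative_bounded_linear)
  have X: "X \<longlonglongrightarrow> x"
  proof -
    have "(\<lambda>k. t k *\<^sub>R ((X k - x) /\<^sub>R t k) + x) \<longlonglongrightarrow> 0 *\<^sub>R v + x"
      by (intro tendsto_intros t lim)
    moreover have "t k *\<^sub>R ((X k - x) /\<^sub>R t k) + x = X k" for k using t(1)[of k] by simp
    ultimately show ?thesis by simp
  qed
  have nb: "(\<lambda>k. norm ((X k - x) /\<^sub>R t k)) \<longlonglongrightarrow> norm v" by (intro tendsto_intros lim)
  then obtain C where C: "C > 0" "\<And>k. norm ((X k - x) /\<^sub>R t k) \<le> C"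
    using convergent_imp_Bseq[OF convergentI[OF lim]] unfolding Bseq_def by blast
  have rem: "(\<lambda>k. (f (X k) - f x - D (X k - x)) /\<^sub>R t k) \<longlonglongrightarrow> 0"
  proof (rule tendstoI)
    fix \<epsilon> :: real assume "\<epsilon> > 0"
    then have e: "\<epsilon> / (2 * C) > 0" using C by simp
    then obtain d where d: "d > 0" "\<And>y. y \<in> S \<Longrightarrow> norm (y - x) < d \<Longrightarrow>
       norm (f y - f x - D (y - x)) \<le> \<epsilon> / (2 * C) * norm (y - x)"
      using der unfolding has_derivative_within_alt by blast
    have "\<forall>\<^sub>F k in sequentially. norm (X k - x) < d"
      using tendstoD[OF X d(1)] by (simp add: dist_norm)
    then show "\<forall>\<^sub>F k in sequentially. dist ((f (X k) - f x - D (X k - x)) /\<^sub>R t k) 0 < \<epsilon>"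
    proof (rule eventually_mono)
      fix k assume k: "norm (X k - x) < d"
      have "norm (f (X k) - f x - D (X k - x)) \<le> \<epsilon> / (2 * C) * norm (X k - x)"
        using d(2)[OF xs k] .
      also have "\<epsilon> / (2 * C) * norm (X k - x) \<le> \<epsilon> / (2 * C) * (C * t k)"
      proof (rule mult_left_mono)
        show "norm (X k - x) \<le> C * t k"
          using C(2)[of k] t(1)[of k] unfolding norm_scaleR
          by (simp add: pos_divide_le_eq flip: divide_inverse_commute)
        show "0 \<le> \<epsilon> / (2 * C)" using e by simp
      qed
      finally have "norm (f (X k) - f x - D (X k - x)) \<le> \<epsilon> / (2 * C) * (C * t k)" .
      then have "norm (f (X k) - f x - D (X k - x)) \<le> \<epsilon> / 2 * t k" using C by (simp add: field_simps)
      then have "norm ((f (X k) - f x - D (X k - x)) /\<^sub>R t k) \<le> \<epsilon> / 2"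
        using t(1)[of k] unfolding norm_scaleR
        by (simp add: pos_divide_le_eq flip: divide_inverse_commute)
      then show "dist ((f (X k) - f x - D (X k - x)) /\<^sub>R t k) 0 < \<epsilon>" using \<open>\<epsilon> > 0\<close>
        by (simp add: dist_norm)
    qed
  qed
  have "(\<lambda>k. (f (X k) - f x - D (X k - x)) /\<^sub>R t k + D ((X k - x) /\<^sub>R t k)) \<longlonglongrightarrow> 0 + D v"
    by (intro tendsto_add rem D.tendsto lim)
  moreover have "(f (X k) - f x - D (X k - x)) /\<^sub>R t k + D ((X k - x) /\<^sub>R t k) = (f (X k) - f x) /\<^sub>R t k" for k
    unfolding D.scaleR by (simp add: scaleR_diff_right)
  ultimately show ?thesis by simp
qed

section \<open>Eigenvalues along a curve of matrices\<close>

definition orthonormal_family :: "('n \<Rightarrow> real^'n) \<Rightarrow> bool" where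
  "orthonormal_family q \<longleftrightarrow> (\<forall>i j. q i \<bullet> q j = (if i = j then 1 else 0))"

lemma orthonormal_family_orthogonal_matrix:
  fixes Q :: "real^'n^'n"
  shows "orthonormal_family (\<lambda>i. column i Q) \<longleftrightarrow> orthogonal_matrix Q"
proof -
  have "transpose Q ** Q = (\<chi> i j. column i Q \<bullet> column j Q)"
    by (simp add: vec_eq_iff matrix_matrix_mult_def transpose_def column_def inner_vec_def)
  then show ?thesis
    unfolding orthogonal_matrix orthonormal_family_def by (auto simp: vec_eq_iff mat_def)
qed

lemma orthonormal_family_expansion:
  fixes q :: "'n \<Rightarrow> real^'n"
  assumes "orthonormal_family q"
  shows "(\<Sum>i\<in>UNIV. (x \<bullet> q i) *\<^sub>R q i) = x"
proof -
  define Q :: "real^'n^'n" where "Q = (\<chi> r i. q i $ r)"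
  have c: "column i Q = q i" for i by (simp add: Q_def column_def vec_eq_iff)
  then have "orthogonal_matrix Q"
    using assms orthonormal_family_orthogonal_matrix[of Q] by simp
  then have "Q ** transpose Q = mat 1" by (simp add: orthogonal_matrix_def)
  then have "Q *v (transpose Q *v x) = x" by (simp only: matrix_vector_mul_assoc matrix_vector_mul_lid)
  moreover have "transpose Q *v x = (\<chi> i. x \<bullet> q i)"
    by (simp add: vec_eq_iff matrix_vector_mult_def transpose_def Q_def inner_vec_def mult.commute)
  moreover have "Q *v v = (\<Sum>i\<in>UNIV. v $ i *\<^sub>R q i)" for v
    by (simp add: matrix_mult_sum c scalar_mult_eq_scaleR)
  ultimately show ?thesis by simp
qed

lemma orthonormal_family_inner:
  fixes q :: "'n \<Rightarrow> real^'n"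
  assumes "orthonormal_family q"
  shows "(\<Sum>i\<in>UNIV. (x \<bullet> q i) * (q i \<bullet> y)) = x \<bullet> y"
  using arg_cong[OF orthonormal_family_expansion[OF assms, of x], of "\<lambda>v. v \<bullet> y"]
  by (simp add: inner_sum_left)

lemma eigvals_are_iff:
  fixes A :: "real^'n^'n"
  shows "eigvals_are A lam \<longleftrightarrow> (\<exists>q. orthonormal_family q \<and> (\<forall>i. A *v q i = lam $ i *\<^sub>R q i))"
proof
  assume "eigvals_are A lam"
  then obtain Q where Q: "orthogonal_matrix Q"
    and A: "A = Q ** (\<chi> i j. if i = j then lam$i else 0) ** transpose Q"
    unfolding eigvals_are_def by blast
  have "A ** Q = Q ** (\<chi> i j. if i = j then lam$i else 0)"
    using Q unfolding A orthogonal_matrix_def by (simp add: matrix_mul_assoc[symmetric])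
  then have "A *v column i Q = lam $ i *\<^sub>R column i Q" for i
    unfolding vec_eq_iff
    by (simp add: matrix_matrix_mult_def matrix_vector_mult_def column_def if_distrib cong: if_cong)
  then show "\<exists>q. orthonormal_family q \<and> (\<forall>i. A *v q i = lam $ i *\<^sub>R q i)"
    using Q orthonormal_family_orthogonal_matrix[of Q] by (intro exI[of _ "\<lambda>i. column i Q"]) auto
next
  assume "\<exists>q. orthonormal_family q \<and> (\<forall>i. A *v q i = lam $ i *\<^sub>R q i)"
  then obtain q where q: "orthonormal_family q" and e: "\<And>i. A *v q i = lam $ i *\<^sub>R q i" by blast
  define Q :: "real^'n^'n" where "Q = (\<chi> r i. q i $ r)"
  have c: "column i Q = q i" for i by (simp add: Q_def column_def vec_eq_iff)
  then have o: "orthogonal_matrix Q"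
    using q orthonormal_family_orthogonal_matrix[of Q] by simp
  have "A ** Q = Q ** (\<chi> i j. if i = j then lam$i else 0)"
    using e unfolding vec_eq_iff
    by (simp add: matrix_matrix_mult_def matrix_vector_mult_def Q_def if_distrib cong: if_cong)
  then have "A ** Q ** transpose Q = Q ** (\<chi> i j. if i = j then lam$i else 0) ** transpose Q"
    by (rule arg_cong)
  then have "A = Q ** (\<chi> i j. if i = j then lam$i else 0) ** transpose Q"
    using o unfolding orthogonal_matrix_def by (simp add: matrix_mul_assoc[symmetric])
  with o show "eigvals_are A lam" unfolding eigvals_are_def by blast
qed

lemma eigvals_are_symmetric:
  fixes A :: "real^'n^'n"
  assumes "eigvals_are A lam"
  shows "transpose A = A"
proof -
  obtain Q where A: "A = Q ** (\<chi> i j. if i = j then lam$i else 0) ** transpose Q"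
    using assms unfolding eigvals_are_def by blast
  have "transpose ((\<chi> i j. if i = j then lam$i else 0) :: real^'n^'n) = (\<chi> i j. if i = j then lam$i else 0)"
    by (simp add: transpose_def vec_eq_iff)
  then show ?thesis unfolding A by (simp only: matrix_transpose_mul transpose_transpose matrix_mul_assoc)
qed

text \<open>Testing the eigenvalue equations of the perturbed matrix against the limiting eigenvectors
  gives the derivative of the eigenvalues even when they are multiple.\<close>

lemma eigenvalue_derivative_sequence:
  fixes A :: "nat \<Rightarrow> real^'n^'n"
  assumes eig: "\<And>k. eigvals_are (A k) (mu k)"
    and t: "\<And>k. t k > 0" "t \<longlonglongrightarrow> 0"
    and lim: "(\<lambda>k. (A k - A0) /\<^sub>R t k) \<longlonglongrightarrow> B"
  obtains r q m where "strict_mono (r :: nat \<Rightarrow> nat)" "orthonormal_family q"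
    "\<And>i. A0 *v q i = m $ i *\<^sub>R q i"
    "(\<lambda>k. mu (r k)) \<longlonglongrightarrow> m"
    "(\<lambda>k. (mu (r k) - m) /\<^sub>R t (r k)) \<longlonglongrightarrow> (\<chi> i. q i \<bullet> (B *v q i))"
proof -
  have "\<forall>k. \<exists>Q. orthonormal_family Q \<and> (\<forall>i. A k *v Q i = mu k $ i *\<^sub>R Q i)"
    using eig eigvals_are_iff by blast
  then obtain Q where on: "\<And>k. orthonormal_family (Q k)"
    and ev: "\<And>k i. A k *v Q k i = mu k $ i *\<^sub>R Q k i" by metis
  \<comment> \<open>The whole eigenframe is packed into one bounded matrix, so that a single
    subsequence serves all indices.\<close>
  define W :: "nat \<Rightarrow> real^'n^'n" where "W k = (\<chi> i. Q k i)" for k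
  have nQ: "norm (Q k i) = 1" for k i
    using on[of k] unfolding orthonormal_family_def by (simp add: norm_eq_1)
  have "norm (W k) \<le> (\<Sum>i\<in>(UNIV::'n set). 1)" for k
    using L2_set_le_sum[of UNIV "\<lambda>i. norm (W k $ i)"] unfolding norm_vec_def[of "W k"]
    by (simp add: W_def nQ)
  then have "bounded (range W)" unfolding bounded_iff by blast
  then obtain l r where r: "strict_mono (r :: nat \<Rightarrow> nat)" and Wl: "(W \<circ> r) \<longlonglongrightarrow> l"
    using bounded_imp_convergent_subsequence by blast
  define q where "q i = l $ i" for i
  have Ql: "(\<lambda>k. Q (r k) i) \<longlonglongrightarrow> q i" for i
    using tendsto_vec_nth[OF Wl, of i] by (simp add: W_def q_def comp_def)
  have onq: "orthonormal_family q"
    unfolding orthonormal_family_def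
  proof (intro allI)
    fix i j
    have "(\<lambda>k. Q (r k) i \<bullet> Q (r k) j) \<longlonglongrightarrow> q i \<bullet> q j" by (intro tendsto_intros Ql)
    moreover have "Q (r k) i \<bullet> Q (r k) j = (if i = j then 1 else 0)" for k
      using on unfolding orthonormal_family_def by blast
    ultimately show "q i \<bullet> q j = (if i = j then 1 else 0)"
      by (simp add: LIMSEQ_const_iff)
  qed
  have tr: "(\<lambda>k. t (r k)) \<longlonglongrightarrow> 0" using LIMSEQ_subseq_LIMSEQ[OF t(2) r] by (simp add: comp_def)
  have limr: "(\<lambda>k. (A (r k) - A0) /\<^sub>R t (r k)) \<longlonglongrightarrow> B"
    using LIMSEQ_subseq_LIMSEQ[OF lim r] by (simp add: comp_def)
  have Alim: "(\<lambda>k. A (r k)) \<longlonglongrightarrow> A0"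
  proof -
    have "(\<lambda>k. t (r k) *\<^sub>R ((A (r k) - A0) /\<^sub>R t (r k)) + A0) \<longlonglongrightarrow> 0 *\<^sub>R B + A0"
      by (intro tendsto_intros tr limr)
    moreover have "t (r k) *\<^sub>R ((A (r k) - A0) /\<^sub>R t (r k)) + A0 = A (r k)" for k
      using t(1)[of "r k"] by simp
    ultimately show ?thesis by simp
  qed
  have mv: "(\<lambda>k. M k *v v k) \<longlonglongrightarrow> M0 *v v0" if "M \<longlonglongrightarrow> M0" "v \<longlonglongrightarrow> v0"
    for M :: "nat \<Rightarrow> real^'n^'n" and M0 v v0
    unfolding matrix_vector_mult_def by (intro tendsto_vec_lambda tendsto_intros that)
  define m where "m = (\<chi> i. q i \<bullet> (A0 *v q i))"
  have mui: "mu k $ i = Q k i \<bullet> (A k *v Q k i)" for k i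
    using on[of k] by (simp add: ev orthonormal_family_def)
  have ml: "(\<lambda>k. mu (r k)) \<longlonglongrightarrow> m"
    unfolding m_def
    by (rule vec_tendstoI) (simp add: mui, intro tendsto_intros mv Alim Ql)
  have ev0: "A0 *v q i = m $ i *\<^sub>R q i" for i
  proof -
    have "(\<lambda>k. A (r k) *v Q (r k) i) \<longlonglongrightarrow> A0 *v q i" by (intro mv Alim Ql)
    moreover have "(\<lambda>k. A (r k) *v Q (r k) i) \<longlonglongrightarrow> m $ i *\<^sub>R q i"
      unfolding ev by (intro tendsto_intros ml Ql)
    ultimately show ?thesis by (rule LIMSEQ_unique)
  qed
  have "eigvals_are A0 m" using onq ev0 eigvals_are_iff by blast
  then have sym: "transpose A0 = A0" by (rule eigvals_are_symmetric)
  have key: "(\<lambda>k. (mu (r k) $ i - m $ i) / t (r k)) \<longlonglongrightarrow> q i \<bullet> (B *v q i)" for i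
  proof -
    have lhs: "(\<lambda>k. q i \<bullet> (((A (r k) - A0) /\<^sub>R t (r k)) *v Q (r k) i)) \<longlonglongrightarrow> q i \<bullet> (B *v q i)"
      by (intro tendsto_intros mv limr Ql)
    \<comment> \<open>Symmetry of \<open>A0\<close> moves it onto \<open>q i\<close>, and only the
      difference of the two eigenvalues survives, times an overlap that tends to 1.\<close>
    have eq: "q i \<bullet> (((A (r k) - A0) /\<^sub>R t (r k)) *v Q (r k) i)
       = (mu (r k) $ i - m $ i) / t (r k) * (q i \<bullet> Q (r k) i)" for k
    proof -
      have "q i \<bullet> (A0 *v Q (r k) i) = (A0 *v q i) \<bullet> Q (r k) i"
        using dot_lmul_matrix[of "q i" A0 "Q (r k) i"] sym by (metis transpose_matrix_vector)
      then show ?thesis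
        by (simp add: scaleR_matrix_vector_assoc[symmetric] matrix_vector_mult_diff_rdistrib inner_diff_right ev ev0
            diff_divide_distrib left_diff_distrib divide_inverse algebra_simps)
    qed
    have one: "(\<lambda>k. q i \<bullet> Q (r k) i) \<longlonglongrightarrow> 1"
      using tendsto_inner[OF tendsto_const[of "q i"] Ql[of i]] onq by (simp add: orthonormal_family_def)
    have "(\<lambda>k. (mu (r k) $ i - m $ i) / t (r k) * (q i \<bullet> Q (r k) i) / (q i \<bullet> Q (r k) i)) \<longlonglongrightarrow> (q i \<bullet> (B *v q i)) / 1"
      using lhs unfolding eq by (intro tendsto_divide one) auto
    moreover have "\<forall>\<^sub>F k in sequentially. q i \<bullet> Q (r k) i \<noteq> 0"
      using one by (rule tendsto_imp_eventually_ne) simp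
    then have "\<forall>\<^sub>F k in sequentially. (mu (r k) $ i - m $ i) / t (r k) * (q i \<bullet> Q (r k) i) / (q i \<bullet> Q (r k) i)
       = (mu (r k) $ i - m $ i) / t (r k)"
      by (rule eventually_mono) simp
    ultimately show ?thesis using Lim_transform_eventually by fastforce
  qed
  have "(\<lambda>k. (mu (r k) - m) /\<^sub>R t (r k)) \<longlonglongrightarrow> (\<chi> i. q i \<bullet> (B *v q i))"
    using key by (intro vec_tendstoI) (simp add: divide_inverse_commute)
  with r onq ev0 ml show ?thesis by (rule that)
qed

section \<open>The curvature matrix\<close>

lemma bounded_bilinear_matrix_vector_mult:
  "bounded_bilinear ((*v) :: real^'n^'m \<Rightarrow> real^'n \<Rightarrow> real^'m)"
proof -
  have "bilinear ((*v) :: real^'n^'m \<Rightarrow> real^'n \<Rightarrow> real^'m)"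
    unfolding bilinear_def
    by (auto intro!: linearI simp: matrix_vector_mult_add_rdistrib matrix_vector_right_distrib
        scaleR_matrix_vector_assoc matrix_vector_mult_scaleR)
  then show ?thesis by (simp add: bilinear_conv_bounded_bilinear)
qed

lemmas has_derivative_matrix_vector_mult [derivative_intros] =
  bounded_bilinear.FDERIV[OF bounded_bilinear_matrix_vector_mult]

lemma inner_matrix_vector_symmetric:
  fixes S :: "real^'n^'n"
  assumes "transpose S = S"
  shows "x \<bullet> (S *v y) = (S *v x) \<bullet> y"
  using dot_lmul_matrix[of x S y] assms by (metis transpose_matrix_vector)

lemma wfun_ge_1: "wfun p \<ge> 1"
  by (simp add: wfun_def)

lemma wfun_pos: "wfun p > 0"
  using wfun_ge_1[of p] by linarith

lemma wfun_square: "(wfun p)\<^sup>2 = 1 + p \<bullet> p"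
  by (simp add: wfun_def power2_norm_eq_inner add_nonneg_nonneg)

lemma gam_mult_vec:
  "gam p *v q = q - ((p \<bullet> q) / (wfun p * (wfun p + 1))) *\<^sub>R p"
proof -
  have "(gam p *v q) $ i = (\<Sum>k\<in>UNIV. (if i = k then q $ k else 0)) - p $ i * (\<Sum>k\<in>UNIV. p $ k * q $ k) / (wfun p * (wfun p + 1))" for i
    by (simp add: gam_def matrix_vector_mult_def left_diff_distrib sum_subtractf sum_distrib_left
        sum_divide_distrib if_distrib[of "\<lambda>x. x * _"] mult.assoc cong: if_cong)
  then show ?thesis by (simp add: vec_eq_iff inner_vec_def mult.commute)
qed

lemma gam_symmetric: "(gam p *v a) \<bullet> b = a \<bullet> (gam p *v b)"
  unfolding gam_mult_vec by (simp add: inner_diff_left inner_diff_right inner_commute)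

lemma inner_gam: "p \<bullet> (gam p *v q) = (p \<bullet> q) / wfun p"
proof -
  have w: "wfun p > 0" by (rule wfun_pos)
  have pp: "p \<bullet> p = (wfun p + 1) * (wfun p - 1)"
    using wfun_square[of p] by (simp add: algebra_simps power2_eq_square)
  have "wfun p + 1 \<noteq> 0" using w by simp
  then have "p \<bullet> (gam p *v q) = (p \<bullet> q) - (p \<bullet> q) * (wfun p - 1) / wfun p"
    by (simp add: gam_mult_vec inner_diff_right pp)
  also have "\<dots> = (p \<bullet> q) / wfun p" using w by (simp add: field_simps)
  finally show ?thesis .
qed

text \<open>\<open>gam p\<close> is the inverse square root of the graph metric I + p p^T: it
  divides \<open>p\<close> by w and fixes the orthogonal complement. Its inverse is I + p p^T / (w +
  1).\<close>

lemma gam_inverse: "gam p *v v + ((p \<bullet> (gam p *v v)) / (wfun p + 1)) *\<^sub>R p = v" 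
proof -
  have w: "wfun p > 0" by (rule wfun_pos)
  then have "(p \<bullet> v) / wfun p / (wfun p + 1) = (p \<bullet> v) / (wfun p * (wfun p + 1))" by simp
  then show ?thesis unfolding inner_gam by (simp add: gam_mult_vec)
qed

text \<open>The metric is the square of the inverse of \<open>gam p\<close>, so the metric composed
  with \<open>gam p\<close> is that inverse again.\<close>

lemma gam_metric:
  "gam p *v q + (p \<bullet> (gam p *v q)) *\<^sub>R p = q + ((p \<bullet> q) / (wfun p + 1)) *\<^sub>R p"
proof -
  have w: "wfun p > 0" by (rule wfun_pos)
  have "(p \<bullet> q) / wfun p = (p \<bullet> q) / (wfun p * (wfun p + 1)) + (p \<bullet> q) / (wfun p + 1)"
    using w by (simp add: divide_simps) (simp add: algebra_simps)
  then show ?thesis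
    unfolding inner_gam unfolding gam_mult_vec by (simp add: scaleR_left_distrib)
qed

lemma gam_inner_metric:
  "(gam p *v a) \<bullet> (b + ((p \<bullet> b) / (wfun p + 1)) *\<^sub>R p) = a \<bullet> b"
proof -
  have "gam p *v (b + ((p \<bullet> b) / (wfun p + 1)) *\<^sub>R p) = b"
  proof -
    have w: "wfun p > 0" by (rule wfun_pos)
    have pp: "p \<bullet> p = (wfun p + 1) * (wfun p - 1)"
      using wfun_square[of p] by (simp add: algebra_simps power2_eq_square)
    have "(p \<bullet> b) / (wfun p + 1) * (p \<bullet> p) = (p \<bullet> b) * (wfun p - 1)"
      using w unfolding pp by simp
    then have "p \<bullet> (b + ((p \<bullet> b) / (wfun p + 1)) *\<^sub>R p) = (p \<bullet> b) * wfun p"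
      by (simp add: inner_add_right algebra_simps)
    then show ?thesis
      unfolding gam_mult_vec using w by simp
  qed
  then show ?thesis by (simp add: gam_symmetric)
qed

text \<open>Vectors \<open>gam p *v q\<close> with unit \<open>q\<close> are unit vectors for the
  metric I + p p^T. They are the directions in which the second-order condition is tested.\<close>

lemma gam_unit: 
  assumes "q \<bullet> q = 1"
  shows "(gam p *v q) \<bullet> (gam p *v q) + (p \<bullet> (gam p *v q))\<^sup>2 = 1"
  using gam_inner_metric[of p q q] assms unfolding gam_metric[symmetric]
  by (simp add: inner_add_right power2_eq_square inner_commute)

lemma curv_mat_mult_vec:
  "curv_mat z p S *v q = (1 / wfun p) *\<^sub>R (gam p *v (gam p *v q + (p \<bullet> (gam p *v q)) *\<^sub>R p + z *\<^sub>R (S *v (gam p *v q))))"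
proof -
  have "(\<chi> k l. p$k * p$l) *v v = (p \<bullet> v) *\<^sub>R p" for v
    by (simp add: vec_eq_iff matrix_vector_mult_def inner_vec_def sum_distrib_left mult.commute mult.left_commute)
  then show ?thesis
    unfolding curv_mat_def
    by (simp add: scaleR_matrix_vector_assoc[symmetric] matrix_vector_mul_assoc[symmetric] matrix_vector_mult_add_rdistrib)
qed

lemma curv_mat_quadratic:
  assumes "q \<bullet> q = 1"
  shows "q \<bullet> (curv_mat z p S *v q) = (1 + z * ((gam p *v q) \<bullet> (S *v (gam p *v q)))) / wfun p"
proof -
  have "q \<bullet> (curv_mat z p S *v q)
     = ((gam p *v q) \<bullet> (gam p *v q) + (p \<bullet> (gam p *v q))\<^sup>2 + z * ((gam p *v q) \<bullet> (S *v (gam p *v q)))) / wfun p"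
    unfolding curv_mat_mult_vec inner_scaleR_right gam_symmetric[where a = q, symmetric]
    by (simp add: inner_add_right power2_eq_square inner_commute[of "gam p *v q" p])
  then show ?thesis using gam_unit[OF assms] by simp
qed

text \<open>The inverse of \<open>gam p\<close> is applied to the eigenvalue equation. The factor
  \<open>wfun p * l - 1\<close>, later called \<open>y\<close>, replaces the curvature in all
  estimates; \<open>l < 0\<close> is the same as \<open>y < -1\<close>.\<close>

lemma curv_mat_eigenvector:
  assumes "curv_mat z p S *v q = l *\<^sub>R q"
  shows "z *\<^sub>R (S *v (gam p *v q)) = (wfun p * l - 1) *\<^sub>R (q + ((p \<bullet> q) / (wfun p + 1)) *\<^sub>R p)"
proof -
  define \<eta> where "\<eta> = q + ((p \<bullet> q) / (wfun p + 1)) *\<^sub>R p"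
  define v where "v = \<eta> + z *\<^sub>R (S *v (gam p *v q))"
  have "(1 / wfun p) *\<^sub>R (gam p *v v) = l *\<^sub>R q"
    using assms unfolding curv_mat_mult_vec gam_metric v_def \<eta>_def .
  then have "wfun p *\<^sub>R ((1 / wfun p) *\<^sub>R (gam p *v v)) = (wfun p * l) *\<^sub>R q" by simp
  then have g: "gam p *v v = (wfun p * l) *\<^sub>R q" using wfun_pos[of p] by simp
  have "v = (wfun p * l) *\<^sub>R \<eta>"
    using gam_inverse[of p v] unfolding g \<eta>_def by (simp add: scaleR_add_right)
  then have "z *\<^sub>R (S *v (gam p *v q)) = (wfun p * l) *\<^sub>R \<eta> - \<eta>"
    unfolding v_def by (simp add: eq_diff_eq add.commute)
  then show ?thesis unfolding \<eta>_def by (simp add: scaleR_left_diff_distrib)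
qed

lemma wfun_has_derivative:
  fixes P :: "real \<Rightarrow> real^'n"
  assumes P: "(P has_derivative (\<lambda>h. h *\<^sub>R P')) (at t)"
  shows "((\<lambda>t. wfun (P t)) has_derivative (\<lambda>h. h * ((P t \<bullet> P') / wfun (P t)))) (at t)"
proof -
  have pos: "1 + P t \<bullet> P t > 0" by (simp add: add_pos_nonneg)
  have W: "wfun v = sqrt (1 + v \<bullet> v)" for v :: "real^'n" by (simp add: wfun_def power2_norm_eq_inner)
  have "((\<lambda>t. 1 + P t \<bullet> P t) has_derivative (\<lambda>h. h * (2 * (P t \<bullet> P')))) (at t)"
    by (rule has_derivative_eq_rhs[OF has_derivative_add[OF has_derivative_const has_derivative_inner[OF P P]]])
      (simp add: inner_commute fun_eq_iff)
  then have 1: "((\<lambda>t. sqrt (1 + P t \<bullet> P t)) has_derivative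
      (\<lambda>h. (inverse (sqrt (1 + P t \<bullet> P t)) / 2) * (h * (2 * (P t \<bullet> P'))))) (at t)"
    by (rule has_derivative_compose) (rule DERIV_real_sqrt[OF pos, unfolded has_field_derivative_def])
  have 2: "(inverse (sqrt (1 + P t \<bullet> P t)) / 2) * (h * (2 * (P t \<bullet> P'))) = h * ((P t \<bullet> P') / wfun (P t))" for h
    unfolding W by (simp add: field_simps)
  show ?thesis using 1 unfolding 2 unfolding W[symmetric] .
qed

text \<open>Trades the third-order quantity of the second-order condition for \<open>a\<close>, the
  derivative of a diagonal entry of the curvature matrix, which the linearised equation controls.
  The eigenvector \<open>q\<close> stays fixed; only its image under the varying \<open>gam\<close>
  moves.\<close>

lemma curv_mat_derivative_identity:
  fixes P :: "real \<Rightarrow> real^'n" and Sg :: "real \<Rightarrow> real^'n^'n"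
  assumes P: "(P has_derivative (\<lambda>t. t *\<^sub>R (S *v p))) (at 0)" and P0: "P 0 = p"
    and Z: "(Z has_derivative (\<lambda>t. t * (p \<bullet> p))) (at 0)" and Z0: "Z 0 = z" "z > 0"
    and Sg: "(Sg has_derivative (\<lambda>t. t *\<^sub>R T)) (at 0)" and S0: "Sg 0 = S"
    and sym: "transpose S = S"
    and q: "q \<bullet> q = 1" and ev: "curv_mat z p S *v q = l *\<^sub>R q"
    and a: "((\<lambda>t. q \<bullet> (curv_mat (Z t) (P t) (Sg t) *v q)) has_derivative (\<lambda>t. t * a)) (at 0)"
  shows "z * ((gam p *v q) \<bullet> (T *v (gam p *v q))) = wfun p * a + l * (p \<bullet> (S *v p)) / wfun p
     - (p \<bullet> p) * (wfun p * l - 1) / z + 2 * (wfun p * l - 1)\<^sup>2 * (p \<bullet> q)\<^sup>2 / z"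
proof -
  define w where "w = wfun p"
  define y where "y = w * l - 1"
  define c where "c = p \<bullet> q"
  define \<xi> where "\<xi> = gam p *v q"
  define \<eta> where "\<eta> = q + (c / (w + 1)) *\<^sub>R p"
  have w: "w > 0" "w \<ge> 1" using wfun_pos wfun_ge_1 by (auto simp: w_def)
  have w2: "w\<^sup>2 = 1 + p \<bullet> p" by (simp add: w_def wfun_square)
  have Sxi: "z *\<^sub>R (S *v \<xi>) = y *\<^sub>R \<eta>"
    using curv_mat_eigenvector[OF ev] by (simp add: \<xi>_def y_def \<eta>_def w_def c_def)
  have Sxi': "S *v \<xi> = (y / z) *\<^sub>R \<eta>"
  proof -
    have "(1/z) *\<^sub>R (z *\<^sub>R (S *v \<xi>)) = (1/z) *\<^sub>R (y *\<^sub>R \<eta>)" by (simp only: Sxi)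
    then show ?thesis using Z0(2) by simp
  qed
  have pxi: "p \<bullet> \<xi> = c / w" by (simp add: \<xi>_def inner_gam c_def w_def)
  have xe: "\<xi> \<bullet> \<eta> = 1" using gam_inner_metric[of p q q] q by (simp add: \<xi>_def \<eta>_def c_def w_def)
  have eta: "\<eta> = \<xi> + (c / w) *\<^sub>R p"
    using gam_metric[of p q] by (simp add: \<xi>_def \<eta>_def c_def w_def inner_gam)
  have peta: "p \<bullet> \<eta> = w * c"
  proof -
    have "p \<bullet> \<eta> = c / w * (1 + p \<bullet> p)" by (simp add: eta inner_add_right pxi algebra_simps)
    also have "\<dots> = w * c" using w unfolding w2[symmetric] by (simp add: power2_eq_square)
    finally show ?thesis .
  qed
  define W where "W t = wfun (P t)" for t
  have W0: "W 0 = w" by (simp add: W_def P0 w_def)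
  have Wd: "(W has_derivative (\<lambda>t. t * ((p \<bullet> (S *v p)) / w))) (at 0)"
    using wfun_has_derivative[OF P] unfolding W_def[abs_def] P0 w_def .
  define X where "X t = q - ((P t \<bullet> q) / (W t * (W t + 1))) *\<^sub>R P t" for t
  have Xg: "X t = gam (P t) *v q" for t by (simp add: X_def gam_mult_vec W_def)
  have X0: "X 0 = \<xi>" by (simp add: Xg P0 \<xi>_def)
  have nz: "W 0 * (W 0 + 1) \<noteq> 0" using W0 w by simp
  have "\<exists>D. (X has_derivative D) (at 0)"
    unfolding X_def[abs_def]
    by (rule exI, rule has_derivative_diff[OF has_derivative_const has_derivative_scaleR[OF has_derivative_divide[OF
        has_derivative_inner[OF P has_derivative_const]
        has_derivative_mult[OF Wd has_derivative_add[OF Wd has_derivative_const]] nz] P]])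
  then obtain D where D: "(X has_derivative D) (at 0)" by blast
  define X' where "X' = D 1"
  have "D t = t *\<^sub>R D 1" for t
    using linear_cmul[OF has_derivative_linear[OF D], of t 1] unfolding real_scaleR_def mult_1_right .
  then have Dt: "D = (\<lambda>t. t *\<^sub>R X')" unfolding X'_def by (rule ext)
  have Xd: "(X has_derivative (\<lambda>t. t *\<^sub>R X')) (at 0)" using D unfolding Dt .
  \<comment> \<open>The Hessian maps \<open>\<xi>\<close> to a multiple of \<open>\<eta>\<close>, so
    only the pairing of \<open>X'\<close> with \<open>\<eta>\<close> matters. Differentiating the
    metric normalisation yields this pairing, without a formula for the derivative of
    \<open>gam\<close>.\<close>
  have one: "X t \<bullet> X t + (P t \<bullet> X t)\<^sup>2 = 1" for t unfolding Xg by (rule gam_unit[OF q])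
  have "((\<lambda>t. X t \<bullet> X t + (P t \<bullet> X t)\<^sup>2) has_derivative
      (\<lambda>t. t * (2 * (\<xi> \<bullet> X') + 2 * (p \<bullet> \<xi>) * ((S *v p) \<bullet> \<xi> + p \<bullet> X')))) (at 0)"
    unfolding power2_eq_square
    apply (rule has_derivative_eq_rhs)
     apply (rule has_derivative_add has_derivative_mult has_derivative_inner Xd P)+
    apply (rule ext)
    apply (simp add: P0 X0 inner_commute[of X' \<xi>] algebra_simps)
    done
  then have "(\<lambda>t::real. t * (2 * (\<xi> \<bullet> X') + 2 * (p \<bullet> \<xi>) * ((S *v p) \<bullet> \<xi> + p \<bullet> X'))) = (\<lambda>t. 0)"
    unfolding one by (rule has_derivative_unique) (rule has_derivative_const)
  from fun_cong[OF this, of 1]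
  have r0: "\<xi> \<bullet> X' + (p \<bullet> \<xi>) * ((S *v p) \<bullet> \<xi> + p \<bullet> X') = 0" by simp
  have Spxi: "(S *v p) \<bullet> \<xi> = y * w * c / z"
    using inner_matrix_vector_symmetric[OF sym, of p \<xi>] by (simp add: Sxi' peta algebra_simps)
  have Xeta: "X' \<bullet> \<eta> = - (y * c\<^sup>2 / z)"
  proof -
    have "X' \<bullet> \<eta> = \<xi> \<bullet> X' + (p \<bullet> \<xi>) * (p \<bullet> X')"
      by (simp add: eta inner_add_right pxi inner_commute[of X' \<xi>] inner_commute[of X' p])
    also have "\<dots> = - (p \<bullet> \<xi>) * ((S *v p) \<bullet> \<xi>)" using r0 by (simp add: algebra_simps)
    also have "\<dots> = - (y * c\<^sup>2 / z)" unfolding pxi Spxi using w by (simp add: power2_eq_square)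
    finally show ?thesis .
  qed
  have quad: "q \<bullet> (curv_mat (Z t) (P t) (Sg t) *v q) = (1 + Z t * (X t \<bullet> (Sg t *v X t))) / W t" for t
    unfolding Xg W_def by (rule curv_mat_quadratic[OF q])
  have xSx: "\<xi> \<bullet> (S *v \<xi>) = y / z" by (simp add: Sxi' xe)
  have xSX: "\<xi> \<bullet> (S *v X') = - (y\<^sup>2 * c\<^sup>2 / z\<^sup>2)" "X' \<bullet> (S *v \<xi>) = - (y\<^sup>2 * c\<^sup>2 / z\<^sup>2)"
    using inner_matrix_vector_symmetric[OF sym, of \<xi> X'] Xeta
    by (simp_all add: Sxi' inner_commute power2_eq_square)
  define b where "b = \<xi> \<bullet> (T *v \<xi>)"
  have y1: "1 + z * (y / z) = w * l" using Z0 by (simp add: y_def)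
  have "((\<lambda>t. q \<bullet> (curv_mat (Z t) (P t) (Sg t) *v q)) has_derivative
     (\<lambda>t. t * (((p \<bullet> p) * (y / z) + z * (b - 2 * (y\<^sup>2 * c\<^sup>2 / z\<^sup>2))) / w - (w * l) * ((p \<bullet> (S *v p)) / w) / w\<^sup>2))) (at 0)"
    unfolding quad
    apply (rule has_derivative_eq_rhs)
     apply (rule has_derivative_divide has_derivative_add has_derivative_const has_derivative_mult Z
          has_derivative_inner Xd has_derivative_matrix_vector_mult Sg Wd)+
     apply (use W0 w in simp)
    apply (rule ext)
    using w apply (simp add: P0 X0 W0 S0 Z0 xSx xSX matrix_vector_mult_scaleR
       scaleR_matrix_vector_assoc[symmetric] inner_add_right b_def[symmetric] y1[simplified] field_simps power2_eq_square)
    done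
  from has_derivative_unique[OF this a]
  have "((p \<bullet> p) * (y / z) + z * (b - 2 * (y\<^sup>2 * c\<^sup>2 / z\<^sup>2))) / w - (w * l) * ((p \<bullet> (S *v p)) / w) / w\<^sup>2 = a"
    by (metis mult_1)
  moreover have "w * (K / w - (w * l) * (B / w) / w\<^sup>2) = K - l * B / w" for K B
    using w by (simp add: field_simps power2_eq_square)
  ultimately have "w * a = (p \<bullet> p) * (y / z) + z * (b - 2 * (y\<^sup>2 * c\<^sup>2 / z\<^sup>2)) - l * (p \<bullet> (S *v p)) / w"
    by metis
  moreover have "z * (b - 2 * (y\<^sup>2 * c\<^sup>2 / z\<^sup>2)) = z * b - 2 * y\<^sup>2 * c\<^sup>2 / z"
    using Z0 by (simp add: right_diff_distrib) (simp add: power2_eq_square)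
  ultimately have "z * b = w * a + l * (p \<bullet> (S *v p)) / w - (p \<bullet> p) * y / z + 2 * y\<^sup>2 * c\<^sup>2 / z"
    by simp
  then show ?thesis by (simp add: b_def \<xi>_def w_def y_def c_def)
qed

section \<open>Linearisation of the curvature equation\<close>

lemma blinfun_apply_cart_sum:
  fixes D :: "(real^'n) \<Rightarrow>\<^sub>L real"
  shows "D v = (\<Sum>i\<in>UNIV. D (axis i 1) * v $ i)"
proof -
  have "v = (\<Sum>i\<in>UNIV. v $ i *\<^sub>R axis i 1)"
    by (simp add: vec_eq_iff axis_def if_distrib cong: if_cong)
  then have "D v = D (\<Sum>i\<in>UNIV. v $ i *\<^sub>R axis i 1)" by simp
  also have "\<dots> = (\<Sum>i\<in>UNIV. D (axis i 1) * v $ i)"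
    by (simp add: blinfun.sum_right blinfun.scaleR_right mult.commute)
  finally show ?thesis .
qed

text \<open>Weights \<open>\<phi>\<close>, one for each eigenvalue in \<open>\<mu>\<close>, and the factor \<open>H\<close> of the right-hand side for
  the equation linearised at a point, where it takes the value \<open>y\<close>. At an interior point of the
  cone \<open>\<phi>\<close> is the gradient of \<open>f\<close> and \<open>H = 1\<close>; at degenerate points \<open>H = 0\<close> may occur.\<close>

definition linearised_weights :: "real \<Rightarrow> real \<Rightarrow> real \<Rightarrow> real \<Rightarrow> real^'n \<Rightarrow> real^'n \<Rightarrow> real \<Rightarrow> bool" where
  "linearised_weights \<delta> c f0 y \<mu> \<phi> H \<longleftrightarrow>
     (\<forall>i. 0 \<le> \<phi> $ i) \<and> 0 \<le> H \<and> 0 \<le> \<phi> \<bullet> \<mu> \<and> \<phi> \<bullet> \<mu> \<le> H * (y - f0) \<and>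
     H * c \<le> (\<Sum>i\<in>UNIV. \<phi> $ i) + H * (y - f0) - \<phi> \<bullet> \<mu> \<and>
     (\<forall>j. \<mu> $ j < 0 \<longrightarrow> 2 * \<delta> * (\<Sum>i\<in>UNIV. \<phi> $ i) \<le> \<phi> $ j)"

locale curvature_function =
  fixes f :: "real^'n \<Rightarrow> real" and \<Gamma> :: "(real^'n) set"
    and Df :: "real^'n \<Rightarrow> ((real^'n) \<Rightarrow>\<^sub>L real)" and \<delta> :: real
  assumes cone: "admissible_cone \<Gamma>"
    and deriv: "\<And>l. l \<in> \<Gamma> \<Longrightarrow> (f has_derivative blinfun_apply (Df l)) (at l)"
    and nonneg: "\<And>l i. l \<in> \<Gamma> \<Longrightarrow> Df l (axis i 1) \<ge> 0"
    and concave: "concave_on \<Gamma> f"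
    and delta: "0 < \<delta>" "\<delta> < 1/2"
    and negative: "\<And>l j. l \<in> \<Gamma> \<Longrightarrow> l $ j < 0 \<Longrightarrow> Df l (axis j 1) > 2 * \<delta> * (\<Sum>i\<in>UNIV. Df l (axis i 1))"
    and ray_mono: "\<And>l. l \<in> \<Gamma> \<Longrightarrow> strict_mono_on {0<..} (\<lambda>t. f (t *\<^sub>R l))"
begin

lemma open_cone: "open \<Gamma>" and convex_cone: "convex \<Gamma>" and zero_notin_cone: "0 \<notin> \<Gamma>"
  and pos_cone_subset: "pos_cone \<subseteq> \<Gamma>" and scale_cone: "l \<in> \<Gamma> \<Longrightarrow> t > 0 \<Longrightarrow> t *\<^sub>R l \<in> \<Gamma>"
  using cone unfolding admissible_cone_def by auto

lemma one_in_cone: "(1 :: real^'n) \<in> \<Gamma>"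
  using pos_cone_subset by (auto simp: pos_cone_def)

lemma tangent_above:
  assumes l: "l \<in> \<Gamma>" and m: "m \<in> \<Gamma>"
  shows "f m \<le> f l + Df l (m - l)"
proof -
  define t where "t k = 1 / (real k + 2)" for k :: nat
  have t: "t k > 0" "t k \<le> 1" for k by (auto simp: t_def)
  have t0: "t \<longlonglongrightarrow> 0" unfolding t_def by real_asymp
  have "(\<lambda>k. (f (l + t k *\<^sub>R (m - l)) - f l) /\<^sub>R t k) \<longlonglongrightarrow> Df l (m - l)"
    by (rule has_derivative_sequentially[OF deriv[OF l], where t = t]) (use t t0 less_imp_neq[OF t(1), symmetric] in auto)
  moreover have "f m - f l \<le> (f (l + t k *\<^sub>R (m - l)) - f l) /\<^sub>R t k" for k
  proof -
    have "(1 - t k) * f l + t k * f m \<le> f ((1 - t k) *\<^sub>R l + t k *\<^sub>R m)"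
      using concave l m t[of k] unfolding concave_on_iff by auto
    then have "t k * (f m - f l) \<le> f (l + t k *\<^sub>R (m - l)) - f l"
      by (simp add: algebra_simps)
    then show ?thesis using t[of k] by (simp add: field_simps)
  qed
  ultimately have "f m - f l \<le> Df l (m - l)" by (intro LIMSEQ_le_const) auto
  then show ?thesis by simp
qed

lemma radial_derivative_nonneg:
  assumes l: "l \<in> \<Gamma>"
  shows "0 \<le> Df l l"
proof -
  define t where "t k = 1 / (real k + 2)" for k :: nat
  have t: "t k > 0" for k by (auto simp: t_def)
  have t0: "t \<longlonglongrightarrow> 0" unfolding t_def by real_asymp
  have "(\<lambda>k. (f (l + t k *\<^sub>R l) - f l) /\<^sub>R t k) \<longlonglongrightarrow> Df l l"
    by (rule has_derivative_sequentially[OF deriv[OF l], where t = t]) (use t t0 less_imp_neq[OF t, symmetric] in auto)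
  moreover have "0 \<le> (f (l + t k *\<^sub>R l) - f l) /\<^sub>R t k" for k
  proof -
    have "f (1 *\<^sub>R l) < f ((1 + t k) *\<^sub>R l)"
      using strict_mono_onD[OF ray_mono[OF l], of 1 "1 + t k"] t[of k] by simp
    then show ?thesis using t[of k] by (simp add: scaleR_left_distrib)
  qed
  ultimately show ?thesis by (intro LIMSEQ_le_const) auto
qed

definition f0 :: ereal where "f0 = Limsup (at 0 within \<Gamma>) (\<lambda>m. ereal (f m))"

text \<open>The tangent plane at \<open>l\<close> lies above \<open>f\<close> by concavity, and the
  right-hand side is its value at the origin.\<close>

lemma f0_le:
  assumes l: "l \<in> \<Gamma>"
  shows "f0 \<le> ereal (f l - Df l l)"
proof (rule ereal_le_epsilon2)
  fix e :: real assume e: "e > 0"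
  have "((\<lambda>m. blinfun_apply (Df l) m) \<longlongrightarrow> Df l 0) (at 0 within \<Gamma>)"
    by (intro tendsto_intros)
  then have "\<forall>\<^sub>F m in at 0 within \<Gamma>. Df l m < e"
    using e by (auto dest: order_tendstoD)
  moreover have "\<forall>\<^sub>F m in at 0 within \<Gamma>. m \<in> \<Gamma>"
    by (auto simp: eventually_at_filter)
  ultimately have "\<forall>\<^sub>F m in at 0 within \<Gamma>. ereal (f m) \<le> ereal (f l - Df l l) + ereal e"
  proof eventually_elim
    case (elim m)
    then show ?case using tangent_above[OF l, of m] by (simp add: blinfun.diff_right)
  qed
  then show "f0 \<le> ereal (f l - Df l l) + ereal e"
    unfolding f0_def by (rule Limsup_bounded)
qed

definition gap :: real where "gap = f 1 - real_of_ereal f0"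

text \<open>Strictness comes from (iv) between the diagonal points 1/2 and 1; the tangent plane at 1
  alone would only give \<open>gap \<ge> 0\<close>.\<close>

lemma gap_pos:
  assumes "\<bar>f0\<bar> \<noteq> \<infinity>"
  shows "gap > 0"
proof -
  have h: "(1/2) *\<^sub>R (1 :: real^'n) \<in> \<Gamma>" using one_in_cone scale_cone by simp
  have "f0 \<le> ereal (f ((1/2) *\<^sub>R 1) - Df ((1/2) *\<^sub>R 1) ((1/2) *\<^sub>R 1))" by (rule f0_le[OF h])
  then have "real_of_ereal f0 \<le> f ((1/2) *\<^sub>R 1) - Df ((1/2) *\<^sub>R 1) ((1/2) *\<^sub>R 1)"
    using assms by (cases f0) auto
  also have "\<dots> \<le> f ((1/2) *\<^sub>R 1)" using radial_derivative_nonneg[OF h] by simp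
  also have "\<dots> < f (1 *\<^sub>R 1)"
    using strict_mono_onD[OF ray_mono[OF one_in_cone], of "1/2" 1] by simp
  finally show ?thesis by (simp add: gap_def)
qed

text \<open>The factor \<open>H\<close> is free because near degenerate points the equation is used
  in the form h o f, whose gradient is h'(f l) times that of \<open>f\<close>. The tangent plane at
  \<open>l\<close>, evaluated at the origin and at 1, gives the two inequalities that involve the
  value \<open>f l\<close>.\<close>

lemma linearised_weights_interior:
  assumes l: "l \<in> \<Gamma>" and fin: "\<bar>f0\<bar> \<noteq> \<infinity>" and H: "H \<ge> 0"
  shows "linearised_weights \<delta> gap (real_of_ereal f0) (f l) l (\<chi> i. H * Df l (axis i 1)) H"
proof -
  have E: "(\<chi> i. H * Df l (axis i 1)) \<bullet> l = H * Df l l"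
    by (simp add: blinfun_apply_cart_sum[of "Df l" l] inner_vec_def sum_distrib_left mult.assoc)
  have "Df l 1 = (\<Sum>i\<in>UNIV. Df l (axis i 1))"
    by (simp add: blinfun_apply_cart_sum[of "Df l" 1])
  then have tau: "(\<Sum>i\<in>UNIV. H * Df l (axis i 1)) = H * Df l 1" by (simp add: sum_distrib_left)
  have 1: "Df l l \<le> f l - real_of_ereal f0"
    using f0_le[OF l] fin by (cases f0) auto
  have 2: "gap \<le> Df l 1 + (f l - real_of_ereal f0) - Df l l"
    using tangent_above[OF l one_in_cone] by (simp add: gap_def blinfun.diff_right)
  have 3: "H * gap \<le> H * Df l 1 + H * (f l - real_of_ereal f0) - H * Df l l"
    using mult_left_mono[OF 2 H] by (simp add: algebra_simps)
  have 4: "2 * \<delta> * (H * Df l 1) \<le> H * Df l (axis j 1)" if "l $ j < 0" for j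
  proof -
    have "2 * \<delta> * Df l 1 \<le> Df l (axis j 1)"
      using negative[OF l that] \<open>Df l 1 = _\<close> by simp
    from mult_left_mono[OF this H] show ?thesis by (simp add: algebra_simps)
  qed
  show ?thesis
    unfolding linearised_weights_def E
    using nonneg[OF l] H radial_derivative_nonneg[OF l] mult_left_mono[OF 1 H] 3 4
    by (simp add: tau)
qed

end

text \<open>All clauses are weak inequalities, and the premise \<open>\<mu> $ j < 0\<close> is an
  open condition that passes to the tail of the sequence. Degenerate points can thus inherit weights
  from the interior of the cone.\<close>

lemma linearised_weights_limit:
  assumes "\<And>k. linearised_weights \<delta> c a (y k) (\<mu> k) (\<phi> k) (H k)"
    and y: "y \<longlonglongrightarrow> y0" and mu: "\<mu> \<longlonglongrightarrow> \<mu>0" and phi: "\<phi> \<longlonglongrightarrow> \<phi>0" and H: "H \<longlonglongrightarrow> H0"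
  shows "linearised_weights \<delta> c a y0 \<mu>0 \<phi>0 H0"
proof -
  have lw: "0 \<le> \<phi> k $ i" "0 \<le> H k" "0 \<le> \<phi> k \<bullet> \<mu> k" "\<phi> k \<bullet> \<mu> k \<le> H k * (y k - a)"
     "H k * c \<le> (\<Sum>i\<in>UNIV. \<phi> k $ i) + H k * (y k - a) - \<phi> k \<bullet> \<mu> k"
     "\<mu> k $ j < 0 \<Longrightarrow> 2 * \<delta> * (\<Sum>i\<in>UNIV. \<phi> k $ i) \<le> \<phi> k $ j" for k i j
    using assms(1)[of k] unfolding linearised_weights_def by auto
  have "2 * \<delta> * (\<Sum>i\<in>UNIV. \<phi>0 $ i) \<le> \<phi>0 $ j" if "\<mu>0 $ j < 0" for j
  proof (rule tendsto_le[of sequentially])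
    show "(\<lambda>k. 2 * \<delta> * (\<Sum>i\<in>UNIV. \<phi> k $ i)) \<longlonglongrightarrow> 2 * \<delta> * (\<Sum>i\<in>UNIV. \<phi>0 $ i)"
      "(\<lambda>k. \<phi> k $ j) \<longlonglongrightarrow> \<phi>0 $ j"
      by (intro tendsto_intros phi)+
    have "\<forall>\<^sub>F k in sequentially. \<mu> k $ j < 0"
      using tendsto_vec_nth[OF mu, of j] that by (rule order_tendstoD)
    then show "\<forall>\<^sub>F k in sequentially. 2 * \<delta> * (\<Sum>i\<in>UNIV. \<phi> k $ i) \<le> \<phi> k $ j"
      by (rule eventually_mono) (rule lw)
  qed simp
  moreover have "0 \<le> \<phi>0 $ i" for i
    by (rule LIMSEQ_le_const[OF tendsto_vec_nth[OF phi]]) (use lw in auto)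
  moreover have "0 \<le> H0"
    by (rule LIMSEQ_le_const[OF H]) (use lw in auto)
  moreover have "0 \<le> \<phi>0 \<bullet> \<mu>0"
    by (rule LIMSEQ_le_const[OF tendsto_inner[OF phi mu]]) (use lw in auto)
  moreover have "\<phi>0 \<bullet> \<mu>0 \<le> H0 * (y0 - a)"
    by (rule LIMSEQ_le[of "\<lambda>k. \<phi> k \<bullet> \<mu> k" _ "\<lambda>k. H k * (y k - a)"])
      (use lw in \<open>auto intro!: tendsto_intros phi mu y H\<close>)
  moreover have "H0 * c \<le> (\<Sum>i\<in>UNIV. \<phi>0 $ i) + H0 * (y0 - a) - \<phi>0 \<bullet> \<mu>0"
    by (rule LIMSEQ_le[of "\<lambda>k. H k * c" _ "\<lambda>k. (\<Sum>i\<in>UNIV. \<phi> k $ i) + H k * (y k - a) - \<phi> k \<bullet> \<mu> k"])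
      (use lw in \<open>auto intro!: tendsto_intros phi mu y H\<close>)
  ultimately show ?thesis unfolding linearised_weights_def by blast
qed

lemma strict_mono_tendsto_cancel:
  fixes h :: "real \<Rightarrow> real"
  assumes "strict_mono h" and lim: "((\<lambda>x. h (g x)) \<longlongrightarrow> h y) F"
  shows "(g \<longlongrightarrow> y) F"
proof (rule order_tendstoI)
  fix a assume "a < y"
  then have "h a < h y" using assms(1) by (simp add: strict_mono_less)
  from order_tendstoD(1)[OF lim this] show "\<forall>\<^sub>F x in F. a < g x"
    using assms(1) by (simp add: strict_mono_less)
next
  fix a assume "y < a"
  then have "h y < h a" using assms(1) by (simp add: strict_mono_less)
  from order_tendstoD(2)[OF lim this] show "\<forall>\<^sub>F x in F. g x < a"
    using assms(1) by (simp add: strict_mono_less)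
qed

context curvature_function
begin

text \<open>Where the eigenvalues are nonnegative on the boundary of the cone, nothing is known about
  derivatives of the equation; there a supporting hyperplane of the cone serves as its linearisation,
  because the curvatures stay in the closed cone.\<close>

lemma support_weights:
  assumes m: "m \<in> closure \<Gamma>" "m \<notin> \<Gamma>"
  obtains a where "\<And>i. 0 \<le> a $ i" "(\<Sum>i\<in>UNIV. a $ i) > 0" "a \<bullet> m = 0" "\<And>l. l \<in> closure \<Gamma> \<Longrightarrow> 0 \<le> a \<bullet> l"
proof -
  obtain a where a: "a \<noteq> 0" "\<And>y. y \<in> closure \<Gamma> \<Longrightarrow> a \<bullet> m \<le> a \<bullet> y"
    using supporting_hyperplane_relative_frontier[OF convex_cone m(1)] m(2) rel_interior_open[OF open_cone]
    by metis
  have sc: "a \<bullet> m \<le> t * (a \<bullet> l)" if "l \<in> \<Gamma>" "t > 0" for l t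
    using a(2)[of "t *\<^sub>R l"] scale_cone[OF that] closure_subset by auto
  \<comment> \<open>Shrinking a point of the cone towards the vertex shows that the supporting value
    is at most 0; stretching, in the next step, excludes negative values on the cone.\<close>
  have am: "a \<bullet> m \<le> 0"
  proof -
    have "(\<lambda>k. (1 / (real k + 1)) * (a \<bullet> 1)) \<longlonglongrightarrow> 0 * (a \<bullet> 1)"
      by (intro tendsto_intros) real_asymp
    then have "a \<bullet> m \<le> 0 * (a \<bullet> 1)"
      by (rule LIMSEQ_le_const) (intro exI allI impI sc[OF one_in_cone], simp)
    then show ?thesis by simp
  qed
  have ge: "0 \<le> a \<bullet> l" if "l \<in> \<Gamma>" for l
  proof (rule ccontr)
    assume n: "\<not> 0 \<le> a \<bullet> l"
    define t where "t = (a \<bullet> m - 1) / (a \<bullet> l)"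
    have "t > 0" using n am by (auto simp: t_def divide_neg_neg)
    from sc[OF that this] n show False by (simp add: t_def)
  qed
  have gec: "0 \<le> a \<bullet> l" if "l \<in> closure \<Gamma>" for l
  proof -
    have "closure \<Gamma> \<subseteq> {l. a \<bullet> l \<ge> 0}"
      by (rule closure_minimal) (use ge closed_halfspace_ge in auto)
    then show ?thesis using that by auto
  qed
  \<comment> \<open>The coordinate axes are limits of positive vectors, so the normal of the
    hyperplane is a vector of weights.\<close>
  have ai: "0 \<le> a $ i" for i
  proof -
    have "(\<lambda>k. (axis i 1 :: real^'n) + (1 / (real k + 1)) *\<^sub>R 1) \<longlonglongrightarrow> axis i 1 + 0 *\<^sub>R 1"
      by (intro tendsto_intros) real_asymp
    moreover have "(axis i 1 :: real^'n) + (1 / (real k + 1)) *\<^sub>R 1 \<in> \<Gamma>" for k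
      using pos_cone_subset by (auto simp: pos_cone_def axis_def add_nonneg_pos)
    ultimately have "axis i 1 \<in> closure \<Gamma>"
      unfolding closure_sequential by (intro exI conjI allI) auto
    from gec[OF this] show ?thesis by (simp add: inner_axis)
  qed
  have "\<exists>i. a $ i \<noteq> 0" using a(1) by (auto simp: vec_eq_iff)
  then obtain i where "a $ i > 0" using ai by (metis less_le)
  then have "(\<Sum>i\<in>UNIV. a $ i) > 0" using ai by (intro sum_pos2[of UNIV i]) auto
  moreover have "a \<bullet> m = 0" using am gec[OF m(1)] by simp
  ultimately show ?thesis using that ai gec by blast
qed

end

text \<open>A strictly increasing function may have critical points, so the derivative is only known
  to be nonnegative. This is one source of \<open>H = 0\<close>.\<close>

lemma C1_differentiable_strict_mono_derivative:
  fixes h :: "real \<Rightarrow> real"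
  assumes mono: "strict_mono h" and C1: "h C1_differentiable_on UNIV"
  obtains h' where "\<And>x. (h has_real_derivative h' x) (at x)" "continuous_on UNIV h'" "\<And>x. 0 \<le> h' x"
proof -
  obtain h' where h': "\<And>x. (h has_vector_derivative h' x) (at x)" "continuous_on UNIV h'"
    using C1 unfolding C1_differentiable_on_def by auto
  have d: "(h has_real_derivative h' x) (at x)" for x
    using h'(1) by (simp add: has_real_derivative_iff_has_vector_derivative)
  have "0 \<le> h' x" for x
  proof (rule ccontr)
    assume "\<not> 0 \<le> h' x"
    then obtain c where c: "c > 0" "\<forall>e>0. e < c \<longrightarrow> h (x + e) < h x"
      using DERIV_neg_dec_right[OF d, of x] by auto
    have "h x < h (x + c / 2)" using c(1) mono by (simp add: strict_mono_less)
    with c show False by (metis half_gt_zero field_sum_of_halves less_add_same_cancel1 not_less_iff_gr_or_eq)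
  qed
  with d h'(2) show ?thesis by (rule that)
qed

definition degenerate_data :: "(real^'n) set \<Rightarrow> (real^'n \<Rightarrow> real) \<Rightarrow> (real \<Rightarrow> real) \<Rightarrow> (real^'n \<Rightarrow> real) \<Rightarrow> bool" where
  "degenerate_data \<Gamma> f h g \<longleftrightarrow> strict_mono h \<and> h C1_differentiable_on UNIV
            \<and> (\<forall>l\<in>\<Gamma>. g l = h (f l))
            \<and> (\<exists>Dg :: real^'n \<Rightarrow> ((real^'n) \<Rightarrow>\<^sub>L real).
                 (\<forall>l\<in>closure \<Gamma> - (frontier pos_cone \<inter> frontier \<Gamma>).
                    (g has_derivative blinfun_apply (Dg l)) (at l within (closure \<Gamma> - (frontier pos_cone \<inter> frontier \<Gamma>))))
                 \<and> continuous_on (closure \<Gamma> - (frontier pos_cone \<inter> frontier \<Gamma>)) Dg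
                 \<and> (\<forall>l\<in>frontier \<Gamma> - frontier pos_cone. (\<Sum>i\<in>UNIV. Dg l (axis i 1)) > 0))"

definition solves_at :: "(real^'n) set \<Rightarrow> (real^'n \<Rightarrow> real) \<Rightarrow> (real \<Rightarrow> real) \<Rightarrow> (real^'n \<Rightarrow> real) \<Rightarrow> real^'n^'n \<Rightarrow> real \<Rightarrow> bool" where
  "solves_at \<Gamma> f h g A y \<longleftrightarrow> (\<forall>l. eigvals_are A l \<longrightarrow>
            (l \<in> \<Gamma> \<longrightarrow> f l = y) \<and>
            (l \<in> frontier \<Gamma> \<longrightarrow> Limsup (at l within \<Gamma>) (\<lambda>m. ereal (g m)) = ereal (h y)))"

context curvature_function
begin

text \<open>The equation \<open>g = h(y)\<close> holds along the whole tail of the sequence,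
  wherever its terms lie in the closed cone, and is differentiated there. The resulting weights
  \<open>Dg m\<close> are limits of h'(f l) \<open>Df l\<close> from the interior, which is how they
  satisfy the inequalities of \<open>linearised_weights\<close>.\<close>

lemma degenerate_weights:
  assumes dat: "degenerate_data \<Gamma> f h g" and fin: "\<bar>f0\<bar> \<noteq> \<infinity>"
    and m: "m \<in> frontier \<Gamma>" "m \<notin> frontier pos_cone"
    and lim: "Limsup (at m within \<Gamma>) (\<lambda>m. ereal (g m)) = ereal (h y0)"
    and X: "\<And>k. X k \<in> closure \<Gamma>" "X \<longlonglongrightarrow> m"
    and eq: "\<And>k. X k \<in> \<Gamma> \<Longrightarrow> f (X k) = y k"
      "\<And>k. X k \<in> frontier \<Gamma> \<Longrightarrow> Limsup (at (X k) within \<Gamma>) (\<lambda>m. ereal (g m)) = ereal (h (y k))"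
    and t: "\<And>k. t k > 0" "t \<longlonglongrightarrow> 0"
    and limX: "(\<lambda>k. (X k - m) /\<^sub>R t k) \<longlonglongrightarrow> v"
    and limy: "(\<lambda>k. (y k - y0) /\<^sub>R t k) \<longlonglongrightarrow> y'"
  obtains \<phi> H where "linearised_weights \<delta> gap (real_of_ereal f0) y0 m \<phi> H"
     "(\<Sum>i\<in>UNIV. \<phi> $ i) > 0" "H * y' = \<phi> \<bullet> v"
proof -
  define S where "S = closure \<Gamma> - (frontier pos_cone \<inter> frontier \<Gamma>)"
  obtain h' where h': "\<And>x. (h has_real_derivative h' x) (at x)" "continuous_on UNIV h'" "\<And>x. 0 \<le> h' x"
    and mono: "strict_mono h"
    using dat C1_differentiable_strict_mono_derivative unfolding degenerate_data_def by metis
  obtain Dg :: "real^'n \<Rightarrow> ((real^'n) \<Rightarrow>\<^sub>L real)"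
    where Dg: "\<And>l. l \<in> S \<Longrightarrow> (g has_derivative blinfun_apply (Dg l)) (at l within S)"
     "continuous_on S Dg" "\<And>l. l \<in> frontier \<Gamma> \<Longrightarrow> l \<notin> frontier pos_cone \<Longrightarrow> (\<Sum>i\<in>UNIV. Dg l (axis i 1)) > 0"
    and gh: "\<And>l. l \<in> \<Gamma> \<Longrightarrow> g l = h (f l)"
    using dat unfolding degenerate_data_def S_def[symmetric] by auto
  have fr: "frontier \<Gamma> = closure \<Gamma> - \<Gamma>"
    by (simp add: frontier_def interior_open[OF open_cone])
  have GS: "\<Gamma> \<subseteq> S" using closure_subset by (auto simp: S_def fr)
  have mS: "m \<in> S" using m by (auto simp: S_def fr)
  \<comment> \<open>\<open>g\<close> is continuous relative to \<open>S\<close>, so the limsup in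
    the degenerate equation is an ordinary value of \<open>g\<close>.\<close>
  have g_value: "g l = h c" if "l \<in> S" "l \<in> frontier \<Gamma>" "Limsup (at l within \<Gamma>) (\<lambda>m. ereal (g m)) = ereal (h c)" for l c
  proof -
    have "(g \<longlongrightarrow> g l) (at l within S)"
      using has_derivative_continuous[OF Dg(1)[OF that(1)]] by (simp add: continuous_within)
    then have "(g \<longlongrightarrow> g l) (at l within \<Gamma>)" by (rule tendsto_within_subset[OF _ GS])
    then have "((\<lambda>x. ereal (g x)) \<longlongrightarrow> ereal (g l)) (at l within \<Gamma>)" by simp
    moreover have "\<not> trivial_limit (at l within \<Gamma>)"
      using that(2) by (auto simp: trivial_limit_within fr closure_def)
    ultimately have "Limsup (at l within \<Gamma>) (\<lambda>m. ereal (g m)) = ereal (g l)"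
      by (intro lim_imp_Limsup) auto
    with that(3) show ?thesis by simp
  qed
  have gm: "g m = h y0" by (rule g_value[OF mS m(1) lim])
  \<comment> \<open>Nothing is known about \<open>g\<close> on the common frontier with the positive
    cone, but \<open>m\<close> lies off that closed set, so a tail of the sequence avoids
    it.\<close>
  have "\<forall>\<^sub>F k in sequentially. X k \<in> - frontier pos_cone"
    using topological_tendstoD[OF X(2), of "- frontier pos_cone"] m(2) by (simp add: open_Compl)
  then obtain N where N: "\<And>k. k \<ge> N \<Longrightarrow> X k \<notin> frontier pos_cone"
    unfolding eventually_sequentially by auto
  have XS: "X (k + N) \<in> S" for k using X(1) N by (auto simp: S_def)
  have gX: "g (X (k + N)) = h (y (k + N))" for k
  proof (cases "X (k + N) \<in> \<Gamma>")
    case True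
    then show ?thesis using gh eq(1) by simp
  next
    case False
    then have "X (k + N) \<in> frontier \<Gamma>" using X(1) by (simp add: fr)
    from g_value[OF XS this eq(2)[OF this]] show ?thesis .
  qed
  have tN: "t (k + N) > 0" "(\<lambda>k. t (k + N)) \<longlonglongrightarrow> 0" for k
    using t LIMSEQ_ignore_initial_segment[OF t(2)] by auto
  have 1: "(\<lambda>k. (g (X (k + N)) - g m) /\<^sub>R t (k + N)) \<longlonglongrightarrow> Dg m v"
    by (rule has_derivative_sequentially[OF Dg(1)[OF mS] XS tN LIMSEQ_ignore_initial_segment[OF limX]])
  have 2: "(\<lambda>k. (h (y (k + N)) - h y0) /\<^sub>R t (k + N)) \<longlonglongrightarrow> h' y0 * y'"
    by (rule has_derivative_sequentially[OF h'(1)[unfolded has_field_derivative_def] _ tN LIMSEQ_ignore_initial_segment[OF limy]]) auto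
  have Dgv: "Dg m v = h' y0 * y'"
    using LIMSEQ_unique[OF 1] 2 unfolding gX gm by blast
  define \<phi> where "\<phi> = (\<chi> i. Dg m (axis i 1))"
  \<comment> \<open>The point \<open>m\<close> is approached along the diagonal. These points are
    interior: the midpoint of \<open>m\<close> and a point of the open cone lies in the cone, and
    doubling it stays there.\<close>
  define l where "l k = m + (1 / (real k + 1)) *\<^sub>R (1 :: real^'n)" for k
  have llim: "l \<longlonglongrightarrow> m"
  proof -
    have "l \<longlonglongrightarrow> m + 0 *\<^sub>R 1" unfolding l_def by (intro tendsto_intros) real_asymp
    then show ?thesis by simp
  qed
  have lG: "l k \<in> \<Gamma>" for k
  proof -
    define c where "c = (1 / (real k + 1)) *\<^sub>R (1 :: real^'n)"
    have "c \<in> interior \<Gamma>"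
      unfolding interior_open[OF open_cone] c_def by (intro scale_cone one_in_cone) simp
    then have "m - (1/2) *\<^sub>R (m - c) \<in> interior \<Gamma>"
      by (rule mem_interior_closure_convex_shrink[OF convex_cone]) (use m in \<open>auto simp: fr\<close>)
    then have "2 *\<^sub>R (m - (1/2) *\<^sub>R (m - c)) \<in> \<Gamma>"
      using scale_cone interior_subset[of \<Gamma>] by auto
    also have "2 *\<^sub>R (m - (1/2) *\<^sub>R (m - c)) = l k"
      unfolding l_def c_def[symmetric] by (simp add: scaleR_diff_right scaleR_2)
    finally show ?thesis .
  qed
  have lS: "l k \<in> S" for k using lG GS by blast
  have Dgl: "Dg (l k) w = h' (f (l k)) * Df (l k) w" for k w
  proof -
    have "(g has_derivative Dg (l k)) (at (l k))"
      using has_derivative_subset[OF Dg(1)[OF lS] GS] at_within_open[OF lG open_cone] by simp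
    moreover have "(g has_derivative (\<lambda>w. h' (f (l k)) * Df (l k) w)) (at (l k))"
    proof (rule has_derivative_transform_within_open[OF _ open_cone lG])
      show "((\<lambda>x. h (f x)) has_derivative (\<lambda>w. h' (f (l k)) * Df (l k) w)) (at (l k))"
        by (rule has_derivative_compose[OF deriv[OF lG]]) (rule h'(1)[unfolded has_field_derivative_def])
    qed (simp add: gh)
    ultimately have "blinfun_apply (Dg (l k)) = (\<lambda>w. h' (f (l k)) * Df (l k) w)" by (rule has_derivative_unique)
    then show ?thesis by (rule fun_cong)
  qed
  have Dglim: "(\<lambda>k. Dg (l k)) \<longlonglongrightarrow> Dg m"
    by (rule continuous_on_tendsto_compose[OF Dg(2) llim mS]) (simp add: lS)
  have "(\<lambda>k. g (l k)) \<longlonglongrightarrow> g m"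
    by (rule continuous_on_tendsto_compose[OF has_derivative_continuous_on[OF Dg(1)] llim mS]) (simp_all add: lS)
  then have "(\<lambda>k. h (f (l k))) \<longlonglongrightarrow> h y0" by (simp add: gh[OF lG] gm)
  from strict_mono_tendsto_cancel[OF mono this] have flim: "(\<lambda>k. f (l k)) \<longlonglongrightarrow> y0" .
  have h'lim: "(\<lambda>k. h' (f (l k))) \<longlonglongrightarrow> h' y0"
    by (rule continuous_on_tendsto_compose[OF h'(2) flim]) auto
  have philim: "(\<lambda>k. \<chi> i. h' (f (l k)) * Df (l k) (axis i 1)) \<longlonglongrightarrow> \<phi>"
    unfolding \<phi>_def Dgl[symmetric] by (intro tendsto_vec_lambda tendsto_intros Dglim)
  have "linearised_weights \<delta> gap (real_of_ereal f0) y0 m \<phi> (h' y0)"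
    by (rule linearised_weights_limit[OF _ flim llim philim h'lim])
       (rule linearised_weights_interior[OF lG fin h'(3)])
  moreover have "(\<Sum>i\<in>UNIV. \<phi> $ i) > 0" using Dg(3)[OF m] by (simp add: \<phi>_def)
  moreover have "h' y0 * y' = \<phi> \<bullet> v"
    using Dgv by (simp add: blinfun_apply_cart_sum[of "Dg m" v] \<phi>_def inner_vec_def)
  ultimately show ?thesis by (rule that)
qed

text \<open>The limiting curvatures \<open>m\<close> lie in the cone (gradient of \<open>f\<close>,
  \<open>H = 1\<close>), on its frontier with no negative entry (supporting hyperplane,
  \<open>H = 0\<close>), or elsewhere on the frontier (gradient of \<open>g\<close>). The last
  conclusion is an inequality because a hyperplane only gives a sign: it vanishes at
  \<open>m\<close> and is nonnegative on the closed cone.\<close>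

lemma linearisation:
  fixes A :: "nat \<Rightarrow> real^'n^'n"
  assumes fin: "\<bar>f0\<bar> \<noteq> \<infinity>"
    and t: "\<And>k. t k > 0" "t \<longlonglongrightarrow> 0"
    and limA: "(\<lambda>k. (A k - A0) /\<^sub>R t k) \<longlonglongrightarrow> B"
    and limy: "(\<lambda>k. (y k - y0) /\<^sub>R t k) \<longlonglongrightarrow> y'"
    and adm: "\<And>k. \<exists>l. eigvals_are (A k) l \<and> l \<in> closure \<Gamma>"
    and eq: "\<And>k. solves_at \<Gamma> f h g (A k) (y k)" and eq0: "solves_at \<Gamma> f h g A0 y0"
    and dat: "\<And>l. eigvals_are A0 l \<Longrightarrow> l \<in> frontier \<Gamma> \<Longrightarrow> degenerate_data \<Gamma> f h g"
  obtains q m \<phi> H where "orthonormal_family q" "\<And>i. A0 *v q i = m $ i *\<^sub>R q i"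
    "linearised_weights \<delta> gap (real_of_ereal f0) y0 m \<phi> H"
    "H = 0 \<Longrightarrow> (\<Sum>i\<in>UNIV. \<phi> $ i) > 0"
    "H * y' \<le> (\<Sum>i\<in>UNIV. \<phi> $ i * (q i \<bullet> (B *v q i)))"
proof -
  obtain mu where mu: "\<And>k. eigvals_are (A k) (mu k)" "\<And>k. mu k \<in> closure \<Gamma>"
    using adm by metis
  obtain r q m where r: "strict_mono (r :: nat \<Rightarrow> nat)" and q: "orthonormal_family q"
    and ev: "\<And>i. A0 *v q i = m $ i *\<^sub>R q i"
    and ml: "(\<lambda>k. mu (r k)) \<longlonglongrightarrow> m"
    and dl: "(\<lambda>k. (mu (r k) - m) /\<^sub>R t (r k)) \<longlonglongrightarrow> (\<chi> i. q i \<bullet> (B *v q i))"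
    by (rule eigenvalue_derivative_sequence[of A mu t A0 B, OF mu(1) t limA]) blast
  define v where "v = (\<chi> i. q i \<bullet> (B *v q i))"
  have eigm: "eigvals_are A0 m" using q ev eigvals_are_iff by blast
  have mcl: "m \<in> closure \<Gamma>"
    using closed_sequentially[OF closed_closure _ ml] mu(2) by blast
  have fr: "frontier \<Gamma> = closure \<Gamma> - \<Gamma>"
    by (simp add: frontier_def interior_open[OF open_cone])
  have tr: "t (r k) > 0" "(\<lambda>k. t (r k)) \<longlonglongrightarrow> 0" for k
    using t LIMSEQ_subseq_LIMSEQ[OF t(2) r] by (auto simp: comp_def)
  have yr: "(\<lambda>k. (y (r k) - y0) /\<^sub>R t (r k)) \<longlonglongrightarrow> y'"
    using LIMSEQ_subseq_LIMSEQ[OF limy r] by (simp add: comp_def)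
  have "\<exists>\<phi> H. linearised_weights \<delta> gap (real_of_ereal f0) y0 m \<phi> H \<and>
    (H = 0 \<longrightarrow> (\<Sum>i\<in>UNIV. \<phi> $ i) > 0) \<and> H * y' \<le> \<phi> \<bullet> v"
  proof (cases "m \<in> \<Gamma>")
    case True
    have fm: "f m = y0" using eq0 eigm True unfolding solves_at_def by blast
    have "(\<lambda>k. (f (mu (r k)) - f m) /\<^sub>R t (r k)) \<longlonglongrightarrow> Df m v"
      by (rule has_derivative_sequentially[OF deriv[OF True] _ tr dl[folded v_def]]) auto
    moreover have "\<forall>\<^sub>F k in sequentially. mu (r k) \<in> \<Gamma>"
      by (rule topological_tendstoD[OF ml open_cone True])
    then have "\<forall>\<^sub>F k in sequentially. (f (mu (r k)) - f m) /\<^sub>R t (r k) = (y (r k) - y0) /\<^sub>R t (r k)"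
    proof (rule eventually_mono)
      fix k assume "mu (r k) \<in> \<Gamma>"
      then have "f (mu (r k)) = y (r k)" using eq mu(1) unfolding solves_at_def by blast
      then show "(f (mu (r k)) - f m) /\<^sub>R t (r k) = (y (r k) - y0) /\<^sub>R t (r k)" by (simp add: fm)
    qed
    ultimately have "(\<lambda>k. (y (r k) - y0) /\<^sub>R t (r k)) \<longlonglongrightarrow> Df m v" by (rule Lim_transform_eventually)
    then have "Df m v = y'" using LIMSEQ_unique yr by blast
    moreover have "linearised_weights \<delta> gap (real_of_ereal f0) y0 m (\<chi> i. 1 * Df m (axis i 1)) 1"
      using linearised_weights_interior[OF True fin, of 1] by (simp add: fm)
    ultimately show ?thesis
      by (intro exI[of _ "\<chi> i. 1 * Df m (axis i 1)"] exI[of _ 1])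
         (simp add: blinfun_apply_cart_sum[of "Df m" v] inner_vec_def)
  next
    case False
    then have mfr: "m \<in> frontier \<Gamma>" using mcl fr by simp
    show ?thesis
    proof (cases "m \<in> frontier pos_cone")
      case True
      have "closure pos_cone \<subseteq> {l :: real^'n. \<forall>i. 0 \<le> l $ i}"
      proof (rule closure_minimal)
        have "{l :: real^'n. \<forall>i. 0 \<le> l $ i} = (\<Inter>i. {l. l $ i \<ge> 0})" by auto
        moreover have "closed {l :: real^'n. l $ i \<ge> 0}" for i
          by (rule closed_Collect_le) (auto intro: continuous_intros)
        ultimately show "closed {l :: real^'n. \<forall>i. 0 \<le> l $ i}" by (simp add: closed_INT)
      qed (auto simp: pos_cone_def less_imp_le)
      \<comment> \<open>Without negative curvatures, the clause of \<open>linearised_weights\<close>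
        that stems from (iii) is vacuous.\<close>
      then have m0: "\<not> m $ j < 0" for j using True by (auto simp: frontier_def not_less)
      obtain a where a: "\<And>i. 0 \<le> a $ i" "(\<Sum>i\<in>UNIV. a $ i) > 0" "a \<bullet> m = 0"
         "\<And>l. l \<in> closure \<Gamma> \<Longrightarrow> 0 \<le> a \<bullet> l"
        using support_weights[OF mcl False] by blast
      have "0 \<le> a \<bullet> v"
      proof (rule LIMSEQ_le_const)
        show "(\<lambda>k. a \<bullet> ((mu (r k) - m) /\<^sub>R t (r k))) \<longlonglongrightarrow> a \<bullet> v"
          by (intro tendsto_intros dl[folded v_def])
        show "\<exists>N. \<forall>n\<ge>N. 0 \<le> a \<bullet> ((mu (r n) - m) /\<^sub>R t (r n))"
          using a(3,4) mu(2) tr(1) by (auto simp: inner_diff_right less_imp_le)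
      qed
      moreover have "linearised_weights \<delta> gap (real_of_ereal f0) y0 m a 0"
        unfolding linearised_weights_def using a m0 by (auto simp: less_imp_le)
      ultimately show ?thesis using a(2) by (intro exI[of _ a] exI[of _ 0]) auto
    next
      case nf: False
      have dd: "degenerate_data \<Gamma> f h g" by (rule dat[OF eigm mfr])
      have e0: "Limsup (at m within \<Gamma>) (\<lambda>m. ereal (g m)) = ereal (h y0)"
        using eq0 eigm mfr unfolding solves_at_def by blast
      have e1: "mu (r k) \<in> \<Gamma> \<Longrightarrow> f (mu (r k)) = y (r k)"
        and e2: "mu (r k) \<in> frontier \<Gamma> \<Longrightarrow> Limsup (at (mu (r k)) within \<Gamma>) (\<lambda>m. ereal (g m)) = ereal (h (y (r k)))" for k
        using eq mu(1) unfolding solves_at_def by blast+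
      obtain \<phi> H where "linearised_weights \<delta> gap (real_of_ereal f0) y0 m \<phi> H"
         "(\<Sum>i\<in>UNIV. \<phi> $ i) > 0" "H * y' = \<phi> \<bullet> v"
        using degenerate_weights[OF dd fin mfr nf e0 mu(2) ml e1 e2 tr dl[folded v_def] yr] by blast
      then show ?thesis by (intro exI[of _ \<phi>] exI[of _ H]) auto
    qed
  qed
  then obtain \<phi> H where 1: "linearised_weights \<delta> gap (real_of_ereal f0) y0 m \<phi> H"
    and 2: "H = 0 \<Longrightarrow> (\<Sum>i\<in>UNIV. \<phi> $ i) > 0" and 3: "H * y' \<le> \<phi> \<bullet> v" by blast
  have "\<phi> \<bullet> v = (\<Sum>i\<in>UNIV. \<phi> $ i * (q i \<bullet> (B *v q i)))" by (simp add: v_def inner_vec_def)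
  with 3 have "H * y' \<le> (\<Sum>i\<in>UNIV. \<phi> $ i * (q i \<bullet> (B *v q i)))" by simp
  with q ev 1 2 show ?thesis by (rule that)
qed

end

section \<open>Second-order conditions at a maximum\<close>

text \<open>Here \<open>U\<close>, \<open>P\<close>, \<open>Q\<close> stand for u, Du and D^2u \<xi>
  on the line x + t \<xi>. One computation serves both test functions: \<open>m = 0\<close> with
  \<open>\<beta> = 0\<close> is the pure cutoff R - |x|^2.\<close>

lemma second_order_along_line:
  fixes U :: "real \<Rightarrow> real" and P Q :: "real \<Rightarrow> 'a::real_inner"
  assumes d: "d > 0"
    and U: "\<And>t. \<bar>t\<bar> < d \<Longrightarrow> (U has_real_derivative (P t \<bullet> \<xi>)) (at t)"
    and P: "\<And>t. \<bar>t\<bar> < d \<Longrightarrow> (P has_vector_derivative Q t) (at t)"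
    and Q: "(Q has_vector_derivative T) (at 0)"
    and \<beta>: "\<And>t. \<bar>t\<bar> < d \<Longrightarrow> (\<beta> has_real_derivative \<beta>1 (U t)) (at (U t))"
    and \<beta>1: "(\<beta>1 has_real_derivative b2) (at (U 0))"
    and pos: "\<And>t. \<bar>t\<bar> < d \<Longrightarrow> R - (x + t *\<^sub>R \<xi>) \<bullet> (x + t *\<^sub>R \<xi>) + \<beta> (U t) > 0"
    and max: "\<And>t. \<bar>t\<bar> < d \<Longrightarrow>
      \<alpha> / 2 * ln (1 + P t \<bullet> P t) + m * U t + ln (R - (x + t *\<^sub>R \<xi>) \<bullet> (x + t *\<^sub>R \<xi>) + \<beta> (U t))
      \<le> \<alpha> / 2 * ln (1 + P 0 \<bullet> P 0) + m * U 0 + ln (R - x \<bullet> x + \<beta> (U 0))"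
  defines "N \<equiv> 1 + P 0 \<bullet> P 0" and "\<zeta> \<equiv> R - x \<bullet> x + \<beta> (U 0)"
  shows "\<alpha> * (P 0 \<bullet> Q 0) / N + m * (P 0 \<bullet> \<xi>) + (\<beta>1 (U 0) * (P 0 \<bullet> \<xi>) - 2 * (x \<bullet> \<xi>)) / \<zeta> = 0"
    and "\<alpha> * ((Q 0 \<bullet> Q 0 + P 0 \<bullet> T) / N - 2 * (P 0 \<bullet> Q 0)\<^sup>2 / N\<^sup>2) + m * (Q 0 \<bullet> \<xi>)
      + (\<beta>1 (U 0) * (Q 0 \<bullet> \<xi>) + b2 * (P 0 \<bullet> \<xi>)\<^sup>2 - 2 * (\<xi> \<bullet> \<xi>)) / \<zeta>
      - ((\<beta>1 (U 0) * (P 0 \<bullet> \<xi>) - 2 * (x \<bullet> \<xi>)) / \<zeta>)\<^sup>2 \<le> 0"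
proof -
  define NN where "NN t = 1 + P t \<bullet> P t" for t
  define Z where "Z t = R - (x + t *\<^sub>R \<xi>) \<bullet> (x + t *\<^sub>R \<xi>) + \<beta> (U t)" for t
  define Z' where "Z' t = \<beta>1 (U t) * (P t \<bullet> \<xi>) - 2 * ((x + t *\<^sub>R \<xi>) \<bullet> \<xi>)" for t
  define f where "f t = \<alpha> / 2 * ln (NN t) + m * U t + ln (Z t)" for t
  define f' where "f' t = \<alpha> * ((P t \<bullet> Q t) / NN t) + m * (P t \<bullet> \<xi>) + Z' t / Z t" for t
  have inner: "((\<lambda>t. a t \<bullet> b t) has_real_derivative (a t \<bullet> b' + a' \<bullet> b t)) (at t)"
    if "(a has_vector_derivative a') (at t)" "(b has_vector_derivative b') (at t)"
    for a b :: "real \<Rightarrow> 'a" and a' b' t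
  proof -
    have "((\<lambda>t. a t \<bullet> b t) has_derivative (\<lambda>h. a t \<bullet> (h *\<^sub>R b') + (h *\<^sub>R a') \<bullet> b t)) (at t)"
      using that unfolding has_vector_derivative_def by (rule has_derivative_inner)
    also have "(\<lambda>h. a t \<bullet> (h *\<^sub>R b') + (h *\<^sub>R a') \<bullet> b t) = (*) (a t \<bullet> b' + a' \<bullet> b t)"
      by (simp add: fun_eq_iff algebra_simps)
    finally show ?thesis by (simp add: has_field_derivative_def)
  qed
  have const: "((\<lambda>t. c) has_vector_derivative 0) (at t)" for c :: 'a and t by simp
  have line: "((\<lambda>t. x + t *\<^sub>R \<xi>) has_vector_derivative \<xi>) (at t)" for t
    by (auto intro!: derivative_eq_intros)
  have NNpos: "NN t > 0" for t by (simp add: NN_def add_pos_nonneg)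
  have NNd: "(NN has_real_derivative 2 * (P t \<bullet> Q t)) (at t)" if "\<bar>t\<bar> < d" for t
    unfolding NN_def[abs_def]
    by (rule DERIV_cong[OF DERIV_add[OF DERIV_const inner[OF P[OF that] P[OF that]]]]) (simp add: inner_commute)
  have Zd: "(Z has_real_derivative Z' t) (at t)" if "\<bar>t\<bar> < d" for t
    unfolding Z_def[abs_def] Z'_def
    by (rule DERIV_cong[OF DERIV_add[OF DERIV_diff[OF DERIV_const inner[OF line line]] DERIV_chain2[OF \<beta>[OF that] U[OF that]]]])
      (simp add: inner_commute)
  have Pxi: "((\<lambda>t. P t \<bullet> \<xi>) has_real_derivative Q t \<bullet> \<xi>) (at t)" if "\<bar>t\<bar> < d" for t
    by (rule DERIV_cong[OF inner[OF P[OF that] const]]) simp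
  have f'd: "(f has_real_derivative f' t) (at t)" if t: "\<bar>t\<bar> < d" for t
  proof -
    have zp: "Z t > 0" using pos[OF t] by (simp add: Z_def)
    have 1: "((\<lambda>t. ln (NN t)) has_real_derivative 1 / NN t * (2 * (P t \<bullet> Q t))) (at t)"
      by (rule DERIV_chain2[OF DERIV_ln_divide[OF NNpos] NNd[OF t]])
    have 2: "((\<lambda>t. ln (Z t)) has_real_derivative 1 / Z t * Z' t) (at t)"
      by (rule DERIV_chain2[OF DERIV_ln_divide[OF zp] Zd[OF t]])
    show ?thesis
      unfolding f_def[abs_def] f'_def
      by (rule DERIV_cong[OF DERIV_add[OF DERIV_add[OF DERIV_cmult[OF 1] DERIV_cmult[OF U[OF t]]] 2]]) simp
  qed
  have d0: "\<bar>0 :: real\<bar> < d" using d by simp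
  have PQ: "((\<lambda>t. P t \<bullet> Q t) has_real_derivative P 0 \<bullet> T + Q 0 \<bullet> Q 0) (at 0)"
    by (rule inner[OF P[OF d0] Q])
  have Z'd: "(Z' has_real_derivative (\<beta>1 (U 0) * (Q 0 \<bullet> \<xi>) + b2 * (P 0 \<bullet> \<xi>)\<^sup>2 - 2 * (\<xi> \<bullet> \<xi>))) (at 0)"
    unfolding Z'_def[abs_def]
    by (rule DERIV_cong[OF DERIV_diff[OF DERIV_mult[OF DERIV_chain2[OF \<beta>1 U[OF d0]] Pxi[OF d0]] DERIV_cmult[OF inner[OF line const]]]])
      (simp add: power2_eq_square)
  have z0: "Z 0 > 0" using pos[OF d0] by (simp add: Z_def)
  have f''d: "(f' has_real_derivative
     (\<alpha> * (((P 0 \<bullet> T + Q 0 \<bullet> Q 0) * NN 0 - (P 0 \<bullet> Q 0) * (2 * (P 0 \<bullet> Q 0))) / (NN 0 * NN 0)) + m * (Q 0 \<bullet> \<xi>)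
      + ((\<beta>1 (U 0) * (Q 0 \<bullet> \<xi>) + b2 * (P 0 \<bullet> \<xi>)\<^sup>2 - 2 * (\<xi> \<bullet> \<xi>)) * Z 0 - Z' 0 * Z' 0) / (Z 0 * Z 0))) (at 0)"
    unfolding f'_def[abs_def]
    by (intro DERIV_add DERIV_cmult Pxi[OF d0] DERIV_divide PQ NNd[OF d0] Z'd Zd[OF d0]) (use z0 NNpos[of 0] in auto)
  have mx: "f t \<le> f 0" if "\<bar>t\<bar> < d" for t
    using max[OF that] by (simp add: f_def NN_def Z_def)
  note r = second_derivative_local_max[OF d f'd f''d mx]
  have NN0: "NN 0 = N" and Z0: "Z 0 = \<zeta>" and Z'0: "Z' 0 = \<beta>1 (U 0) * (P 0 \<bullet> \<xi>) - 2 * (x \<bullet> \<xi>)"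
    by (simp_all add: NN_def Z_def Z'_def N_def \<zeta>_def)
  show "\<alpha> * (P 0 \<bullet> Q 0) / N + m * (P 0 \<bullet> \<xi>) + (\<beta>1 (U 0) * (P 0 \<bullet> \<xi>) - 2 * (x \<bullet> \<xi>)) / \<zeta> = 0"
    using r(1) by (simp add: f'_def NN0 Z0 Z'0)
  have e1: "((a + b) * n - c * (2 * c)) / (n * n) = (b + a) / n - 2 * c\<^sup>2 / n\<^sup>2" if "n > 0" for a b c n :: real
    using that by (simp add: field_simps power2_eq_square)
  have e2: "(a * n - c * c) / (n * n) = a / n - (c / n)\<^sup>2" if "n > 0" for a c n :: real
    using that by (simp add: field_simps power2_eq_square)
  show "\<alpha> * ((Q 0 \<bullet> Q 0 + P 0 \<bullet> T) / N - 2 * (P 0 \<bullet> Q 0)\<^sup>2 / N\<^sup>2) + m * (Q 0 \<bullet> \<xi>)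
      + (\<beta>1 (U 0) * (Q 0 \<bullet> \<xi>) + b2 * (P 0 \<bullet> \<xi>)\<^sup>2 - 2 * (\<xi> \<bullet> \<xi>)) / \<zeta>
      - ((\<beta>1 (U 0) * (P 0 \<bullet> \<xi>) - 2 * (x \<bullet> \<xi>)) / \<zeta>)\<^sup>2 \<le> 0"
    using r(2) unfolding e1[OF NNpos] e2[OF z0] unfolding NN0 Z0 Z'0 by simp
qed

lemma hessian_symmetric:
  fixes u :: "real^'n \<Rightarrow> real"
  assumes S: "open S" "x \<in> S"
    and Du: "\<And>y. y \<in> S \<Longrightarrow> (u has_derivative (\<lambda>h. Du y \<bullet> h)) (at y)"
    and D2u: "(Du has_derivative (\<lambda>h. D2u *v h)) (at x)"
  shows "transpose D2u = D2u"
proof -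
  obtain e where e: "e > 0" "ball x e \<subseteq> S" using S open_contains_ball by blast
  have d: "((\<lambda>y. Du y \<bullet> a) has_derivative (\<lambda>h. (D2u *v h) \<bullet> a)) (at x)" for a
    by (rule has_derivative_inner_left[OF D2u])
  have sym: "(D2u *v a) \<bullet> b = (D2u *v b) \<bullet> a" for a b
    by (rule second_derivative_symmetric[where f = u, OF e(1) _ d d]) (use e(2) Du in auto)
  have "D2u $ i $ j = D2u $ j $ i" for i j
    using sym[of "axis j 1" "axis i 1"] by (simp add: inner_axis matrix_vector_mul_component)
  then show ?thesis by (simp add: transpose_def vec_eq_iff)
qed

text \<open>The second-order condition produces the left-hand side, while the equation
  differentiated along \<open>p\<close> controls the right-hand side. Two exchanges match them: of
  the differentiation directions, and of the two arguments of the symmetric Hessian.\<close>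

lemma third_derivative_symmetric:
  fixes Du :: "real^'n \<Rightarrow> real^'n"
  assumes S: "open S" "x \<in> S"
    and D2u: "\<And>y. y \<in> S \<Longrightarrow> (Du has_derivative (\<lambda>h. D2u y *v h)) (at y)"
    and sym: "\<And>y. y \<in> S \<Longrightarrow> transpose (D2u y) = D2u y"
    and D3: "(D2u has_derivative D3) (at x)"
  shows "p \<bullet> (D3 \<xi> *v \<xi>) = \<xi> \<bullet> (D3 p *v \<xi>)"
proof -
  obtain e where e: "e > 0" "ball x e \<subseteq> S" using S open_contains_ball by blast
  have mv: "((\<lambda>y. D2u y *v a) has_derivative (\<lambda>h. D3 h *v a)) (at x)" for a
    using has_derivative_matrix_vector_mult[OF D3 has_derivative_const[of a]] by simp
  have "\<xi> \<bullet> (D3 \<xi> *v p) = \<xi> \<bullet> (D3 p *v \<xi>)"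
    by (rule second_derivative_symmetric[where f = "\<lambda>y. \<xi> \<bullet> Du y",
          OF e(1) has_derivative_inner_right[OF D2u] has_derivative_inner_right[OF mv] has_derivative_inner_right[OF mv]])
      (use e(2) in blast)
  moreover have "p \<bullet> (D3 h *v a) = a \<bullet> (D3 h *v p)" for h a
  proof -
    have 1: "((\<lambda>y. p \<bullet> (D2u y *v a)) has_derivative (\<lambda>h. p \<bullet> (D3 h *v a))) (at x)"
      by (rule has_derivative_inner_right[OF mv])
    have 2: "((\<lambda>y. a \<bullet> (D2u y *v p)) has_derivative (\<lambda>h. a \<bullet> (D3 h *v p))) (at x)"
      by (rule has_derivative_inner_right[OF mv])
    have "a \<bullet> (D2u y *v p) = p \<bullet> (D2u y *v a)" if "y \<in> S" for y
      using inner_matrix_vector_symmetric[OF sym[OF that], of a p] by (simp add: inner_commute)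
    then have "((\<lambda>y. p \<bullet> (D2u y *v a)) has_derivative (\<lambda>h. a \<bullet> (D3 h *v p))) (at x)"
      by (rule has_derivative_transform_within_open[OF 2 S])
    from has_derivative_unique[OF 1 this] show ?thesis by (rule fun_cong)
  qed
  ultimately show ?thesis by simp
qed

lemma bounded_bilinear_matrix_matrix_mult:
  "bounded_bilinear ((**) :: real^'n^'m \<Rightarrow> real^'p^'n \<Rightarrow> real^'p^'m)"
proof -
  have "bilinear ((**) :: real^'n^'m \<Rightarrow> real^'p^'n \<Rightarrow> real^'p^'m)"
    unfolding bilinear_def
    by (auto intro!: linearI simp: matrix_add_ldistrib matrix_matrix_mult_def vec_eq_iff
        sum.distrib algebra_simps sum_distrib_left)
  then show ?thesis by (simp add: bilinear_conv_bounded_bilinear)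
qed

lemma bounded_bilinear_outer_product:
  "bounded_bilinear (\<lambda>(p :: real^'n) (q :: real^'n). (\<chi> i k. p $ i * q $ k) :: real^'n^'n)"
proof -
  have "bilinear (\<lambda>(p :: real^'n) (q :: real^'n). (\<chi> i k. p $ i * q $ k) :: real^'n^'n)"
    unfolding bilinear_def by (auto intro!: linearI simp: vec_eq_iff algebra_simps)
  then show ?thesis by (simp add: bilinear_conv_bounded_bilinear)
qed

text \<open>Only the existence of \<open>B\<close> is needed: its quadratic form on eigenvectors is
  identified by \<open>curv_mat_derivative_identity\<close>.\<close>

lemma curv_mat_differentiable:
  fixes P :: "real \<Rightarrow> real^'n" and Sg :: "real \<Rightarrow> real^'n^'n"
  assumes P: "(P has_derivative (\<lambda>h. h *\<^sub>R P')) (at t)" and Z: "(Z has_derivative (\<lambda>h. h * Z')) (at t)"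
    and Sg: "(Sg has_derivative (\<lambda>h. h *\<^sub>R S')) (at t)"
  obtains B where "((\<lambda>t. curv_mat (Z t) (P t) (Sg t)) has_derivative (\<lambda>h. h *\<^sub>R B)) (at t)"
proof -
  define W where "W t = wfun (P t)" for t
  have W: "(W has_derivative (\<lambda>h. h * ((P t \<bullet> P') / wfun (P t)))) (at t)"
    unfolding W_def[abs_def] by (rule wfun_has_derivative[OF P])
  have Wp: "W t > 0" for t by (simp add: W_def wfun_pos)
  have nz: "W t \<noteq> 0" "W t * (W t + 1) \<noteq> 0" using Wp[of t] by auto
  note outer = bounded_bilinear.FDERIV[OF bounded_bilinear_outer_product P P]
  define G where "G t = gam (P t)" for t
  have G: "G t = mat 1 - (1 / (W t * (W t + 1))) *\<^sub>R (\<chi> i k. P t $ i * P t $ k)" for t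
    by (simp add: G_def W_def gam_def vec_eq_iff mat_def)
  have "\<exists>D. (G has_derivative D) (at t)"
    unfolding G[abs_def]
    by (rule exI, rule has_derivative_diff[OF has_derivative_const has_derivative_scaleR[OF has_derivative_divide[OF
       has_derivative_const has_derivative_mult[OF W has_derivative_add[OF W has_derivative_const]] nz(2)] outer]])
  then obtain DG where DG: "(G has_derivative DG) (at t)" by blast
  have "\<exists>D. ((\<lambda>t. curv_mat (Z t) (P t) (Sg t)) has_derivative D) (at t)"
    unfolding curv_mat_def G_def[symmetric] W_def[symmetric]
    by (rule exI, rule has_derivative_scaleR[OF has_derivative_divide[OF has_derivative_const W nz(1)]
       bounded_bilinear.FDERIV[OF bounded_bilinear_matrix_matrix_mult
         bounded_bilinear.FDERIV[OF bounded_bilinear_matrix_matrix_mult DG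
           has_derivative_add[OF has_derivative_add[OF has_derivative_const outer] has_derivative_scaleR[OF Z Sg]]] DG]])
  then obtain D where D: "((\<lambda>t. curv_mat (Z t) (P t) (Sg t)) has_derivative D) (at t)" by blast
  have "D h = h *\<^sub>R D 1" for h
    using linear_cmul[OF has_derivative_linear[OF D], of h 1] unfolding real_scaleR_def mult_1_right .
  then have Dt: "D = (\<lambda>h. h *\<^sub>R D 1)" by (rule ext)
  have "((\<lambda>t. curv_mat (Z t) (P t) (Sg t)) has_derivative (\<lambda>h. h *\<^sub>R D 1)) (at t)"
    using D by (subst (asm) Dt)
  then show ?thesis by (rule that)
qed

text \<open>The first-order condition is multiplied by z w, the second-order one by z w^2. In the
  latter the third derivative is replaced by \<open>ident\<close> and the square of the logarithmic
  gradient of \<open>\<zeta>\<close> by its value from the first-order condition, so that only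
  \<open>y\<close>, \<open>c\<close> and \<open>a\<close> remain.\<close>

lemma direction_inequality:
  fixes S T :: "real^'n^'n" and p q x :: "real^'n"
  defines "w \<equiv> wfun p" and "\<xi> \<equiv> gam p *v q" and "c \<equiv> p \<bullet> q"
  assumes sym: "transpose S = S" and q: "q \<bullet> q = 1" and z: "z > 0"
    and ev: "curv_mat z p S *v q = l *\<^sub>R q"
    and y: "y = w * l - 1"
    and ident: "z * (\<xi> \<bullet> (T *v \<xi>)) = w * a + l * (p \<bullet> (S *v p)) / w - (p \<bullet> p) * y / z + 2 * y\<^sup>2 * c\<^sup>2 / z"
    and first: "\<alpha> * (p \<bullet> (S *v \<xi>)) / w\<^sup>2 + m * (p \<bullet> \<xi>) + (b1 * (p \<bullet> \<xi>) - 2 * (x \<bullet> \<xi>)) / \<zeta> = 0"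
    and second: "\<alpha> * (((S *v \<xi>) \<bullet> (S *v \<xi>) + \<xi> \<bullet> (T *v \<xi>)) / w\<^sup>2 - 2 * (p \<bullet> (S *v \<xi>))\<^sup>2 / (w\<^sup>2)\<^sup>2)
       + m * ((S *v \<xi>) \<bullet> \<xi>) + (b1 * ((S *v \<xi>) \<bullet> \<xi>) + b2 * (p \<bullet> \<xi>)\<^sup>2 - 2 * (\<xi> \<bullet> \<xi>)) / \<zeta>
       - ((b1 * (p \<bullet> \<xi>) - 2 * (x \<bullet> \<xi>)) / \<zeta>)\<^sup>2 \<le> 0"
    and zeta: "\<zeta> > 0"
  shows "\<alpha> * y * c = - z * ((m + b1 / \<zeta>) * c - 2 * w * (x \<bullet> \<xi>) / \<zeta>)"
    and "\<alpha> * (w * a + l * (p \<bullet> (S *v p)) / w + (y\<^sup>2 * (1 + c\<^sup>2) - (p \<bullet> p) * y) / z) + w\<^sup>2 * (m + b1 / \<zeta>) * y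
       + z * b2 * c\<^sup>2 / \<zeta> - 2 * w\<^sup>2 * z * (\<xi> \<bullet> \<xi>) / \<zeta> - z * (\<alpha> * y * c / z + m * c)\<^sup>2 \<le> 0"
proof -
  define \<eta> where "\<eta> = q + (c / (w + 1)) *\<^sub>R p"
  have w: "w > 0" by (simp add: w_def wfun_pos)
  have w2: "1 + p \<bullet> p = w\<^sup>2" by (simp add: w_def wfun_square)
  have zS: "z *\<^sub>R (S *v \<xi>) = y *\<^sub>R \<eta>"
    using curv_mat_eigenvector[OF ev] by (simp add: \<xi>_def y \<eta>_def w_def c_def)
  have S\<xi>: "S *v \<xi> = (y / z) *\<^sub>R \<eta>"
  proof -
    have "(1/z) *\<^sub>R (z *\<^sub>R (S *v \<xi>)) = (1/z) *\<^sub>R (y *\<^sub>R \<eta>)" by (simp only: zS)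
    then show ?thesis using z by simp
  qed
  have pxi: "p \<bullet> \<xi> = c / w" by (simp add: \<xi>_def inner_gam c_def w_def)
  have eta: "\<eta> = \<xi> + (c / w) *\<^sub>R p"
    using gam_metric[of p q] by (simp add: \<xi>_def \<eta>_def c_def w_def inner_gam)
  have peta: "p \<bullet> \<eta> = w * c"
  proof -
    have "p \<bullet> \<eta> = c / w * (1 + p \<bullet> p)" by (simp add: eta inner_add_right pxi algebra_simps)
    also have "\<dots> = w * c" using w unfolding w2 by (simp add: power2_eq_square)
    finally show ?thesis .
  qed
  have xe: "\<eta> \<bullet> \<xi> = 1" using gam_inner_metric[of p q q] q by (simp add: \<xi>_def \<eta>_def c_def w_def inner_commute)
  have ee: "\<eta> \<bullet> \<eta> = 1 + c\<^sup>2"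
  proof -
    have "\<eta> \<bullet> \<eta> = \<eta> \<bullet> \<xi> + (c / w) * (p \<bullet> \<eta>)"
      by (subst (2) eta) (simp add: inner_add_right inner_commute)
    then show ?thesis unfolding xe peta using w by (simp add: power2_eq_square)
  qed
  have r1: "p \<bullet> (S *v \<xi>) = y * w * c / z" by (simp add: S\<xi> peta)
  have r2: "(S *v \<xi>) \<bullet> \<xi> = y / z" by (simp add: S\<xi> xe)
  have r3: "(S *v \<xi>) \<bullet> (S *v \<xi>) = (y / z)\<^sup>2 * (1 + c\<^sup>2)" by (simp add: S\<xi> ee power2_eq_square)
  define X where "X = x \<bullet> \<xi>"
  have f1: "\<alpha> * y * c / (z * w) + m * c / w + (b1 * c / w - 2 * X) / \<zeta> = 0"
    using first unfolding r1 pxi X_def[symmetric] using w by (simp add: power2_eq_square mult.assoc)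
  have "(z * w) * (\<alpha> * y * c / (z * w) + m * c / w + (b1 * c / w - 2 * X) / \<zeta>)
      = \<alpha> * y * c + z * ((m + b1 / \<zeta>) * c - 2 * w * X / \<zeta>)"
    using w z zeta by (simp add: field_simps)
  then have "\<alpha> * y * c + z * ((m + b1 / \<zeta>) * c - 2 * w * X / \<zeta>) = 0" using f1 by simp
  then show "\<alpha> * y * c = - z * ((m + b1 / \<zeta>) * c - 2 * w * (x \<bullet> \<xi>) / \<zeta>)" by (simp add: X_def)
  \<comment> \<open>This substitution leaves a square with the factor \<alpha>^2, which a small
    \<alpha> makes harmless against the good term in \<alpha> y^2.\<close>
  have g1: "(b1 * (p \<bullet> \<xi>) - 2 * (x \<bullet> \<xi>)) / \<zeta> = - ((\<alpha> * y * c / z + m * c) / w)"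
  proof -
    have "(\<alpha> * y * c / z + m * c) / w = \<alpha> * y * c / (z * w) + m * c / w" by (simp add: add_divide_distrib)
    then show ?thesis unfolding pxi X_def[symmetric] using f1 by simp
  qed
  define t where "t = \<xi> \<bullet> (T *v \<xi>)"
  define k where "k = \<xi> \<bullet> \<xi>"
  define u where "u = \<alpha> * y * c / z + m * c"
  have sec: "\<alpha> * (((y / z)\<^sup>2 * (1 + c\<^sup>2) + t) / w\<^sup>2 - 2 * (y * w * c / z)\<^sup>2 / (w\<^sup>2)\<^sup>2)
       + m * (y / z) + (b1 * (y / z) + b2 * (c / w)\<^sup>2 - 2 * k) / \<zeta> - (- (u / w))\<^sup>2 \<le> 0"
    using second unfolding g1 unfolding r1 r2 r3 pxi t_def k_def u_def .
  have "(z * w\<^sup>2) * (\<alpha> * (((y / z)\<^sup>2 * (1 + c\<^sup>2) + t) / w\<^sup>2 - 2 * (y * w * c / z)\<^sup>2 / (w\<^sup>2)\<^sup>2)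
       + m * (y / z) + (b1 * (y / z) + b2 * (c / w)\<^sup>2 - 2 * k) / \<zeta> - (- (u / w))\<^sup>2) \<le> 0"
    using sec z w by (simp add: mult_le_0_iff)
  also have "(z * w\<^sup>2) * (\<alpha> * (((y / z)\<^sup>2 * (1 + c\<^sup>2) + t) / w\<^sup>2 - 2 * (y * w * c / z)\<^sup>2 / (w\<^sup>2)\<^sup>2)
       + m * (y / z) + (b1 * (y / z) + b2 * (c / w)\<^sup>2 - 2 * k) / \<zeta> - (- (u / w))\<^sup>2)
     = \<alpha> * (y\<^sup>2 * (1 + c\<^sup>2) / z + z * t - 2 * y\<^sup>2 * c\<^sup>2 / z) + w\<^sup>2 * (m + b1 / \<zeta>) * y
       + z * b2 * c\<^sup>2 / \<zeta> - 2 * w\<^sup>2 * z * k / \<zeta> - z * u\<^sup>2"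
  proof -
    have e1: "(z * w\<^sup>2) * (\<alpha> * (((y / z)\<^sup>2 * (1 + c\<^sup>2) + t) / w\<^sup>2 - 2 * (y * w * c / z)\<^sup>2 / (w\<^sup>2)\<^sup>2))
       = \<alpha> * (y\<^sup>2 * (1 + c\<^sup>2) / z + z * t - 2 * y\<^sup>2 * c\<^sup>2 / z)"
      using w z by (simp add: field_simps power2_eq_square)
    have e2: "(z * w\<^sup>2) * ((b1 * (y / z) + b2 * (c / w)\<^sup>2 - 2 * k) / \<zeta>)
       = w\<^sup>2 * (b1 / \<zeta>) * y + z * b2 * c\<^sup>2 / \<zeta> - 2 * w\<^sup>2 * z * k / \<zeta>"
      using w z zeta by (simp add: field_simps power2_eq_square)
    have e3: "(z * w\<^sup>2) * (m * (y / z)) = w\<^sup>2 * m * y" using z by simp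
    have e4: "(z * w\<^sup>2) * (- (u / w))\<^sup>2 = z * u\<^sup>2" using w by (simp add: power2_eq_square)
    have dist: "(z * w\<^sup>2) * (A + B + C - D) = (z * w\<^sup>2) * A + (z * w\<^sup>2) * B + (z * w\<^sup>2) * C - (z * w\<^sup>2) * D" for A B C D
      by (simp add: algebra_simps)
    show ?thesis unfolding dist e1 e2 e3 e4 by (simp add: algebra_simps)
  qed
  finally have "\<alpha> * (y\<^sup>2 * (1 + c\<^sup>2) / z + z * t - 2 * y\<^sup>2 * c\<^sup>2 / z) + w\<^sup>2 * (m + b1 / \<zeta>) * y
       + z * b2 * c\<^sup>2 / \<zeta> - 2 * w\<^sup>2 * z * k / \<zeta> - z * u\<^sup>2 \<le> 0" .
  moreover have "y\<^sup>2 * (1 + c\<^sup>2) / z + z * t - 2 * y\<^sup>2 * c\<^sup>2 / z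
     = w * a + l * (p \<bullet> (S *v p)) / w + (y\<^sup>2 * (1 + c\<^sup>2) - (p \<bullet> p) * y) / z"
    unfolding t_def ident by (simp add: diff_divide_distrib)
  ultimately show "\<alpha> * (w * a + l * (p \<bullet> (S *v p)) / w + (y\<^sup>2 * (1 + c\<^sup>2) - (p \<bullet> p) * y) / z) + w\<^sup>2 * (m + b1 / \<zeta>) * y
       + z * b2 * c\<^sup>2 / \<zeta> - 2 * w\<^sup>2 * z * (\<xi> \<bullet> \<xi>) / \<zeta> - z * (\<alpha> * y * c / z + m * c)\<^sup>2 \<le> 0"
    unfolding k_def u_def by simp
qed

text \<open>The first-order condition expresses the derivative of the normal through the test function.\<close>

lemma upnormal_derivative_bound:
  fixes P :: "real \<Rightarrow> real^'n" and S :: "real^'n^'n"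
  assumes P: "(P has_derivative (\<lambda>h. h *\<^sub>R (S *v p))) (at 0)" and P0: "P 0 = p"
    and sym: "transpose S = S"
    and first: "\<And>\<xi>. \<alpha> * (p \<bullet> (S *v \<xi>)) / (wfun p)\<^sup>2 + m * (p \<bullet> \<xi>) + (b1 * (p \<bullet> \<xi>) - 2 * (x \<bullet> \<xi>)) / \<zeta> = 0"
    and V: "m + b1 / \<zeta> \<ge> 0" and zeta: "\<zeta> > 0" and \<alpha>: "\<alpha> > 0"
  obtains N where "((\<lambda>t. upnormal (P t)) has_derivative (\<lambda>h. h *\<^sub>R N)) (at 0)"
    "\<alpha> * norm N \<le> wfun p * (2 * (m + b1 / \<zeta>) + 3 * (2 * norm x / \<zeta>))"
proof -
  define w where "w = wfun p"
  define V where "V = m + b1 / \<zeta>"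
  define g where "g = (2 / \<zeta>) *\<^sub>R x - V *\<^sub>R p"
  define G where "G = 2 * norm x / \<zeta>"
  have w: "w > 0" "w \<ge> 1" by (simp_all add: w_def wfun_pos wfun_ge_1)
  have w2: "w\<^sup>2 = 1 + p \<bullet> p" by (simp add: w_def wfun_square)
  have "(norm p)\<^sup>2 \<le> w\<^sup>2" unfolding w2 power2_norm_eq_inner by simp
  then have np: "norm p \<le> w" using w(1) by (rule power2_le_imp_le[OF _ less_imp_le])
  have G0: "G \<ge> 0" using zeta by (simp add: G_def)
  \<comment> \<open>The first-order condition in all directions determines the vector D^2u p, hence
    the derivative of the normal along \<open>p\<close>.\<close>
  have Sp: "\<alpha> *\<^sub>R (S *v p) = w\<^sup>2 *\<^sub>R g"
  proof (rule vector_eq_ldot[THEN iffD1], rule allI)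
    fix \<xi>
    have "\<alpha> * (p \<bullet> (S *v \<xi>)) / w\<^sup>2 = g \<bullet> \<xi>"
    proof -
      have "(b1 * (p \<bullet> \<xi>) - 2 * (x \<bullet> \<xi>)) / \<zeta> = b1 / \<zeta> * (p \<bullet> \<xi>) - 2 / \<zeta> * (x \<bullet> \<xi>)"
        by (simp add: diff_divide_distrib)
      moreover have "g \<bullet> \<xi> = 2 / \<zeta> * (x \<bullet> \<xi>) - (m * (p \<bullet> \<xi>) + b1 / \<zeta> * (p \<bullet> \<xi>))"
        by (simp add: g_def V_def inner_diff_left distrib_right)
      ultimately show ?thesis using first[of \<xi>] by (simp add: w_def)
    qed
    then have "\<alpha> * (p \<bullet> (S *v \<xi>)) = w\<^sup>2 * (g \<bullet> \<xi>)" using w by (simp add: field_simps)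
    then show "\<xi> \<bullet> (\<alpha> *\<^sub>R (S *v p)) = \<xi> \<bullet> (w\<^sup>2 *\<^sub>R g)"
      using inner_matrix_vector_symmetric[OF sym, of p \<xi>] by (simp add: inner_commute)
  qed
  define w' where "w' = (p \<bullet> (S *v p)) / w"
  have Wd: "((\<lambda>t. wfun (P t)) has_derivative (\<lambda>h. h * w')) (at 0)"
    using wfun_has_derivative[OF P] by (simp add: P0 w'_def w_def)
  have aw': "\<alpha> * w' = w * (g \<bullet> p)"
  proof -
    have "\<alpha> * (p \<bullet> (S *v p)) = w\<^sup>2 * (g \<bullet> p)"
      using arg_cong[OF Sp, of "\<lambda>v. p \<bullet> v"] by (simp add: inner_commute)
    then show ?thesis using w by (simp add: w'_def power2_eq_square)
  qed
  define N where "N = ((w' / w\<^sup>2) *\<^sub>R p - (1 / w) *\<^sub>R (S *v p), - (w' / w\<^sup>2))"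
  have nz: "wfun (P 0) \<noteq> 0" using w by (simp add: P0 w_def)
  have "((\<lambda>t. upnormal (P t)) has_derivative (\<lambda>h. h *\<^sub>R N)) (at 0)"
    unfolding upnormal_def
    apply (rule has_derivative_eq_rhs)
     apply (rule has_derivative_Pair[OF has_derivative_minus[OF has_derivative_scaleR[OF
        has_derivative_divide[OF has_derivative_const Wd nz] P]] has_derivative_divide[OF has_derivative_const Wd nz]])
    using w apply (simp add: fun_eq_iff P0 w_def[symmetric] N_def power2_eq_square algebra_simps)
    apply (simp add: field_simps)
    done
  moreover have "\<alpha> * norm N \<le> w * (2 * V + 3 * G)"
  proof -
    have ng: "\<bar>g \<bullet> p\<bar> \<le> V * (p \<bullet> p) + G * norm p"
    proof -
      have "\<bar>(2 / \<zeta>) * (x \<bullet> p)\<bar> \<le> (2 / \<zeta>) * (norm x * norm p)"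
        unfolding abs_mult using zeta mult_left_mono[OF Cauchy_Schwarz_ineq2[of x p], of "2 / \<zeta>"] by simp
      then have "\<bar>(2 / \<zeta>) * (x \<bullet> p)\<bar> \<le> G * norm p" by (simp add: G_def)
      moreover have "\<bar>V * (p \<bullet> p)\<bar> = V * (p \<bullet> p)" using V by (simp add: V_def)
      moreover have "g \<bullet> p = (2 / \<zeta>) * (x \<bullet> p) - V * (p \<bullet> p)" by (simp add: g_def inner_diff_left)
      ultimately show ?thesis by linarith
    qed
    have pp: "p \<bullet> p \<le> w * w" using w2 by (simp add: power2_eq_square)
    have n2: "\<bar>\<alpha> * (w' / w\<^sup>2)\<bar> \<le> w * V + G"
    proof -
      have "\<alpha> * (w' / w\<^sup>2) = (\<alpha> * w') / w\<^sup>2" by simp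
      also have "\<dots> = (g \<bullet> p) / w" unfolding aw' using w by (simp add: power2_eq_square)
      finally have "\<bar>\<alpha> * (w' / w\<^sup>2)\<bar> = \<bar>g \<bullet> p\<bar> / w" using w by simp
      also have "\<dots> \<le> (V * (w * w) + G * w) / w"
        using ng w np pp V G0 by (intro divide_right_mono order_trans[OF ng] add_mono mult_left_mono) (auto simp: V_def)
      also have "\<dots> = w * V + G" using w by (simp add: field_simps)
      finally show ?thesis .
    qed
    have n1: "\<alpha> * norm ((w' / w\<^sup>2) *\<^sub>R p - (1 / w) *\<^sub>R (S *v p)) \<le> V + 2 * w * G"
    proof -
      have "\<alpha> *\<^sub>R ((w' / w\<^sup>2) *\<^sub>R p - (1 / w) *\<^sub>R (S *v p)) = ((\<alpha> * w') / w\<^sup>2) *\<^sub>R p - (1 / w) *\<^sub>R (\<alpha> *\<^sub>R (S *v p))"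
        by (simp add: scaleR_diff_right)
      also have "\<dots> = ((g \<bullet> p) / w) *\<^sub>R p - w *\<^sub>R g"
        unfolding aw' Sp using w by (simp add: power2_eq_square)
      \<comment> \<open>Two contributions of \<open>V\<close>, each of order w^2 V, cancel up to (V
        / w) p because |p|^2 = w^2 - 1. Without this the bound by w could not hold.\<close>
      also have "\<dots> = (V / w) *\<^sub>R p + (2 / \<zeta>) *\<^sub>R (((x \<bullet> p) / w) *\<^sub>R p - w *\<^sub>R x)"
      proof -
        have "(g \<bullet> p) / w = (2 / \<zeta>) * ((x \<bullet> p) / w) - V * (w - 1 / w)"
        proof -
          have "p \<bullet> p = w * w - 1" using w2 by (simp add: power2_eq_square)
          then show ?thesis using w by (simp add: g_def inner_diff_left diff_divide_distrib) (simp add: field_simps)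
        qed
        then have k: "(g \<bullet> p) / w + w * V = V / w + (2 / \<zeta>) * ((x \<bullet> p) / w)"
          by (simp add: algebra_simps)
        have "((g \<bullet> p) / w) *\<^sub>R p - w *\<^sub>R g = ((g \<bullet> p) / w + w * V) *\<^sub>R p - (w * (2 / \<zeta>)) *\<^sub>R x"
          by (subst (2) g_def) (simp add: scaleR_diff_right scaleR_add_left)
        then show ?thesis unfolding k by (simp add: scaleR_diff_right scaleR_add_left mult.commute)
      qed
      finally have eq: "\<alpha> *\<^sub>R ((w' / w\<^sup>2) *\<^sub>R p - (1 / w) *\<^sub>R (S *v p)) = (V / w) *\<^sub>R p + (2 / \<zeta>) *\<^sub>R (((x \<bullet> p) / w) *\<^sub>R p - w *\<^sub>R x)" .
      have "norm (((x \<bullet> p) / w) *\<^sub>R p) \<le> w * norm x"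
      proof -
        have "norm (((x \<bullet> p) / w) *\<^sub>R p) = \<bar>x \<bullet> p\<bar> * norm p / w" using w by simp
        also have "\<dots> \<le> (norm x * w) * w / w"
          using w np by (intro divide_right_mono mult_mono order_trans[OF Cauchy_Schwarz_ineq2] mult_left_mono) auto
        finally show ?thesis using w by (simp add: mult.commute)
      qed
      then have a: "norm (((x \<bullet> p) / w) *\<^sub>R p - w *\<^sub>R x) \<le> 2 * w * norm x"
        using norm_triangle_ineq4[of "((x \<bullet> p) / w) *\<^sub>R p" "w *\<^sub>R x"] w by simp
      have b: "norm ((V / w) *\<^sub>R p) \<le> V"
      proof -
        have "norm ((V / w) *\<^sub>R p) = V / w * norm p" using V w by (simp add: V_def)
        also have "\<dots> \<le> V / w * w" using np V w by (intro mult_left_mono) (auto simp: V_def)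
        finally show ?thesis using w by simp
      qed
      have "norm ((2 / \<zeta>) *\<^sub>R (((x \<bullet> p) / w) *\<^sub>R p - w *\<^sub>R x)) \<le> (2 / \<zeta>) * (2 * w * norm x)"
        using a zeta by (simp add: divide_right_mono)
      then have "norm ((V / w) *\<^sub>R p + (2 / \<zeta>) *\<^sub>R (((x \<bullet> p) / w) *\<^sub>R p - w *\<^sub>R x)) \<le> V + (2 / \<zeta>) * (2 * w * norm x)"
        using b norm_triangle_ineq[of "(V / w) *\<^sub>R p"] by (smt (verit))
      then have "norm (\<alpha> *\<^sub>R ((w' / w\<^sup>2) *\<^sub>R p - (1 / w) *\<^sub>R (S *v p))) \<le> V + (2 / \<zeta>) * (2 * w * norm x)"
        unfolding eq .
      moreover have "(2 / \<zeta>) * (2 * w * norm x) = 2 * w * G" by (simp add: G_def)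
      ultimately show ?thesis using \<alpha> unfolding norm_scaleR[of \<alpha>] by simp
    qed
    have "\<alpha> * norm N \<le> \<alpha> * (norm ((w' / w\<^sup>2) *\<^sub>R p - (1 / w) *\<^sub>R (S *v p)) + norm (- (w' / w\<^sup>2)))"
      unfolding N_def using \<alpha> by (intro mult_left_mono norm_Pair_le) auto
    also have "\<dots> = \<alpha> * norm ((w' / w\<^sup>2) *\<^sub>R p - (1 / w) *\<^sub>R (S *v p)) + \<bar>\<alpha> * (w' / w\<^sup>2)\<bar>"
      using \<alpha> by (simp add: distrib_left abs_mult)
    also have "\<dots> \<le> (V + 2 * w * G) + (w * V + G)" using n1 n2 by linarith
    also have "\<dots> \<le> w * (2 * V + 3 * G)"
    proof -
      have "V \<le> w * V" "G \<le> w * G" using w V G0 by (auto simp: V_def mult_le_cancel_right1)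
      then show ?thesis by (simp add: algebra_simps)
    qed
    finally show ?thesis .
  qed
  ultimately show ?thesis using that unfolding w_def V_def G_def by blast
qed

context curvature_function
begin

text \<open>The directional inequalities are multiplied by the weights of the linearised equation
  and summed. The outcome involves only finite families of numbers, so that the rest of the argument
  is free of geometry.\<close>

lemma maximum_point_estimate:
  fixes u :: "real^'n \<Rightarrow> real" and Du :: "real^'n \<Rightarrow> real^'n" and D2u :: "real^'n \<Rightarrow> real^'n^'n"
    and \<beta> \<beta>1 :: "real \<Rightarrow> real" and x :: "real^'n" and R m :: real
    and D\<psi> :: "((real^'n) \<times> real \<times> ((real^'n) \<times> real)) \<Rightarrow>\<^sub>L real"
  defines "A \<equiv> \<lambda>y. curv_mat (u y) (Du y) (D2u y)" and "J \<equiv> \<lambda>y. (y, u y, upnormal (Du y))"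
  assumes fin: "\<bar>f0\<bar> \<noteq> \<infinity>" and S: "open S" "x \<in> S"
    and upos: "\<And>y. y \<in> S \<Longrightarrow> u y > 0"
    and du: "\<And>y. y \<in> S \<Longrightarrow> (u has_derivative (\<lambda>h. Du y \<bullet> h)) (at y)"
    and d2u: "\<And>y. y \<in> S \<Longrightarrow> (Du has_derivative (\<lambda>h. D2u y *v h)) (at y)"
    and d3u: "(D2u has_derivative D3) (at x)"
    and adm: "\<And>y. y \<in> S \<Longrightarrow> \<exists>l. eigvals_are (A y) l \<and> l \<in> closure \<Gamma>"
    and eq: "\<And>y. y \<in> S \<Longrightarrow> solves_at \<Gamma> f h g (A y) (\<psi> (J y))"
    and dat: "\<And>l. eigvals_are (A x) l \<Longrightarrow> l \<in> frontier \<Gamma> \<Longrightarrow> degenerate_data \<Gamma> f h g"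
    and \<psi>: "(\<psi> has_derivative blinfun_apply D\<psi>) (at (J x))" and K: "norm D\<psi> \<le> K"
    and str: "(\<psi> (J x) - real_of_ereal f0) / u x \<le> D\<psi> (0, 1, 0)"
    and \<alpha>: "\<alpha> > 0" and m: "m \<ge> 0"
    and \<beta>: "\<And>t. t > 0 \<Longrightarrow> (\<beta> has_real_derivative \<beta>1 t) (at t)"
    and \<beta>1: "(\<beta>1 has_real_derivative b2) (at (u x))" and b1: "\<beta>1 (u x) \<ge> 0"
    and d: "d > 0"
    and max: "\<And>y. y \<in> ball x d \<Longrightarrow> y \<in> S \<and> R - y \<bullet> y + \<beta> (u y) > 0 \<and>
        \<alpha> / 2 * ln (1 + Du y \<bullet> Du y) + m * u y + ln (R - y \<bullet> y + \<beta> (u y))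
        \<le> \<alpha> / 2 * ln (1 + Du x \<bullet> Du x) + m * u x + ln (R - x \<bullet> x + \<beta> (u x))"
  defines "p \<equiv> Du x" and "z \<equiv> u x" and "\<zeta> \<equiv> R - x \<bullet> x + \<beta> (u x)"
  defines "w \<equiv> wfun p" and "s \<equiv> p \<bullet> p" and "G \<equiv> 2 * norm x / \<zeta>" and "V \<equiv> m + \<beta>1 z / \<zeta>"
  obtains H D and \<phi> y c :: "'n \<Rightarrow> real"
  where "\<And>i. 0 \<le> \<phi> i" "0 \<le> H" "0 \<le> D" "H * gap \<le> (\<Sum>i\<in>UNIV. \<phi> i) + D" "H = 0 \<Longrightarrow> 0 < (\<Sum>i\<in>UNIV. \<phi> i)"
    "(\<Sum>i\<in>UNIV. (c i)\<^sup>2) = s"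
    "\<alpha> * (\<Sum>i\<in>UNIV. (c i)\<^sup>2 * y i) = - z * (V * s - 2 * (x \<bullet> p) / \<zeta>)"
    "\<And>i. y i < - 1 \<Longrightarrow> 2 * \<delta> * (\<Sum>i\<in>UNIV. \<phi> i) \<le> \<phi> i"
    "\<alpha> * w * s * D / z + \<alpha> * s * (\<Sum>i\<in>UNIV. \<phi> i) / z
      + (\<Sum>i\<in>UNIV. \<phi> i * ((\<alpha> * (y i)\<^sup>2 * (1 + (c i)\<^sup>2) - \<alpha>\<^sup>2 * (y i)\<^sup>2 * (c i)\<^sup>2) / z
           - 2 * \<alpha> * m * y i * (c i)\<^sup>2 - z * m\<^sup>2 * (c i)\<^sup>2 + z * b2 * (c i)\<^sup>2 / \<zeta>))
      \<le> w\<^sup>2 * (V * (\<Sum>i\<in>UNIV. \<phi> i) + H * K * (\<alpha> + (3 + z) * G + 2 * V) + 2 * z * (\<Sum>i\<in>UNIV. \<phi> i) / \<zeta>)"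
proof -
  define Sx where "Sx = D2u x"
  define T where "T = D3 p"
  have z: "z > 0" using upos[OF S(2)] by (simp add: z_def)
  have zeta: "\<zeta> > 0" using max[of x] d by (simp add: \<zeta>_def)
  have w: "w > 0" "w \<ge> 1" by (simp_all add: w_def wfun_pos wfun_ge_1)
  have w2: "w\<^sup>2 = 1 + s" by (simp add: w_def wfun_square s_def)
  have V: "V \<ge> 0" using m b1 zeta by (simp add: V_def z_def)
  have symS: "transpose (D2u y) = D2u y" if "y \<in> S" for y
    by (rule hessian_symmetric[OF S(1) that du d2u[OF that]])
  have sym: "transpose Sx = Sx" using symS[OF S(2)] by (simp add: Sx_def)
  define dd where "dd e = d / (norm e + 1)" for e :: "real^'n"
  have dd: "dd e > 0" for e using d by (simp add: dd_def add_nonneg_pos)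
  have inb: "x + t *\<^sub>R e \<in> ball x d" if "\<bar>t\<bar> < dd e" for t e
  proof -
    have "\<bar>t\<bar> * norm e \<le> \<bar>t\<bar> * (norm e + 1)" by (simp add: mult_left_mono)
    also have "\<dots> < d" using that by (simp add: dd_def pos_less_divide_eq add_nonneg_pos)
    finally show ?thesis by (simp add: dist_norm)
  qed
  have line: "((\<lambda>t. x + t *\<^sub>R e) has_derivative (\<lambda>h. h *\<^sub>R e)) (at t)" for e t
    by (rule has_derivative_eq_rhs[OF has_derivative_add[OF has_derivative_const
          has_derivative_scaleR_left[OF has_derivative_ident]]]) simp
  have uL: "((\<lambda>t. u (x + t *\<^sub>R e)) has_derivative (\<lambda>h. h * (Du (x + t *\<^sub>R e) \<bullet> e))) (at t)"
    if "x + t *\<^sub>R e \<in> S" for e t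
    using has_derivative_compose[OF line du[OF that]] by (simp only: inner_scaleR_right)
  have DuL: "((\<lambda>t. Du (x + t *\<^sub>R e)) has_derivative (\<lambda>h. h *\<^sub>R (D2u (x + t *\<^sub>R e) *v e))) (at t)"
    if "x + t *\<^sub>R e \<in> S" for e t
    using has_derivative_compose[OF line d2u[OF that]] by (simp only: matrix_vector_mult_scaleR)
  have D2L: "((\<lambda>t. D2u (x + t *\<^sub>R e)) has_derivative (\<lambda>h. h *\<^sub>R D3 e)) (at 0)" for e
  proof -
    have "(D2u has_derivative D3) (at (x + 0 *\<^sub>R e))" using d3u by simp
    from has_derivative_compose[OF line this]
    show ?thesis by (simp only: linear_cmul[OF has_derivative_linear[OF d3u]])
  qed
  have D2vL: "((\<lambda>t. D2u (x + t *\<^sub>R e) *v e) has_derivative (\<lambda>h. h *\<^sub>R (D3 e *v e))) (at 0)" for e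
    using has_derivative_matrix_vector_mult[OF D2L has_derivative_const[of e]]
    by (simp only: matrix_vector_mult_0_right add_0_left scaleR_matrix_vector_assoc)
  have x0S: "x + 0 *\<^sub>R e \<in> S" for e using S(2) by simp
  have so: "\<alpha> * (p \<bullet> (Sx *v e)) / w\<^sup>2 + m * (p \<bullet> e) + (\<beta>1 z * (p \<bullet> e) - 2 * (x \<bullet> e)) / \<zeta> = 0 \<and>
     \<alpha> * (((Sx *v e) \<bullet> (Sx *v e) + p \<bullet> (D3 e *v e)) / w\<^sup>2 - 2 * (p \<bullet> (Sx *v e))\<^sup>2 / (w\<^sup>2)\<^sup>2)
       + m * ((Sx *v e) \<bullet> e) + (\<beta>1 z * ((Sx *v e) \<bullet> e) + b2 * (p \<bullet> e)\<^sup>2 - 2 * (e \<bullet> e)) / \<zeta>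
       - ((\<beta>1 z * (p \<bullet> e) - 2 * (x \<bullet> e)) / \<zeta>)\<^sup>2 \<le> 0" for e
  proof -
    define U where "U t = u (x + t *\<^sub>R e)" for t
    define P where "P t = Du (x + t *\<^sub>R e)" for t
    define Q where "Q t = D2u (x + t *\<^sub>R e) *v e" for t
    have U0: "U 0 = z" and P0: "P 0 = p" and Q0: "Q 0 = Sx *v e"
      by (simp_all add: U_def P_def Q_def z_def p_def Sx_def)
    have 1: "(U has_real_derivative (P t \<bullet> e)) (at t)" if "\<bar>t\<bar> < dd e" for t
    proof -
      have "x + t *\<^sub>R e \<in> S" using max inb[OF that] by blast
      from uL[OF this] show ?thesis
        by (simp only: U_def[abs_def] P_def has_field_derivative_def mult.commute[of _ "_ \<bullet> _"])
    qed
    have 2: "(P has_vector_derivative Q t) (at t)" if "\<bar>t\<bar> < dd e" for t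
    proof -
      have "x + t *\<^sub>R e \<in> S" using max inb[OF that] by blast
      from DuL[OF this] show ?thesis by (simp only: P_def[abs_def] Q_def has_vector_derivative_def)
    qed
    have 3: "(Q has_vector_derivative (D3 e *v e)) (at 0)"
      using D2vL[of e] by (simp only: Q_def[abs_def] has_vector_derivative_def)
    have 4: "(\<beta> has_real_derivative \<beta>1 (U t)) (at (U t))" if "\<bar>t\<bar> < dd e" for t
      unfolding U_def using \<beta> upos max inb[OF that] by blast
    have 5: "(\<beta>1 has_real_derivative b2) (at (U 0))" using \<beta>1 by (simp add: U_def)
    have 6: "R - (x + t *\<^sub>R e) \<bullet> (x + t *\<^sub>R e) + \<beta> (U t) > 0" if "\<bar>t\<bar> < dd e" for t
      unfolding U_def using max inb[OF that] by blast
    have 7: "\<alpha> / 2 * ln (1 + P t \<bullet> P t) + m * U t + ln (R - (x + t *\<^sub>R e) \<bullet> (x + t *\<^sub>R e) + \<beta> (U t))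
      \<le> \<alpha> / 2 * ln (1 + P 0 \<bullet> P 0) + m * U 0 + ln (R - x \<bullet> x + \<beta> (U 0))" if "\<bar>t\<bar> < dd e" for t
      using max[OF inb[OF that]] by (simp add: U_def P_def)
    have N: "1 + p \<bullet> p = w\<^sup>2" using w2 by (simp add: s_def)
    have Z: "R - x \<bullet> x + \<beta> z = \<zeta>" by (simp add: \<zeta>_def z_def)
    show ?thesis
      using second_order_along_line[OF dd 1 2 3 4 5 6 7] unfolding U0 P0 Q0 N Z by blast
  qed
  then have first: "\<alpha> * (p \<bullet> (Sx *v e)) / w\<^sup>2 + m * (p \<bullet> e) + (\<beta>1 z * (p \<bullet> e) - 2 * (x \<bullet> e)) / \<zeta> = 0" for e
    by blast
  have PL: "((\<lambda>t. Du (x + t *\<^sub>R p)) has_derivative (\<lambda>h. h *\<^sub>R (Sx *v p))) (at 0)"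
    using DuL[OF x0S, of p] by (simp add: Sx_def)
  have ZL: "((\<lambda>t. u (x + t *\<^sub>R p)) has_derivative (\<lambda>h. h * (p \<bullet> p))) (at 0)"
    using uL[OF x0S, of p] by (simp add: p_def)
  obtain N where N: "((\<lambda>t. upnormal (Du (x + t *\<^sub>R p))) has_derivative (\<lambda>h. h *\<^sub>R N)) (at 0)"
    and Nb: "\<alpha> * norm N \<le> w * (2 * V + 3 * G)"
    using upnormal_derivative_bound[OF PL _ sym, of \<alpha> m "\<beta>1 z" x \<zeta>] first V zeta \<alpha>
    unfolding V_def[symmetric] G_def[symmetric] w_def[symmetric] by (auto simp: p_def)
  obtain B where B: "((\<lambda>t. curv_mat (u (x + t *\<^sub>R p)) (Du (x + t *\<^sub>R p)) (D2u (x + t *\<^sub>R p))) has_derivative (\<lambda>h. h *\<^sub>R B)) (at 0)"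
    using curv_mat_differentiable[OF PL ZL D2L[of p]] by blast
  have B': "((\<lambda>t. A (x + t *\<^sub>R p)) has_derivative (\<lambda>h. h *\<^sub>R B)) (at 0)" using B by (simp only: A_def)
  define Y' where "Y' = D\<psi> (p, s, N)"
  have JL: "((\<lambda>t. J (x + t *\<^sub>R p)) has_derivative (\<lambda>h. (h *\<^sub>R p, h * s, h *\<^sub>R N))) (at 0)"
    unfolding J_def s_def by (intro has_derivative_Pair line ZL N)
  have \<psi>0: "(\<psi> has_derivative blinfun_apply D\<psi>) (at (J (x + 0 *\<^sub>R p)))" using \<psi> by simp
  have YL: "((\<lambda>t. \<psi> (J (x + t *\<^sub>R p))) has_derivative (\<lambda>h. h * Y')) (at 0)"
  proof -
    have "D\<psi> (h *\<^sub>R p, h * s, h *\<^sub>R N) = h * Y'" for h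
      using blinfun.scaleR_right[of D\<psi> h "(p, s, N)"] by (simp add: Y'_def)
    then show ?thesis using has_derivative_compose[OF JL \<psi>0] by (simp only:)
  qed
  define t where "t k = dd p / (real k + 2)" for k :: nat
  have t: "t k > 0" "\<bar>t k\<bar> < dd p" for k
    using dd[of p] by (auto simp: t_def field_simps add_pos_nonneg)
  have t0: "t \<longlonglongrightarrow> 0" unfolding t_def by real_asymp
  have tS: "x + t k *\<^sub>R p \<in> S" for k using max inb[OF t(2)] by blast
  have t1: "(\<lambda>k. (t k - 0) /\<^sub>R t k) \<longlonglongrightarrow> 1" using t(1) less_imp_neq[OF t(1), symmetric] by simp
  have limA: "(\<lambda>k. (A (x + t k *\<^sub>R p) - A x) /\<^sub>R t k) \<longlonglongrightarrow> B"
    using has_derivative_sequentially[OF B' UNIV_I t(1) t0 t1] by simp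
  have limY: "(\<lambda>k. (\<psi> (J (x + t k *\<^sub>R p)) - \<psi> (J x)) /\<^sub>R t k) \<longlonglongrightarrow> Y'"
    using has_derivative_sequentially[OF YL UNIV_I t(1) t0 t1] by simp
  obtain q mu \<phi>v H where q: "orthonormal_family q" and ev: "\<And>i. A x *v q i = mu $ i *\<^sub>R q i"
    and lw: "linearised_weights \<delta> gap (real_of_ereal f0) (\<psi> (J x)) mu \<phi>v H"
    and H0: "H = 0 \<Longrightarrow> (\<Sum>i\<in>UNIV. \<phi>v $ i) > 0"
    and lin: "H * Y' \<le> (\<Sum>i\<in>UNIV. \<phi>v $ i * (q i \<bullet> (B *v q i)))"
    by (rule linearisation[OF fin t(1) t0 limA limY adm[OF tS] eq[OF tS] eq[OF S(2)] dat]) blast+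
  define \<phi> where "\<phi> i = \<phi>v $ i" for i
  define \<tau> where "\<tau> = (\<Sum>i\<in>UNIV. \<phi> i)"
  define E where "E = (\<Sum>i\<in>UNIV. \<phi> i * mu $ i)"
  define a where "a i = q i \<bullet> (B *v q i)" for i
  define c where "c i = p \<bullet> q i" for i
  define y where "y i = w * mu $ i - 1" for i
  define \<xi> where "\<xi> i = gam p *v q i" for i
  have E': "\<phi>v \<bullet> mu = E" by (simp add: E_def \<phi>_def inner_vec_def)
  have \<phi>: "\<phi> i \<ge> 0" and H: "H \<ge> 0" and E0: "E \<ge> 0" and E1: "E \<le> H * (\<psi> (J x) - real_of_ereal f0)"
    and gp: "H * gap \<le> \<tau> + H * (\<psi> (J x) - real_of_ereal f0) - E"
    and neg: "mu $ j < 0 \<Longrightarrow> 2 * \<delta> * \<tau> \<le> \<phi> j" for i j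
    using lw unfolding linearised_weights_def E' by (auto simp: \<phi>_def \<tau>_def)
  have \<tau>: "\<tau> \<ge> 0" unfolding \<tau>_def by (intro sum_nonneg \<phi>)
  define \<Psi>u where "\<Psi>u = D\<psi> (0, 1, 0)"
  \<comment> \<open>The condition on \<psi> gives \<psi> - f(0) \<le> z \<psi>_u, and the weights
    satisfy \<open>E \<le> H * (\<psi> (J x) - real_of_ereal f0)\<close>. Together they make
    \<open>D\<close> nonnegative and turn the lower bound with \<open>gap\<close> into one for
    \<open>\<tau> + D\<close>.\<close>
  define D where "D = H * z * \<Psi>u - E"
  have "\<psi> (J x) - real_of_ereal f0 \<le> z * \<Psi>u"
    using str z by (simp add: \<Psi>u_def z_def field_simps)
  then have Hz: "H * (\<psi> (J x) - real_of_ereal f0) \<le> H * (z * \<Psi>u)" by (rule mult_left_mono[OF _ H])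
  have D: "D \<ge> 0" and gD: "H * gap \<le> \<tau> + D" using E1 gp Hz by (auto simp: D_def mult.assoc)
  have K0: "K \<ge> 0" using K norm_ge_zero order_trans by blast
  have "\<bar>\<Psi>u\<bar> \<le> norm D\<psi> * norm ((0, 1, 0) :: (real^'n) \<times> real \<times> ((real^'n) \<times> real))"
    unfolding \<Psi>u_def real_norm_def[symmetric] by (rule norm_blinfun)
  then have \<Psi>K: "\<Psi>u \<le> K" using K by (simp add: norm_Pair)
  have EK: "E \<le> H * (z * K)"
  proof -
    have "E \<le> H * (z * \<Psi>u)" using D by (simp add: D_def mult.assoc)
    also have "\<dots> \<le> H * (z * K)" using \<Psi>K z H by (intro mult_left_mono) auto
    finally show ?thesis .
  qed
  have qq: "q i \<bullet> q i = 1" for i using q by (simp add: orthonormal_family_def)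
  have dir1: "\<alpha> * y i * c i = - z * (V * c i - 2 * w * (x \<bullet> \<xi> i) / \<zeta>)"
    and dir2: "\<alpha> * (w * a i + mu $ i * (p \<bullet> (Sx *v p)) / w + ((y i)\<^sup>2 * (1 + (c i)\<^sup>2) - s * y i) / z) + w\<^sup>2 * V * y i
       + z * b2 * (c i)\<^sup>2 / \<zeta> - 2 * w\<^sup>2 * z * (\<xi> i \<bullet> \<xi> i) / \<zeta> - z * (\<alpha> * y i * c i / z + m * c i)\<^sup>2 \<le> 0" for i
  proof -
    have ev': "curv_mat z p Sx *v q i = mu $ i *\<^sub>R q i" using ev by (simp add: A_def z_def p_def Sx_def)
    have aL: "((\<lambda>t. q i \<bullet> (curv_mat (u (x + t *\<^sub>R p)) (Du (x + t *\<^sub>R p)) (D2u (x + t *\<^sub>R p)) *v q i)) has_derivative (\<lambda>t. t * a i)) (at 0)"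
      using has_derivative_inner_right[OF has_derivative_matrix_vector_mult[OF B has_derivative_const[of "q i"]], of "q i"]
      by (simp only: matrix_vector_mult_0_right add_0_left scaleR_matrix_vector_assoc[symmetric] inner_scaleR_right a_def)
    have id: "z * (\<xi> i \<bullet> (T *v \<xi> i)) = w * a i + mu $ i * (p \<bullet> (Sx *v p)) / w - (p \<bullet> p) * y i / z + 2 * (y i)\<^sup>2 * (c i)\<^sup>2 / z"
      unfolding \<xi>_def w_def c_def y_def T_def
      by (rule curv_mat_derivative_identity[OF PL _ ZL _ z D2L _ sym qq ev' aL]) (simp_all add: p_def z_def Sx_def)
    have third: "p \<bullet> (D3 (\<xi> i) *v \<xi> i) = \<xi> i \<bullet> (T *v \<xi> i)"
      unfolding T_def by (rule third_derivative_symmetric[OF S d2u symS d3u])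
    note args = sym qq[of i] z ev' y_def[of i, unfolded w_def] id[unfolded w_def \<xi>_def c_def]
      first[of "\<xi> i", unfolded w_def \<xi>_def] conjunct2[OF so[of "\<xi> i"], unfolded third, unfolded w_def \<xi>_def] zeta
    show "\<alpha> * y i * c i = - z * (V * c i - 2 * w * (x \<bullet> \<xi> i) / \<zeta>)"
      using direction_inequality(1)[OF args] unfolding V_def w_def \<xi>_def c_def .
    show "\<alpha> * (w * a i + mu $ i * (p \<bullet> (Sx *v p)) / w + ((y i)\<^sup>2 * (1 + (c i)\<^sup>2) - s * y i) / z) + w\<^sup>2 * V * y i
       + z * b2 * (c i)\<^sup>2 / \<zeta> - 2 * w\<^sup>2 * z * (\<xi> i \<bullet> \<xi> i) / \<zeta> - z * (\<alpha> * y i * c i / z + m * c i)\<^sup>2 \<le> 0"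
      using direction_inequality(2)[OF args] unfolding V_def w_def \<xi>_def c_def s_def .
  qed
  have csum: "(\<Sum>i\<in>UNIV. (c i)\<^sup>2) = s"
    using orthonormal_family_inner[OF q, of p p] by (simp add: c_def s_def power2_eq_square inner_commute)
  \<comment> \<open>The first-order conditions are weighted by \<open>c i\<close> and summed. Up to
    the position term, the mean of \<open>y\<close> with weights \<open>(c i)\<^sup>2\<close> is
    -zV/\<alpha>: this is the negative curvature in the direction of Du.\<close>
  have ysum: "\<alpha> * (\<Sum>i\<in>UNIV. (c i)\<^sup>2 * y i) = - z * (V * s - 2 * (x \<bullet> p) / \<zeta>)"
  proof -
    have xs: "(\<Sum>i\<in>UNIV. c i * (x \<bullet> \<xi> i)) = (x \<bullet> p) / w"
    proof -
      have "(\<Sum>i\<in>UNIV. c i * (x \<bullet> \<xi> i)) = (\<Sum>i\<in>UNIV. (p \<bullet> q i) * (q i \<bullet> (gam p *v x)))"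
        unfolding c_def \<xi>_def by (subst inner_commute[of x]) (simp only: gam_symmetric)
      also have "\<dots> = p \<bullet> (gam p *v x)" by (rule orthonormal_family_inner[OF q])
      finally show ?thesis by (simp add: inner_gam w_def inner_commute[of p x])
    qed
    have "\<alpha> * (\<Sum>i\<in>UNIV. (c i)\<^sup>2 * y i) = (\<Sum>i\<in>UNIV. c i * (\<alpha> * y i * c i))"
      by (simp add: sum_distrib_left power2_eq_square algebra_simps)
    also have "\<dots> = (\<Sum>i\<in>UNIV. - z * V * (c i)\<^sup>2 + (2 * z * w / \<zeta>) * (c i * (x \<bullet> \<xi> i)))"
      by (rule sum.cong[OF refl]) (unfold dir1, simp add: power2_eq_square algebra_simps)
    also have "\<dots> = - z * V * s + (2 * z * w / \<zeta>) * ((x \<bullet> p) / w)"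
      by (simp only: sum.distrib sum_distrib_left[symmetric] csum xs)
    also have "\<dots> = - z * (V * s - 2 * (x \<bullet> p) / \<zeta>)" using w by (simp add: algebra_simps)
    finally show ?thesis .
  qed
  define Kf where "Kf i = (\<alpha> * (y i)\<^sup>2 * (1 + (c i)\<^sup>2) - \<alpha>\<^sup>2 * (y i)\<^sup>2 * (c i)\<^sup>2) / z
           - 2 * \<alpha> * m * y i * (c i)\<^sup>2 - z * m\<^sup>2 * (c i)\<^sup>2 + z * b2 * (c i)\<^sup>2 / \<zeta>" for i
  define W' where "W' = (p \<bullet> (Sx *v p)) / w"
  have per: "\<alpha> * w * a i + mu $ i * (\<alpha> * W' + w ^ 3 * V - \<alpha> * s * w / z) - (w\<^sup>2 * V - \<alpha> * s / z) - 2 * w\<^sup>2 * z / \<zeta> + Kf i \<le> 0" for i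
  proof -
    have "\<xi> i \<bullet> \<xi> i \<le> 1"
      using gam_unit[OF qq, of p i] unfolding \<xi>_def by (metis le_add_same_cancel1 zero_le_power2)
    then have "2 * w\<^sup>2 * z * (\<xi> i \<bullet> \<xi> i) / \<zeta> \<le> 2 * w\<^sup>2 * z / \<zeta>"
      using w z zeta by (intro divide_right_mono) (auto simp: mult_left_le)
    moreover have "z * (\<alpha> * y i * c i / z + m * c i)\<^sup>2 = \<alpha>\<^sup>2 * (y i)\<^sup>2 * (c i)\<^sup>2 / z + 2 * \<alpha> * m * y i * (c i)\<^sup>2 + z * m\<^sup>2 * (c i)\<^sup>2"
      using z by (simp add: power2_eq_square field_simps)
    moreover have "\<alpha> * (w * a i + mu $ i * (p \<bullet> (Sx *v p)) / w + ((y i)\<^sup>2 * (1 + (c i)\<^sup>2) - s * y i) / z)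
       = \<alpha> * w * a i + mu $ i * (\<alpha> * W') + \<alpha> * (y i)\<^sup>2 * (1 + (c i)\<^sup>2) / z - \<alpha> * s * y i / z"
      by (simp add: W'_def algebra_simps diff_divide_distrib)
    moreover have "w\<^sup>2 * V * y i = mu $ i * (w ^ 3 * V) - w\<^sup>2 * V"
      by (simp add: y_def algebra_simps power2_eq_square power3_eq_cube)
    moreover have "\<alpha> * s * y i / z = mu $ i * (\<alpha> * s * w / z) - \<alpha> * s / z"
      by (simp add: y_def algebra_simps diff_divide_distrib)
    moreover have "mu $ i * (\<alpha> * W' + w ^ 3 * V - \<alpha> * s * w / z) = mu $ i * (\<alpha> * W') + mu $ i * (w ^ 3 * V) - mu $ i * (\<alpha> * s * w / z)"
      by (simp add: algebra_simps)
    moreover have "Kf i = \<alpha> * (y i)\<^sup>2 * (1 + (c i)\<^sup>2) / z - \<alpha>\<^sup>2 * (y i)\<^sup>2 * (c i)\<^sup>2 / z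
           - 2 * \<alpha> * m * y i * (c i)\<^sup>2 - z * m\<^sup>2 * (c i)\<^sup>2 + z * b2 * (c i)\<^sup>2 / \<zeta>"
      by (simp add: Kf_def diff_divide_distrib)
    ultimately show ?thesis using dir2[of i] by linarith
  qed
  have "(\<Sum>i\<in>UNIV. \<phi> i * (\<alpha> * w * a i + mu $ i * (\<alpha> * W' + w ^ 3 * V - \<alpha> * s * w / z) - (w\<^sup>2 * V - \<alpha> * s / z) - 2 * w\<^sup>2 * z / \<zeta> + Kf i)) \<le> 0"
    by (intro sum_nonpos mult_nonneg_nonpos \<phi> per)
  moreover have "(\<Sum>i\<in>UNIV. \<phi> i * (\<alpha> * w * a i + mu $ i * X1 - X2 - X3 + Kf i))
     = \<alpha> * w * (\<Sum>i\<in>UNIV. \<phi> i * a i) + E * X1 - \<tau> * X2 - \<tau> * X3 + (\<Sum>i\<in>UNIV. \<phi> i * Kf i)" for X1 X2 X3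
    by (simp add: algebra_simps sum.distrib sum_subtractf sum_distrib_left sum_distrib_right E_def \<tau>_def)
  ultimately have tot: "\<alpha> * w * (\<Sum>i\<in>UNIV. \<phi> i * a i) + E * (\<alpha> * W' + w ^ 3 * V - \<alpha> * s * w / z) - \<tau> * (w\<^sup>2 * V - \<alpha> * s / z)
      - \<tau> * (2 * w\<^sup>2 * z / \<zeta>) + (\<Sum>i\<in>UNIV. \<phi> i * Kf i) \<le> 0" by simp
  \<comment> \<open>The height derivative of \<psi> is split off since it belongs to
    \<open>D\<close>; the remaining part, in the position and the normal, is merely estimated by
    \<open>K\<close>.\<close>
  define \<omega> where "\<omega> = D\<psi> (p, 0, N)"
  have Y': "Y' = \<omega> + s * \<Psi>u"
  proof -
    have "(p, s, N) = (p, 0, N) + s *\<^sub>R (0, 1, 0)" by simp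
    then show ?thesis unfolding Y'_def \<omega>_def \<Psi>u_def by (simp only: blinfun.add_right blinfun.scaleR_right real_scaleR_def)
  qed
  have "\<alpha> * w * (H * Y') \<le> \<alpha> * w * (\<Sum>i\<in>UNIV. \<phi> i * a i)"
    using lin \<alpha> w by (intro mult_left_mono) (auto simp: \<phi>_def a_def)
  then have lin': "\<alpha> * w * H * \<omega> + \<alpha> * w * s * (H * \<Psi>u) \<le> \<alpha> * w * (\<Sum>i\<in>UNIV. \<phi> i * a i)"
    by (simp add: Y' algebra_simps)
  have np: "norm p \<le> w"
  proof (rule power2_le_imp_le)
    show "(norm p)\<^sup>2 \<le> w\<^sup>2" unfolding w2 power2_norm_eq_inner s_def by simp
  qed (use w in simp)
  have G0: "G \<ge> 0" using zeta by (simp add: G_def)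
  have om: "- (w\<^sup>2 * (H * K * (\<alpha> + 2 * V + 3 * G))) \<le> \<alpha> * w * H * \<omega>"
  proof -
    have "\<bar>\<omega>\<bar> \<le> norm D\<psi> * norm (p, 0 :: real, N)"
      unfolding \<omega>_def real_norm_def[symmetric] by (rule norm_blinfun)
    also have "\<dots> \<le> K * (norm p + norm N)"
      using K norm_Pair_le[of p "(0 :: real, N)"] norm_Pair_le[of "0 :: real" N] K0 by (intro mult_mono) auto
    finally have "\<bar>\<omega>\<bar> \<le> K * (norm p + norm N)" .
    then have "\<alpha> * \<bar>\<omega>\<bar> \<le> \<alpha> * (K * (norm p + norm N))" using \<alpha> by (intro mult_left_mono) auto
    also have "\<dots> = K * (\<alpha> * norm p + \<alpha> * norm N)" by (simp add: algebra_simps)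
    also have "\<dots> \<le> K * (\<alpha> * w + w * (2 * V + 3 * G))"
      using np Nb \<alpha> K0 by (intro mult_left_mono add_mono) auto
    also have "\<dots> = w * (K * (\<alpha> + 2 * V + 3 * G))" by (simp add: algebra_simps)
    finally have "(w * H) * (\<alpha> * \<bar>\<omega>\<bar>) \<le> (w * H) * (w * (K * (\<alpha> + 2 * V + 3 * G)))"
      using w H by (intro mult_left_mono) auto
    then have "\<alpha> * w * H * \<bar>\<omega>\<bar> \<le> w\<^sup>2 * (H * K * (\<alpha> + 2 * V + 3 * G))"
      by (simp add: power2_eq_square algebra_simps)
    moreover have "- (\<alpha> * w * H * \<bar>\<omega>\<bar>) \<le> \<alpha> * w * H * \<omega>"
    proof -
      have "(\<alpha> * w * H) * (- \<bar>\<omega>\<bar>) \<le> (\<alpha> * w * H) * \<omega>" using \<alpha> w H by (intro mult_left_mono) auto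
      then show ?thesis by simp
    qed
    ultimately show ?thesis by linarith
  qed
  have aW: "\<alpha> * W' = w * (2 * (x \<bullet> p) / \<zeta> - V * s)"
  proof -
    have "\<alpha> * (p \<bullet> (Sx *v p)) / w\<^sup>2 = 2 * (x \<bullet> p) / \<zeta> - V * s"
    proof -
      have "V * s = m * s + \<beta>1 z * s / \<zeta>" by (simp add: V_def distrib_right)
      then show ?thesis using first[of p] by (simp add: s_def diff_divide_distrib)
    qed
    then have "\<alpha> * (p \<bullet> (Sx *v p)) = w\<^sup>2 * (2 * (x \<bullet> p) / \<zeta> - V * s)"
      using w by (simp add: field_simps)
    then show ?thesis unfolding W'_def using w by (simp add: power2_eq_square)
  qed
  \<comment> \<open>In this coefficient the terms w V s cancel: one comes from the derivative of w
    in the first-order condition, the other from w^3 V with w^2 = 1 + s. What is left is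
    nonnegative, of size w^2 z G, or the part of \<open>D\<close> that contains
    \<open>E\<close>.\<close>
  have Eterm: "E * (\<alpha> * W' + w ^ 3 * V - \<alpha> * s * w / z) \<ge> - (w\<^sup>2 * (H * K * (z * G))) - \<alpha> * w * s * E / z"
  proof -
    have "w ^ 3 * V = w * V + w * V * s"
      using w2 by (simp add: power3_eq_cube power2_eq_square algebra_simps)
    then have "E * (\<alpha> * W' + w ^ 3 * V - \<alpha> * s * w / z) = E * w * (2 * (x \<bullet> p) / \<zeta>) + E * (w * V) - \<alpha> * w * s * E / z"
      unfolding aW by (simp add: algebra_simps)
    moreover have "E * (w * V) \<ge> 0" using E0 w V by simp
    moreover have "- (E * w * (G * w)) \<le> E * w * (2 * (x \<bullet> p) / \<zeta>)"
    proof -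
      have "\<bar>2 * (x \<bullet> p) / \<zeta>\<bar> = 2 / \<zeta> * \<bar>x \<bullet> p\<bar>" using zeta by (simp add: abs_mult)
      also have "\<dots> \<le> 2 / \<zeta> * (norm x * w)"
        using zeta np by (intro mult_left_mono order_trans[OF Cauchy_Schwarz_ineq2]) auto
      also have "\<dots> = G * w" by (simp add: G_def)
      finally have "\<bar>2 * (x \<bullet> p) / \<zeta>\<bar> \<le> G * w" .
      then have "- (G * w) \<le> 2 * (x \<bullet> p) / \<zeta>" by linarith
      then have "(E * w) * (- (G * w)) \<le> (E * w) * (2 * (x \<bullet> p) / \<zeta>)" using E0 w by (intro mult_left_mono) auto
      then show ?thesis by simp
    qed
    moreover have "E * w * (G * w) \<le> w\<^sup>2 * (H * K * (z * G))"
    proof -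
      have "E * (w * (G * w)) \<le> (H * (z * K)) * (w * (G * w))"
        using EK w G0 by (intro mult_right_mono) auto
      then show ?thesis by (simp add: power2_eq_square algebra_simps)
    qed
    ultimately show ?thesis by linarith
  qed
  have "\<alpha> * w * s * D / z = \<alpha> * w * s * (H * \<Psi>u) - \<alpha> * w * s * E / z"
    using z by (simp add: D_def algebra_simps diff_divide_distrib)
  moreover have "\<tau> * (w\<^sup>2 * V - \<alpha> * s / z) = w\<^sup>2 * (V * \<tau>) - \<alpha> * s * \<tau> / z"
    by (simp add: algebra_simps)
  moreover have "\<tau> * (2 * w\<^sup>2 * z / \<zeta>) = w\<^sup>2 * (2 * z * \<tau> / \<zeta>)" by simp
  moreover have "w\<^sup>2 * (V * \<tau> + H * K * (\<alpha> + (3 + z) * G + 2 * V) + 2 * z * \<tau> / \<zeta>)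
     = w\<^sup>2 * (V * \<tau>) + w\<^sup>2 * (H * K * (\<alpha> + 2 * V + 3 * G)) + w\<^sup>2 * (H * K * (z * G)) + w\<^sup>2 * (2 * z * \<tau> / \<zeta>)"
    by (simp add: algebra_simps)
  ultimately have fin_ineq: "\<alpha> * w * s * D / z + \<alpha> * s * \<tau> / z + (\<Sum>i\<in>UNIV. \<phi> i * Kf i)
     \<le> w\<^sup>2 * (V * \<tau> + H * K * (\<alpha> + (3 + z) * G + 2 * V) + 2 * z * \<tau> / \<zeta>)"
    using tot lin' om Eterm by linarith
  have negy: "2 * \<delta> * \<tau> \<le> \<phi> i" if "y i < -1" for i
  proof (rule neg)
    show "mu $ i < 0" using that w by (simp add: y_def mult_less_0_iff)
  qed
  show ?thesis
    by (rule that[of \<phi> H D c y])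
      (use \<phi> H D gD H0 csum ysum negy fin_ineq in \<open>auto simp: \<tau>_def \<phi>_def Kf_def\<close>)
qed

end

section \<open>Estimates at the maximum\<close>

text \<open>Indices with \<open>y i \<ge> -1\<close> contribute at most \<open>s\<close> to the
  negative mean. The others therefore carry at least s (X - 1), and on them the weights are at least
  \<open>\<theta>\<close>, so Cauchy-Schwarz gives the quadratic term.\<close>

lemma weighted_negative_part:
  fixes \<phi> y c :: "'n::finite \<Rightarrow> real"
  assumes \<phi>: "\<And>i. 0 \<le> \<phi> i" and neg: "\<And>i. y i < - 1 \<Longrightarrow> \<theta> \<le> \<phi> i" and \<theta>: "\<theta> \<ge> 0"
    and c: "(\<Sum>i\<in>UNIV. (c i)\<^sup>2) = s" and X: "s * X \<le> - (\<Sum>i\<in>UNIV. (c i)\<^sup>2 * y i)" and X1: "X \<ge> 1"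
  shows "\<theta> * (s * (X - 1)\<^sup>2) \<le> (\<Sum>i\<in>UNIV. \<phi> i * ((c i)\<^sup>2 * (y i)\<^sup>2))"
proof -
  define N where "N = {i. y i < - 1}"
  define k where "k = X - 1"
  have k: "k \<ge> 0" using X1 by (simp add: k_def)
  have split: "(\<Sum>i\<in>UNIV. g i) = (\<Sum>i\<in>N. g i) + (\<Sum>i\<in>-N. g i)" for g :: "'n \<Rightarrow> real"
    using sum.union_disjoint[of N "-N" g] by simp
  have cN: "(\<Sum>i\<in>N. (c i)\<^sup>2) \<le> s" and cnN: "(\<Sum>i\<in>-N. (c i)\<^sup>2) \<le> s"
    using split[of "\<lambda>i. (c i)\<^sup>2"] c sum_nonneg[of N "\<lambda>i. (c i)\<^sup>2"] sum_nonneg[of "-N" "\<lambda>i. (c i)\<^sup>2"] by simp_all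
  have "- (\<Sum>i\<in>-N. (c i)\<^sup>2 * y i) \<le> (\<Sum>i\<in>-N. (c i)\<^sup>2)"
    unfolding sum_negf[symmetric]
  proof (rule sum_mono)
    fix i assume "i \<in> -N"
    then have "- y i \<le> 1" by (simp add: N_def)
    from mult_left_mono[OF this, of "(c i)\<^sup>2"] show "- ((c i)\<^sup>2 * y i) \<le> (c i)\<^sup>2" by simp
  qed
  then have yN: "s * k \<le> - (\<Sum>i\<in>N. (c i)\<^sup>2 * y i)"
    using X cnN split[of "\<lambda>i. (c i)\<^sup>2 * y i"] by (simp add: k_def right_diff_distrib)
  \<comment> \<open>Cauchy-Schwarz in linearised form: y^2 \<ge> -2 k y - k^2, which avoids dividing
    by the mass of \<open>N\<close>.\<close>
  have "2 * k * (s * k) - k\<^sup>2 * s \<le> 2 * k * (- (\<Sum>i\<in>N. (c i)\<^sup>2 * y i)) - k\<^sup>2 * (\<Sum>i\<in>N. (c i)\<^sup>2)"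
    using yN cN k by (intro diff_mono mult_left_mono) auto
  also have "\<dots> = (\<Sum>i\<in>N. (c i)\<^sup>2 * (- (2 * k * y i) - k\<^sup>2))"
    by (simp add: sum_distrib_left sum_negf[symmetric] sum_subtractf[symmetric] algebra_simps)
  also have "\<dots> \<le> (\<Sum>i\<in>N. (c i)\<^sup>2 * (y i)\<^sup>2)"
  proof (intro sum_mono mult_left_mono)
    fix i show "- (2 * k * y i) - k\<^sup>2 \<le> (y i)\<^sup>2"
      using zero_le_power2[of "y i + k"] by (simp add: power2_eq_square algebra_simps)
  qed simp
  finally have "s * k\<^sup>2 \<le> (\<Sum>i\<in>N. (c i)\<^sup>2 * (y i)\<^sup>2)" by (simp add: power2_eq_square algebra_simps)
  then have "\<theta> * (s * k\<^sup>2) \<le> \<theta> * (\<Sum>i\<in>N. (c i)\<^sup>2 * (y i)\<^sup>2)" using \<theta> by (rule mult_left_mono)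
  also have "\<dots> \<le> (\<Sum>i\<in>N. \<phi> i * ((c i)\<^sup>2 * (y i)\<^sup>2))"
    unfolding sum_distrib_left by (intro sum_mono mult_right_mono neg) (auto simp: N_def)
  also have "\<dots> \<le> (\<Sum>i\<in>UNIV. \<phi> i * ((c i)\<^sup>2 * (y i)\<^sup>2))"
    by (intro sum_mono2) (auto intro: mult_nonneg_nonneg \<phi>)
  finally show ?thesis by (simp add: k_def)
qed

lemma maximum_estimate_without_height:
  fixes \<phi> y c :: "'n::finite \<Rightarrow> real"
  assumes \<phi>: "\<And>i. 0 \<le> \<phi> i" and H: "0 \<le> H" and D: "0 \<le> D" and gap: "gap > 0"
    and gH: "H * gap \<le> (\<Sum>i\<in>UNIV. \<phi> i) + D" and H0: "H = 0 \<Longrightarrow> 0 < (\<Sum>i\<in>UNIV. \<phi> i)"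
    and ineq: "\<alpha> * w * s * D / z + \<alpha> * s * (\<Sum>i\<in>UNIV. \<phi> i) / z
      + (\<Sum>i\<in>UNIV. \<phi> i * ((\<alpha> * (y i)\<^sup>2 * (1 + (c i)\<^sup>2) - \<alpha>\<^sup>2 * (y i)\<^sup>2 * (c i)\<^sup>2) / z))
      \<le> w\<^sup>2 * (H * K * (\<alpha> + (3 + z) * G) + 2 * z * (\<Sum>i\<in>UNIV. \<phi> i) / \<zeta>)"
    and \<alpha>: "0 < \<alpha>" "\<alpha> \<le> 1" and z: "z > 0" and zeta: "\<zeta> > 0" and w: "w \<ge> 2" "w\<^sup>2 = 1 + s"
    and K: "K \<ge> 0" and G: "G \<ge> 0"
  shows "\<alpha> / (2 * z) \<le> K / gap * (\<alpha> + (3 + z) * G) + 2 * z / \<zeta>"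
proof -
  define \<tau> where "\<tau> = (\<Sum>i\<in>UNIV. \<phi> i)"
  have \<tau>: "\<tau> \<ge> 0" unfolding \<tau>_def by (intro sum_nonneg \<phi>)
  have "2 * 2 \<le> w * w" using w(1) by (intro mult_mono) auto
  then have s: "s \<ge> w\<^sup>2 / 2" using w(2) by (simp add: power2_eq_square)
  then have s0: "s \<ge> 0" using zero_le_power2[of w] by linarith
  have "0 \<le> (\<alpha> * (y i)\<^sup>2 * (1 + (c i)\<^sup>2) - \<alpha>\<^sup>2 * (y i)\<^sup>2 * (c i)\<^sup>2) / z" for i
  proof -
    have "\<alpha>\<^sup>2 * ((y i)\<^sup>2 * (c i)\<^sup>2) \<le> \<alpha> * ((y i)\<^sup>2 * (c i)\<^sup>2)"
      using \<alpha> by (intro mult_right_mono) (auto simp: power2_eq_square mult_left_le)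
    moreover have "0 \<le> \<alpha> * (y i)\<^sup>2" using \<alpha> by simp
    ultimately have "0 \<le> \<alpha> * (y i)\<^sup>2 * (1 + (c i)\<^sup>2) - \<alpha>\<^sup>2 * (y i)\<^sup>2 * (c i)\<^sup>2" by (simp add: algebra_simps)
    then show ?thesis using z by simp
  qed
  then have "0 \<le> (\<Sum>i\<in>UNIV. \<phi> i * ((\<alpha> * (y i)\<^sup>2 * (1 + (c i)\<^sup>2) - \<alpha>\<^sup>2 * (y i)\<^sup>2 * (c i)\<^sup>2) / z))"
    by (intro sum_nonneg mult_nonneg_nonneg \<phi>)
  then have 1: "\<alpha> * w * s * D / z + \<alpha> * s * \<tau> / z \<le> w\<^sup>2 * (H * K * (\<alpha> + (3 + z) * G) + 2 * z * \<tau> / \<zeta>)"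
    using ineq by (simp add: \<tau>_def)
  have "(\<alpha> * (D + \<tau>) / z) * (w\<^sup>2 / 2) \<le> (\<alpha> * (D + \<tau>) / z) * s"
    using s \<alpha> z D \<tau> by (intro mult_left_mono) auto
  also have "\<dots> = \<alpha> * s * D / z + \<alpha> * s * \<tau> / z" by (simp add: algebra_simps add_divide_distrib)
  also have "\<alpha> * s * D / z \<le> \<alpha> * w * s * D / z"
  proof -
    have "1 * (\<alpha> * s * D) \<le> w * (\<alpha> * s * D)" using w s0 \<alpha> D by (intro mult_right_mono) auto
    then show ?thesis using z by (simp add: divide_right_mono algebra_simps)
  qed
  finally have "w\<^sup>2 * (\<alpha> * (D + \<tau>) / (2 * z)) \<le> w\<^sup>2 * (H * K * (\<alpha> + (3 + z) * G) + 2 * z * \<tau> / \<zeta>)"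
    using 1 by (simp add: algebra_simps)
  moreover have wp: "0 < w\<^sup>2" using w(1) by simp
  ultimately have 2: "\<alpha> * (D + \<tau>) / (2 * z) \<le> H * (K * (\<alpha> + (3 + z) * G)) + 2 * z * \<tau> / \<zeta>"
    by (simp only: mult_le_cancel_left_pos mult.assoc)
  have Hle: "H \<le> (D + \<tau>) / gap" using gH gap by (simp add: \<tau>_def field_simps)
  have pos: "D + \<tau> > 0"
  proof (cases "H = 0")
    case True
    then show ?thesis using H0 D by (simp add: \<tau>_def)
  next
    case False
    then have "0 < H * gap" using H gap by simp
    then show ?thesis using gH by (simp add: \<tau>_def)
  qed
  have "H * (K * (\<alpha> + (3 + z) * G)) \<le> (D + \<tau>) / gap * (K * (\<alpha> + (3 + z) * G))"
    using Hle K \<alpha> z G by (intro mult_right_mono) auto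
  moreover have "2 * z * \<tau> / \<zeta> \<le> (D + \<tau>) * (2 * z / \<zeta>)"
  proof -
    have "\<tau> * (2 * z / \<zeta>) \<le> (D + \<tau>) * (2 * z / \<zeta>)" using D z zeta by (intro mult_right_mono) auto
    then show ?thesis by (simp add: algebra_simps)
  qed
  ultimately have "(D + \<tau>) * (\<alpha> / (2 * z)) \<le> (D + \<tau>) * (K / gap * (\<alpha> + (3 + z) * G) + 2 * z / \<zeta>)"
    using 2 by (simp add: algebra_simps)
  with pos show ?thesis by (simp only: mult_le_cancel_left_pos)
qed

text \<open>The inequality becomes a linear relation in \<open>D\<close> and \<tau>.
  \<open>small1\<close> makes the coefficient of \<open>D\<close> positive through the large factor
  w, and \<open>small2\<close> makes that of \<tau> positive through the quadratic term. Hence D =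
  \<tau> = 0, so H = 0, which \<open>H0\<close> excludes.\<close>

lemma maximum_contradiction_with_height:
  fixes \<phi> y c :: "'n::finite \<Rightarrow> real"
  assumes \<phi>: "\<And>i. 0 \<le> \<phi> i" and H: "0 \<le> H" and D: "0 \<le> D" and gap: "gap > 0"
    and gH: "H * gap \<le> (\<Sum>i\<in>UNIV. \<phi> i) + D" and H0: "H = 0 \<Longrightarrow> 0 < (\<Sum>i\<in>UNIV. \<phi> i)"
    and c: "(\<Sum>i\<in>UNIV. (c i)\<^sup>2) = s"
    and yc: "\<alpha> * (\<Sum>i\<in>UNIV. (c i)\<^sup>2 * y i) = - z * (V * s - T)"
    and neg: "\<And>i. y i < - 1 \<Longrightarrow> 2 * \<delta> * (\<Sum>i\<in>UNIV. \<phi> i) \<le> \<phi> i" and \<delta>: "\<delta> > 0"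
    and ineq: "\<alpha> * w * s * D / z + \<alpha> * s * (\<Sum>i\<in>UNIV. \<phi> i) / z
      + (\<Sum>i\<in>UNIV. \<phi> i * ((\<alpha> * (y i)\<^sup>2 * (1 + (c i)\<^sup>2) - \<alpha>\<^sup>2 * (y i)\<^sup>2 * (c i)\<^sup>2) / z
           - 2 * \<alpha> * m * y i * (c i)\<^sup>2 - z * m\<^sup>2 * (c i)\<^sup>2 + z * b2 * (c i)\<^sup>2 / \<zeta>))
      \<le> w\<^sup>2 * (V * (\<Sum>i\<in>UNIV. \<phi> i) + H * K * Q + 2 * z * (\<Sum>i\<in>UNIV. \<phi> i) / \<zeta>)"
    and \<alpha>: "0 < \<alpha>" "\<alpha> \<le> 1/4" and z: "z > 0" and zeta: "\<zeta> > 0" and w: "w \<ge> 2" "w\<^sup>2 = 1 + s"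
    and K: "K \<ge> 0" and Q: "Q \<ge> 0" and V: "4 * \<alpha> \<le> z * V" and T: "T \<le> V * s / 2"
    and small1: "K / gap * Q < \<alpha> * w / (2 * z)"
    and small2: "V + 2 * z * m\<^sup>2 + z * \<bar>b2\<bar> / \<zeta> + 2 * z / \<zeta> + K / gap * Q < \<delta> / 32 * z * V\<^sup>2 / \<alpha>"
  shows False
proof -
  define \<tau> where "\<tau> = (\<Sum>i\<in>UNIV. \<phi> i)"
  have \<tau>: "\<tau> \<ge> 0" unfolding \<tau>_def by (intro sum_nonneg \<phi>)
  have "2 * 2 \<le> w * w" using w(1) by (intro mult_mono) auto
  then have s: "s \<ge> w\<^sup>2 / 2" using w(2) by (simp add: power2_eq_square)
  then have s0: "s \<ge> 0" using zero_le_power2[of w] by linarith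
  \<comment> \<open>After half of V s has been spent on \<open>T\<close>, the weighted mean of
    \<open>y\<close> is at most -X. The hypothesis 4 \<alpha> \<le> z V is what makes X \<ge> 2, and
    then (X - 1)^2 \<ge> X^2 / 4.\<close>
  define X where "X = z * V / (2 * \<alpha>)"
  have X2: "X \<ge> 2" using V \<alpha> by (simp add: X_def field_simps)
  have "s * X \<le> - (\<Sum>i\<in>UNIV. (c i)\<^sup>2 * y i)"
  proof -
    have "z * (V * s / 2) \<le> z * (V * s - T)" using T z by (intro mult_left_mono) auto
    then have "z * V * s / 2 \<le> - (\<alpha> * (\<Sum>i\<in>UNIV. (c i)\<^sup>2 * y i))" using yc by simp
    then have "z * V * s / 2 \<le> \<alpha> * (- (\<Sum>i\<in>UNIV. (c i)\<^sup>2 * y i))" by simp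
    moreover have "\<alpha> * (s * X) = z * V * s / 2" using \<alpha> by (simp add: X_def)
    ultimately have "\<alpha> * (s * X) \<le> \<alpha> * (- (\<Sum>i\<in>UNIV. (c i)\<^sup>2 * y i))" by (rule ord_eq_le_trans[rotated])
    then show ?thesis using \<alpha> by (simp only: mult_le_cancel_left_pos)
  qed
  then have ny: "2 * \<delta> * \<tau> * (s * (X - 1)\<^sup>2) \<le> (\<Sum>i\<in>UNIV. \<phi> i * ((c i)\<^sup>2 * (y i)\<^sup>2))"
    using \<delta> \<tau> X2 by (intro weighted_negative_part[OF \<phi> neg[folded \<tau>_def] _ c]) auto
  have X1: "X\<^sup>2 / 4 \<le> (X - 1)\<^sup>2"
  proof -
    have "(X / 2)\<^sup>2 \<le> (X - 1)\<^sup>2" using X2 by (intro power_mono) auto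
    then show ?thesis by (simp add: power_divide)
  qed
  define Y where "Y = (\<Sum>i\<in>UNIV. \<phi> i * ((c i)\<^sup>2 * (y i)\<^sup>2))"
  have Ybound: "\<delta> / 32 * z * V\<^sup>2 / \<alpha> * (w\<^sup>2 * \<tau>) \<le> \<alpha> / (2 * z) * Y"
  proof -
    have "w\<^sup>2 / 2 * (X\<^sup>2 / 4) \<le> s * (X - 1)\<^sup>2" using s X1 s0 by (intro mult_mono) auto
    then have "2 * \<delta> * \<tau> * (w\<^sup>2 / 2 * (X\<^sup>2 / 4)) \<le> 2 * \<delta> * \<tau> * (s * (X - 1)\<^sup>2)"
      using \<delta> \<tau> by (intro mult_left_mono) auto
    then have "2 * \<delta> * \<tau> * (w\<^sup>2 / 2 * (X\<^sup>2 / 4)) \<le> Y" using ny by (simp add: Y_def)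
    then have "\<alpha> / (2 * z) * (2 * \<delta> * \<tau> * (w\<^sup>2 / 2 * (X\<^sup>2 / 4))) \<le> \<alpha> / (2 * z) * Y"
      using \<alpha> z by (intro mult_left_mono) auto
    moreover have "\<alpha> / (2 * z) * (2 * \<delta> * \<tau> * (w\<^sup>2 / 2 * (X\<^sup>2 / 4))) = \<delta> / 32 * z * V\<^sup>2 / \<alpha> * (w\<^sup>2 * \<tau>)"
      using \<alpha> z by (simp add: X_def power2_eq_square field_simps)
    ultimately show ?thesis by simp
  qed
  \<comment> \<open>Half of the good term \<alpha> y^2 / z is kept. One quarter pays for \<alpha>^2
    y^2 / z, another for the cross term with \<open>m\<close> by Young's inequality; both use
    \<alpha> \<le> 1/4.\<close>
  have per: "(c i)\<^sup>2 * (\<alpha> / (2 * z) * (y i)\<^sup>2 - 2 * z * m\<^sup>2 - z * \<bar>b2\<bar> / \<zeta>)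
      \<le> (\<alpha> * (y i)\<^sup>2 * (1 + (c i)\<^sup>2) - \<alpha>\<^sup>2 * (y i)\<^sup>2 * (c i)\<^sup>2) / z
           - 2 * \<alpha> * m * y i * (c i)\<^sup>2 - z * m\<^sup>2 * (c i)\<^sup>2 + z * b2 * (c i)\<^sup>2 / \<zeta>" for i
  proof -
    have sq: "2 * \<alpha> * m * y i \<le> \<alpha> / (4 * z) * (y i)\<^sup>2 + z * m\<^sup>2"
    proof -
      have "0 \<le> \<alpha> / (4 * z) * (y i - 4 * z * m)\<^sup>2" using \<alpha> z by simp
      also have "\<dots> = \<alpha> / (4 * z) * (y i)\<^sup>2 - 2 * \<alpha> * m * y i + 4 * \<alpha> * (z * m\<^sup>2)"
        using z by (simp add: power2_eq_square field_simps)
      finally have "2 * \<alpha> * m * y i \<le> \<alpha> / (4 * z) * (y i)\<^sup>2 + 4 * \<alpha> * (z * m\<^sup>2)" by simp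
      moreover have "(4 * \<alpha>) * (z * m\<^sup>2) \<le> 1 * (z * m\<^sup>2)" using \<alpha> z by (intro mult_right_mono) auto
      ultimately show ?thesis by simp
    qed
    have a2: "\<alpha>\<^sup>2 * ((y i)\<^sup>2 / z) \<le> \<alpha> / 4 * ((y i)\<^sup>2 / z)"
    proof (rule mult_right_mono)
      have "\<alpha> * \<alpha> \<le> \<alpha> * (1/4)" using \<alpha> by (intro mult_left_mono) auto
      then show "\<alpha>\<^sup>2 \<le> \<alpha> / 4" by (simp add: power2_eq_square)
    qed (use z in simp)
    have b2: "- (z * \<bar>b2\<bar> / \<zeta>) \<le> z * b2 / \<zeta>"
    proof -
      have "z / \<zeta> * (- \<bar>b2\<bar>) \<le> z / \<zeta> * b2" using z zeta by (intro mult_left_mono) auto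
      then show ?thesis by simp
    qed
    have e: "\<alpha> / (2 * z) * (y i)\<^sup>2 = \<alpha> / 2 * ((y i)\<^sup>2 / z)" "\<alpha> / (4 * z) * (y i)\<^sup>2 = \<alpha> / 4 * ((y i)\<^sup>2 / z)"
      by simp_all
    have "\<alpha> / (2 * z) * (y i)\<^sup>2 - 2 * z * m\<^sup>2 - z * \<bar>b2\<bar> / \<zeta>
       \<le> (\<alpha> * ((y i)\<^sup>2 / z) - \<alpha>\<^sup>2 * ((y i)\<^sup>2 / z)) - 2 * \<alpha> * m * y i - z * m\<^sup>2 + z * b2 / \<zeta>"
      using sq a2 b2 unfolding e by linarith
    then have "(c i)\<^sup>2 * (\<alpha> / (2 * z) * (y i)\<^sup>2 - 2 * z * m\<^sup>2 - z * \<bar>b2\<bar> / \<zeta>)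
       \<le> (c i)\<^sup>2 * ((\<alpha> * ((y i)\<^sup>2 / z) - \<alpha>\<^sup>2 * ((y i)\<^sup>2 / z)) - 2 * \<alpha> * m * y i - z * m\<^sup>2 + z * b2 / \<zeta>)"
      by (rule mult_left_mono) simp
    also have "\<dots> \<le> (c i)\<^sup>2 * ((\<alpha> * ((y i)\<^sup>2 / z) - \<alpha>\<^sup>2 * ((y i)\<^sup>2 / z)) - 2 * \<alpha> * m * y i - z * m\<^sup>2 + z * b2 / \<zeta>) + \<alpha> * ((y i)\<^sup>2 / z)"
      using \<alpha> z by simp
    also have "\<dots> = (\<alpha> * (y i)\<^sup>2 * (1 + (c i)\<^sup>2) - \<alpha>\<^sup>2 * (y i)\<^sup>2 * (c i)\<^sup>2) / z
           - 2 * \<alpha> * m * y i * (c i)\<^sup>2 - z * m\<^sup>2 * (c i)\<^sup>2 + z * b2 * (c i)\<^sup>2 / \<zeta>"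
      by (simp add: algebra_simps diff_divide_distrib add_divide_distrib)
    finally show ?thesis .
  qed
  have phic: "(\<Sum>i\<in>UNIV. \<phi> i * (c i)\<^sup>2) \<le> w\<^sup>2 * \<tau>"
  proof -
    have "\<phi> i \<le> \<tau>" for i unfolding \<tau>_def by (rule member_le_sum) (use \<phi> in auto)
    then have "(\<Sum>i\<in>UNIV. \<phi> i * (c i)\<^sup>2) \<le> (\<Sum>i\<in>UNIV. \<tau> * (c i)\<^sup>2)"
      by (intro sum_mono mult_right_mono) auto
    also have "\<dots> = \<tau> * s" by (simp add: sum_distrib_left[symmetric] c)
    also have "\<dots> \<le> \<tau> * w\<^sup>2" using \<tau> w(2) by (intro mult_left_mono) auto
    finally show ?thesis by (simp add: mult.commute)
  qed
  define B where "B = 2 * z * m\<^sup>2 + z * \<bar>b2\<bar> / \<zeta>"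
  have B: "B \<ge> 0" using z zeta by (simp add: B_def)
  have "\<alpha> / (2 * z) * Y - B * (w\<^sup>2 * \<tau>) \<le> \<alpha> / (2 * z) * Y - B * (\<Sum>i\<in>UNIV. \<phi> i * (c i)\<^sup>2)"
    using mult_left_mono[OF phic B] by simp
  also have "\<dots> = (\<Sum>i\<in>UNIV. \<phi> i * ((c i)\<^sup>2 * (\<alpha> / (2 * z) * (y i)\<^sup>2 - 2 * z * m\<^sup>2 - z * \<bar>b2\<bar> / \<zeta>)))"
    unfolding Y_def sum_distrib_left sum_subtractf[symmetric]
    by (rule sum.cong) (simp_all add: B_def algebra_simps)
  also have "\<dots> \<le> (\<Sum>i\<in>UNIV. \<phi> i * ((\<alpha> * (y i)\<^sup>2 * (1 + (c i)\<^sup>2) - \<alpha>\<^sup>2 * (y i)\<^sup>2 * (c i)\<^sup>2) / z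
           - 2 * \<alpha> * m * y i * (c i)\<^sup>2 - z * m\<^sup>2 * (c i)\<^sup>2 + z * b2 * (c i)\<^sup>2 / \<zeta>))"
    by (intro sum_mono mult_left_mono per \<phi>)
  finally have low: "\<delta> / 32 * z * V\<^sup>2 / \<alpha> * (w\<^sup>2 * \<tau>) - B * (w\<^sup>2 * \<tau>) \<le> \<dots>"
    using Ybound by linarith
  have "\<alpha> * w * D / (2 * z) * w\<^sup>2 \<le> \<alpha> * w * s * D / z"
  proof -
    have "(\<alpha> * w * D / z) * (w\<^sup>2 / 2) \<le> (\<alpha> * w * D / z) * s"
      using s \<alpha> w D z by (intro mult_left_mono) auto
    then show ?thesis by (simp add: algebra_simps)
  qed
  moreover have "0 \<le> \<alpha> * s * \<tau> / z" using \<alpha> s0 \<tau> z by simp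
  ultimately have "\<alpha> * w * D / (2 * z) * w\<^sup>2 + (\<delta> / 32 * z * V\<^sup>2 / \<alpha> * (w\<^sup>2 * \<tau>) - B * (w\<^sup>2 * \<tau>))
      \<le> w\<^sup>2 * (V * \<tau> + H * K * Q + 2 * z * \<tau> / \<zeta>)"
    using ineq low unfolding \<tau>_def[symmetric] by linarith
  then have "w\<^sup>2 * (\<alpha> * w * D / (2 * z) + \<delta> / 32 * z * V\<^sup>2 / \<alpha> * \<tau> - B * \<tau>)
      \<le> w\<^sup>2 * (V * \<tau> + H * K * Q + 2 * z * \<tau> / \<zeta>)"
    by (simp add: algebra_simps)
  moreover have wp: "0 < w\<^sup>2" using w(1) by simp
  ultimately have main: "\<alpha> * w * D / (2 * z) + \<delta> / 32 * z * V\<^sup>2 / \<alpha> * \<tau> - B * \<tau> \<le> V * \<tau> + H * (K * Q) + 2 * z * \<tau> / \<zeta>"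
    by (simp only: mult_le_cancel_left_pos mult.assoc)
  have "H \<le> (D + \<tau>) / gap" using gH gap by (simp add: \<tau>_def field_simps)
  then have "H * (K * Q) \<le> (D + \<tau>) / gap * (K * Q)" using K Q by (intro mult_right_mono) auto
  also have "\<dots> = D * (K / gap * Q) + \<tau> * (K / gap * Q)" by (simp add: algebra_simps add_divide_distrib)
  finally have HK: "H * (K * Q) \<le> D * (K / gap * Q) + \<tau> * (K / gap * Q)" .
  define q where "q = K / gap * Q"
  define P where "P = V + B + 2 * z / \<zeta> + q"
  define L where "L = \<delta> / 32 * z * V\<^sup>2 / \<alpha>"
  have PL: "P < L" using small2 by (simp add: P_def B_def q_def L_def)
  have "D * (\<alpha> * w / (2 * z)) + L * \<tau> \<le> D * q + P * \<tau>"
    using main HK unfolding q_def[symmetric] L_def[symmetric] P_def by (simp add: algebra_simps)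
  then have le: "D * (\<alpha> * w / (2 * z) - q) + \<tau> * (L - P) \<le> 0" by (simp add: algebra_simps)
  have p1: "D * (\<alpha> * w / (2 * z) - q) \<ge> 0" using D small1 by (simp add: q_def)
  have p2: "\<tau> * (L - P) \<ge> 0" using \<tau> PL by simp
  have "\<tau> = 0" using le p1 p2 PL \<tau> by (smt (verit, best) mult_pos_pos)
  moreover have "D = 0" using le p1 p2 small1 D unfolding q_def[symmetric] by (smt (verit, best) mult_pos_pos)
  ultimately have "H * gap \<le> 0" using gH by (simp add: \<tau>_def[symmetric])
  then have "H = 0" using H gap by (simp add: mult_le_0_iff)
  with H0 \<open>\<tau> = 0\<close> show False by (simp add: \<tau>_def)
qed

section \<open>The barrier\<close>

text \<open>The constants are chosen in the order \<open>\<alpha>\<close>, \<open>b\<close>, \<open>k\<close>, and none depends on \<open>M1\<close>, a bound for the height.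
  The slope \<open>m = k M1\<close> together with \<open>\<beta>1 \<ge> a / (2 M1)\<close> keeps \<open>m \<beta>1\<close> bounded below while \<open>\<beta>\<close> stays
  bounded; this balance costs \<open>exp (m u)\<close>, that is, the square of the height in the exponent.
  The term \<open>t / (b + t)\<close> makes \<open>\<beta>\<close> steep for small heights.\<close>

locale barrier =
  fixes r Kg \<kappa> \<alpha> b k a M1 :: real
  assumes r: "r > 0" and Kg: "Kg \<ge> 0" and \<kappa>: "\<kappa> > 0" and a: "a = r\<^sup>2 / 2"
    and \<alpha>: "\<alpha> > 0" "\<alpha> \<le> 1/64" "128 * (1 + 2 * Kg) * \<alpha> \<le> \<kappa>"
    and b: "b > 0" "b \<le> 1" "b * (Kg * (1 + 32 * r / a) + 8 / a) < \<alpha> / 2"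
      "512 * \<alpha> * (6 * Kg * r + (2 + 2 * Kg * r)) * b \<le> \<kappa> * a"
    and k: "k * b \<ge> 1" "2 * \<alpha> * (6 * Kg * r / b + (2 + 2 * Kg * r)) \<le> \<kappa> * a * k"
    and M1: "M1 \<ge> 1"
begin

definition m where "m = k * M1"
definition \<beta> where "\<beta> t = a / (2 * M1) * t + (a / 2) * (t / (b + t))"
definition \<beta>1 where "\<beta>1 t = a / (2 * M1) + (a / 2) * (b / (b + t)\<^sup>2)"
definition \<beta>2 where "\<beta>2 t = - (a * b / (b + t) ^ 3)"

lemma a_pos: "a > 0" using r by (simp add: a)

lemma k_ge: "k \<ge> 1"
proof -
  have "k > 0" using k(1) b(1) by (smt (verit) mult_nonpos_nonneg)
  then have "k * b \<le> k * 1" using b(2) by (intro mult_left_mono) auto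
  then show ?thesis using k(1) by simp
qed

lemma m_ge: "m \<ge> k" "m \<ge> 1"
  using k_ge M1 mult_left_mono[of 1 M1 k] mult_mono[of 1 k 1 M1] by (auto simp: m_def)

lemma \<beta>_derivative:
  assumes "t > 0"
  shows "(\<beta> has_real_derivative \<beta>1 t) (at t)" "(\<beta>1 has_real_derivative \<beta>2 t) (at t)"
proof -
  have nz: "b + t \<noteq> 0" using assms b by simp
  show "(\<beta> has_real_derivative \<beta>1 t) (at t)"
    unfolding \<beta>_def[abs_def] \<beta>1_def
    by (rule DERIV_cong[OF DERIV_add[OF DERIV_cmult[OF DERIV_ident]
          DERIV_cmult[OF DERIV_divide[OF DERIV_ident DERIV_add[OF DERIV_const DERIV_ident] nz]]]])
      (simp add: power2_eq_square)
  have nz2: "(b + t) ^ 2 \<noteq> 0" using nz by simp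
  have e: "a / 2 * ((0 * c\<^sup>2 - b * (2 * c)) / (c\<^sup>2 * c\<^sup>2)) = - (a * b / c ^ 3)" if "c \<noteq> 0" for c
    using that by (simp add: power2_eq_square power3_eq_cube)
  show "(\<beta>1 has_real_derivative \<beta>2 t) (at t)"
    unfolding \<beta>1_def[abs_def] \<beta>2_def
    by (rule DERIV_cong[OF DERIV_add[OF DERIV_const DERIV_cmult[OF DERIV_divide[OF DERIV_const
          DERIV_power[OF DERIV_add[OF DERIV_const DERIV_ident]] nz2]]]])
      (use e[OF nz] in simp)
qed

lemma \<beta>_bounds:
  assumes "t > 0"
  shows "\<beta> t > 0" "t \<le> M1 \<Longrightarrow> \<beta> t \<le> a" "\<beta> t \<ge> (a / 2) * (t / (b + t))"
    "\<beta>1 t \<ge> a / (2 * M1)" "\<beta>1 t \<ge> (a / 2) * (b / (b + t)\<^sup>2)" "2 * \<beta>1 t \<le> a * (1 + 1 / b)"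
proof -
  have t: "t / (b + t) > 0" "t / (b + t) \<le> 1" using assms b by auto
  have t1: "a / (2 * M1) * t > 0" using assms a_pos M1 by simp
  have "(a / 2) * (t / (b + t)) > 0" using t a_pos by (intro mult_pos_pos) auto
  then show "\<beta> t > 0" unfolding \<beta>_def using t1 by linarith
  show "\<beta> t \<ge> (a / 2) * (t / (b + t))" unfolding \<beta>_def using t1 by simp
  show "\<beta> t \<le> a" if "t \<le> M1"
  proof -
    have "a / (2 * M1) * t \<le> a / (2 * M1) * M1" using that M1 a_pos by (intro mult_left_mono) auto
    then have "a / (2 * M1) * t \<le> a / 2" using M1 by simp
    moreover have "(a / 2) * (t / (b + t)) \<le> (a / 2) * 1" using t a_pos by (intro mult_left_mono) auto
    ultimately show ?thesis unfolding \<beta>_def by linarith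
  qed
  show "\<beta>1 t \<ge> a / (2 * M1)" "\<beta>1 t \<ge> (a / 2) * (b / (b + t)\<^sup>2)"
    unfolding \<beta>1_def using a_pos b M1 by auto
  have "a / M1 \<le> a" using M1 a_pos by (simp add: divide_simps)
  moreover have "b / (b + t)\<^sup>2 \<le> 1 / b"
  proof -
    have "b\<^sup>2 \<le> (b + t)\<^sup>2" using assms b by (intro power_mono) auto
    then have "b / (b + t)\<^sup>2 \<le> b / b\<^sup>2" using assms b by (intro divide_left_mono) auto
    then show ?thesis using b by (simp add: power2_eq_square)
  qed
  then have "a * (b / (b + t)\<^sup>2) \<le> a * (1 / b)" using a_pos by (intro mult_left_mono) auto
  ultimately show "2 * \<beta>1 t \<le> a * (1 + 1 / b)" unfolding \<beta>1_def by (simp add: algebra_simps)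
qed

text \<open>\<open>act\<close> says that the test function with height dependence is the larger one.
  If m z < 1/4, then exp (m z) \<le> 3/2 is well below the factor 2 in \<open>act\<close>, so \<rho>
  \<le> 3 \<beta>; moreover z \<le> b, where the fraction in \<open>\<beta>\<close> is steep enough
  for z \<beta>1 \<ge> \<beta> / 2. Since \<alpha> \<le> 1/64, the bound 1/16 is at least the
  required 4 \<alpha>.\<close>

lemma height_slope:
  assumes z: "z > 0" and zeta: "\<rho> + \<beta> z > 0" and act: "2 * \<rho> \<le> exp (m * z) * (\<rho> + \<beta> z)"
  shows "1/16 \<le> z * (m + \<beta>1 z / (\<rho> + \<beta> z))"
proof -
  have b1: "\<beta>1 z \<ge> 0" using \<beta>_bounds(4)[OF z] a_pos M1 by (smt (verit) divide_nonneg_nonneg)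
  have zb: "z * (\<beta>1 z / (\<rho> + \<beta> z)) \<ge> 0" using z b1 zeta by simp
  show ?thesis
  proof (cases "m * z \<ge> 1/4")
    case True
    then show ?thesis using zb by (simp add: distrib_left mult.commute)
  next
    case False
    have "3/4 \<le> exp (- (1/4) :: real)" using exp_ge_add_one_self[of "-(1/4)"] by simp
    then have "exp (1/4 :: real) \<le> 4/3" by (simp add: exp_minus field_simps)
    moreover have "exp (m * z) \<le> exp (1/4)" using False by simp
    ultimately have "exp (m * z) \<le> 3/2" by linarith
    then have "exp (m * z) * (\<rho> + \<beta> z) \<le> 3/2 * (\<rho> + \<beta> z)" using zeta by (intro mult_right_mono) auto
    with act have "2 * \<rho> \<le> 3/2 * (\<rho> + \<beta> z)" by (rule order_trans)
    then have zeta4: "\<rho> + \<beta> z \<le> 4 * \<beta> z" by simp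
    have "z \<le> b"
    proof -
      have "k * z \<le> m * z" using m_ge z by (intro mult_right_mono) auto
      then have "k * z \<le> k * b" using False k by linarith
      then show ?thesis using k_ge by simp
    qed
    then have half: "1/2 \<le> b / (b + z)" using b z by (simp add: field_simps)
    have "z * \<beta>1 z = a / (2 * M1) * z + (a / 2) * (z / (b + z)) * (b / (b + z))"
      unfolding \<beta>1_def by (simp add: algebra_simps power2_eq_square)
    moreover have "(a / 2) * (z / (b + z)) * (1 / 2) \<le> (a / 2) * (z / (b + z)) * (b / (b + z))"
      using half a_pos z b by (intro mult_left_mono) auto
    moreover have "a / (2 * M1) * z \<ge> 0" using a_pos z M1 by simp
    moreover have "(P + Q) / 2 \<le> P + R" if "Q * (1 / 2) \<le> R" "0 \<le> P" for P Q R :: real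
      using that by simp
    ultimately have "\<beta> z / 2 \<le> z * \<beta>1 z" unfolding \<beta>_def by metis
    then have "\<beta> z / 2 / (4 * \<beta> z) \<le> z * \<beta>1 z / (\<rho> + \<beta> z)"
      using zeta zeta4 \<beta>_bounds(1)[OF z] by (intro frac_le) auto
    then have "1/8 \<le> z * (\<beta>1 z / (\<rho> + \<beta> z))" using \<beta>_bounds(1)[OF z] by simp
    moreover have "z * m \<ge> 0" using z m_ge by simp
    ultimately show ?thesis unfolding distrib_left by linarith
  qed
qed

text \<open>With \<open>L\<close> for the right-hand side, the terms on the left are bounded by four
  times L/8 and once L/4. Three lower bounds on \<open>L\<close> are used: it is at least \<kappa> V
  / (16 \<alpha>), at least 128 z V^2, and V^2 dominates m \<beta>1 / \<zeta>.\<close>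

lemma height_estimate:
  assumes z: "0 < z" and zeta: "\<zeta> > 0" and G: "0 \<le> G" "G \<le> 2 * r / \<zeta>"
    and V: "V = m + \<beta>1 z / \<zeta>" and zV: "1/16 \<le> z * V"
  shows "V + 2 * z * m\<^sup>2 + z * \<bar>\<beta>2 z\<bar> / \<zeta> + 2 * z / \<zeta> + Kg * (\<alpha> + (3 + z) * G + 2 * V) < \<kappa> * z * V\<^sup>2 / \<alpha>"
proof -
  define L where "L = \<kappa> * z * V\<^sup>2 / \<alpha>"
  have b1: "\<beta>1 z \<ge> 0" using \<beta>_bounds(4)[OF z] a_pos M1 by (smt (verit) divide_nonneg_nonneg)
  have "\<beta>1 z / \<zeta> \<ge> 0" using b1 zeta by simp
  then have Vm: "V \<ge> m" and Vk: "V \<ge> k" and V1: "V \<ge> 1" and Vb: "V \<ge> \<beta>1 z / \<zeta>"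
    using m_ge k_ge unfolding V by linarith+
  have Lpos: "L > 0" using \<kappa> z V1 \<alpha> by (simp add: L_def)
  \<comment> \<open>The arithmetic-geometric mean inequality. The product m \<beta>1 is at least k a
    / 2 whatever \<open>M1\<close> is, which lets V^2 absorb multiples of 1/\<zeta>.\<close>
  have V2: "V\<^sup>2 \<ge> 4 * m * (\<beta>1 z / \<zeta>)"
  proof -
    have "4 * m * e \<le> (m + e)\<^sup>2" for e
      using zero_le_power2[of "m - e"] by (simp add: power2_eq_square algebra_simps)
    then show ?thesis unfolding V .
  qed
  have LV: "\<kappa> * V / (16 * \<alpha>) \<le> L"
  proof -
    have "(\<kappa> * V / \<alpha>) * (1/16) \<le> (\<kappa> * V / \<alpha>) * (z * V)"
      using zV \<kappa> V1 \<alpha> by (intro mult_left_mono) auto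
    then show ?thesis by (simp add: L_def power2_eq_square algebra_simps)
  qed
  have \<kappa>\<alpha>: "128 * (1 + 2 * Kg) \<le> \<kappa> / \<alpha>" using \<alpha> by (simp add: pos_le_divide_eq)
  have "128 \<le> 128 * (1 + 2 * Kg)" using Kg by simp
  then have \<kappa>1: "128 \<le> \<kappa> / \<alpha>" using \<kappa>\<alpha> by (rule order_trans)
  have i1: "V * (1 + 2 * Kg) \<le> L / 8"
  proof -
    have "V / 16 * (128 * (1 + 2 * Kg)) \<le> V / 16 * (\<kappa> / \<alpha>)" using \<kappa>\<alpha> V1 by (intro mult_left_mono) auto
    also have "\<dots> \<le> L" using LV by (simp add: algebra_simps)
    finally show ?thesis by (simp add: algebra_simps)
  qed
  have i2: "Kg * \<alpha> \<le> L / 8"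
  proof -
    have "Kg * \<alpha> \<le> Kg * 1" using \<alpha> Kg by (intro mult_left_mono) auto
    also have "\<dots> \<le> 1 * (1 + 2 * Kg)" using Kg by simp
    also have "\<dots> \<le> V * (1 + 2 * Kg)" using V1 Kg by (intro mult_right_mono) auto
    finally show ?thesis using i1 by simp
  qed
  have zVL: "128 * (z * V\<^sup>2) \<le> L"
  proof -
    have "128 * (z * V\<^sup>2) \<le> (\<kappa> / \<alpha>) * (z * V\<^sup>2)" using \<kappa>1 z by (intro mult_right_mono) auto
    then show ?thesis by (simp add: L_def algebra_simps)
  qed
  have i3: "2 * z * m\<^sup>2 \<le> L / 8"
  proof -
    have "m\<^sup>2 \<le> V\<^sup>2" using Vm m_ge by (intro power_mono) auto
    then have "z * m\<^sup>2 \<le> z * V\<^sup>2" using z by (intro mult_left_mono) auto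
    then show ?thesis using zVL Lpos by linarith
  qed
  have i4: "z * \<bar>\<beta>2 z\<bar> / \<zeta> \<le> L / 8"
  proof -
    have bz: "b + z > 0" using b z by simp
    have ab: "\<bar>\<beta>2 z\<bar> = a * b / (b + z) ^ 3" using a_pos b z by (simp add: \<beta>2_def)
    \<comment> \<open>Here \<open>k * b \<ge> 1\<close> is needed: one factor b + z in the
      denominator of \<open>\<beta>2\<close> is exchanged for \<open>k\<close>, which reduces it to
      a multiple of m \<beta>1.\<close>
    have "1 \<le> k * (b + z)" using k z k_ge by (simp add: distrib_left add_increasing2)
    then have "(a * b / (b + z) ^ 3) * 1 \<le> (a * b / (b + z) ^ 3) * (k * (b + z))"
      using a_pos b bz by (intro mult_left_mono) auto
    also have "\<dots> = k * (a * (b / (b + z)\<^sup>2))"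
    proof -
      have "(a * b / c ^ 3) * (k * c) = k * (a * (b / c\<^sup>2))" if "c > 0" for c
        using that by (simp add: power2_eq_square power3_eq_cube)
      from this[OF bz] show ?thesis .
    qed
    also have "\<dots> \<le> m * (2 * \<beta>1 z)"
    proof (rule mult_mono)
      show "a * (b / (b + z)\<^sup>2) \<le> 2 * \<beta>1 z" using \<beta>_bounds(5)[OF z] by simp
    qed (use m_ge k_ge a_pos b in auto)
    finally have "\<bar>\<beta>2 z\<bar> \<le> m * (2 * \<beta>1 z)" unfolding ab by simp
    then have "\<bar>\<beta>2 z\<bar> / \<zeta> \<le> m * (2 * \<beta>1 z) / \<zeta>" using zeta by (intro divide_right_mono) auto
    also have "\<dots> = (4 * m * (\<beta>1 z / \<zeta>)) / 2" by simp
    finally have "\<bar>\<beta>2 z\<bar> / \<zeta> \<le> (4 * m * (\<beta>1 z / \<zeta>)) / 2" .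
    also have "\<dots> \<le> V\<^sup>2 / 2" using V2 by (rule divide_right_mono) simp
    also have "\<dots> \<le> V\<^sup>2" by simp
    finally have "\<bar>\<beta>2 z\<bar> / \<zeta> \<le> V\<^sup>2" .
    then have "z * (\<bar>\<beta>2 z\<bar> / \<zeta>) \<le> z * V\<^sup>2" using z by (intro mult_left_mono) auto
    then show ?thesis using zVL Lpos by simp
  qed
  define c3 where "c3 = 6 * Kg * r"
  define c4 where "c4 = 2 + 2 * Kg * r"
  have c34: "c3 \<ge> 0" "c4 > 0" using Kg r by (auto simp: c3_def c4_def add_pos_nonneg)
  \<comment> \<open>Terms in 1/\<zeta>. For z \<le> b the slope \<beta>1 \<ge> a / (8 b) is large
    because \<open>b\<close> is small; for z > b the linear part of \<open>\<beta>\<close> together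
    with \<open>m\<close> suffices because \<open>k\<close> is large.\<close>
  have i5: "(c3 + c4 * z) / \<zeta> \<le> L / 4"
  proof (cases "z \<le> b")
    case True
    have "c4 * z \<le> c4 * 1" using True b c34 by (intro mult_left_mono) auto
    then have "c3 + c4 * z \<le> c3 + c4" by simp
    also have "\<dots> \<le> \<kappa> * a / (512 * \<alpha> * b)"
      using b(1,4) \<alpha> by (simp add: c3_def c4_def field_simps)
    finally have 1: "(c3 + c4 * z) / \<zeta> \<le> \<kappa> * a / (512 * \<alpha> * b) / \<zeta>" using zeta by (intro divide_right_mono) auto
    have "(b + z)\<^sup>2 \<le> (2 * b)\<^sup>2" using True b z by (intro power_mono) auto
    then have "b / (2 * b)\<^sup>2 \<le> b / (b + z)\<^sup>2" using b z by (intro divide_left_mono) auto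
    then have "(a / 2) * (b / (2 * b)\<^sup>2) \<le> (a / 2) * (b / (b + z)\<^sup>2)" using a_pos by (intro mult_left_mono) auto
    then have "(a / 2) * (b / (2 * b)\<^sup>2) \<le> \<beta>1 z" using \<beta>_bounds(5)[OF z] by (rule order_trans)
    moreover have "(a / 2) * (b / (2 * b)\<^sup>2) = a / (8 * b)" using b by (simp add: power2_eq_square)
    ultimately have "a / (8 * b) \<le> \<beta>1 z" by (simp only:)
    then have "a / (8 * b) / \<zeta> \<le> V" using Vb zeta by (smt (verit) divide_right_mono)
    then have "\<kappa> / (16 * \<alpha>) * (a / (8 * b) / \<zeta>) \<le> \<kappa> / (16 * \<alpha>) * V" using \<kappa> \<alpha> by (intro mult_left_mono) auto
    also have "\<dots> \<le> L" using LV by simp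
    finally have "\<kappa> * a / (512 * \<alpha> * b) / \<zeta> \<le> L / 4" by (simp add: field_simps)
    with 1 show ?thesis by linarith
  next
    case False
    have "c3 * 1 \<le> c3 * (z / b)" using False b c34 by (intro mult_left_mono) (auto simp: field_simps)
    then have "c3 + c4 * z \<le> z * (c3 / b + c4)" by (simp add: algebra_simps)
    then have "2 * \<alpha> * (c3 + c4 * z) \<le> 2 * \<alpha> * (z * (c3 / b + c4))" using \<alpha> by (intro mult_left_mono) auto
    also have "\<dots> = z * (2 * \<alpha> * (c3 / b + c4))" by (simp add: algebra_simps)
    also have "\<dots> \<le> z * (\<kappa> * a * k)" using k(2) z by (intro mult_left_mono) (auto simp: c3_def c4_def)
    finally have "c3 + c4 * z \<le> \<kappa> * a * k * z / (2 * \<alpha>)" using \<alpha> by (simp add: field_simps)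
    then have 1: "(c3 + c4 * z) / \<zeta> \<le> \<kappa> * a * k * z / (2 * \<alpha>) / \<zeta>" using zeta by (intro divide_right_mono) auto
    have "m * (a / (2 * M1)) \<le> m * \<beta>1 z" using \<beta>_bounds(4)[OF z] m_ge by (intro mult_left_mono) auto
    then have "k * a / 2 \<le> m * \<beta>1 z" using M1 by (simp add: m_def)
    then have "k * a / 2 / \<zeta> \<le> m * \<beta>1 z / \<zeta>" using zeta by (intro divide_right_mono) auto
    then have "4 * (k * a / 2 / \<zeta>) \<le> 4 * (m * \<beta>1 z / \<zeta>)" by (rule mult_left_mono) simp
    also have "4 * (k * a / 2 / \<zeta>) = 2 * k * a / \<zeta>" by simp
    also have "4 * (m * \<beta>1 z / \<zeta>) = 4 * m * (\<beta>1 z / \<zeta>)" by simp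
    finally have "2 * k * a / \<zeta> \<le> V\<^sup>2" using V2 by (rule order_trans)
    then have "(\<kappa> * z / \<alpha>) * (2 * k * a / \<zeta>) \<le> (\<kappa> * z / \<alpha>) * V\<^sup>2" using \<kappa> z \<alpha> by (intro mult_left_mono) auto
    moreover have "(\<kappa> * z / \<alpha>) * (2 * k * a / \<zeta>) = 4 * (\<kappa> * a * k * z / (2 * \<alpha>) / \<zeta>)" by simp
    moreover have "(\<kappa> * z / \<alpha>) * V\<^sup>2 = L" by (simp add: L_def)
    ultimately have "\<kappa> * a * k * z / (2 * \<alpha>) / \<zeta> \<le> L / 4" by linarith
    with 1 show ?thesis by linarith
  qed
  have "Kg * ((3 + z) * G) \<le> Kg * ((3 + z) * (2 * r / \<zeta>))"
    using Kg z G by (intro mult_left_mono) auto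
  also have "\<dots> = (c3 + 2 * Kg * r * z) / \<zeta>" by (simp add: c3_def algebra_simps add_divide_distrib)
  finally have "2 * z / \<zeta> + Kg * ((3 + z) * G) \<le> (c3 + c4 * z) / \<zeta>"
    by (simp add: c4_def algebra_simps add_divide_distrib)
  then have i6: "2 * z / \<zeta> + Kg * ((3 + z) * G) \<le> L / 4" using i5 by (rule order_trans)
  have "V + 2 * z * m\<^sup>2 + z * \<bar>\<beta>2 z\<bar> / \<zeta> + 2 * z / \<zeta> + Kg * (\<alpha> + (3 + z) * G + 2 * V)
      = V * (1 + 2 * Kg) + Kg * \<alpha> + 2 * z * m\<^sup>2 + z * \<bar>\<beta>2 z\<bar> / \<zeta> + (2 * z / \<zeta> + Kg * ((3 + z) * G))"
    by (simp add: algebra_simps)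
  also have "\<dots> \<le> L / 8 + L / 8 + L / 8 + L / 8 + L / 4"
    by (intro add_mono i1 i2 i3 i4 i6)
  also have "\<dots> < L" using Lpos by simp
  finally show ?thesis by (simp add: L_def)
qed

text \<open>Multiplied by \<open>z\<close>, every term on the left is at most a multiple of
  \<open>b\<close>, because z / \<rho> \<le> 4 b / a; the choice of \<open>b\<close> makes their sum
  less than \<alpha> / 2. This contradicts \<open>maximum_estimate_without_height\<close>.\<close>

lemma cutoff_estimate:
  assumes z: "0 < z" "z \<le> b" and \<rho>: "a * z / (4 * b) \<le> \<rho>" and G: "0 \<le> G" "G \<le> 2 * r / \<rho>"
  shows "Kg * (\<alpha> + (3 + z) * G) + 2 * z / \<rho> < \<alpha> / (2 * z)"
proof -
  have rp: "\<rho> > 0" using \<rho> z a_pos b by (smt (verit) divide_pos_pos mult_pos_pos)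
  have zr: "z / \<rho> \<le> 4 * b / a" using \<rho> z a_pos b rp by (simp add: field_simps)
  have "z * ((3 + z) * G) \<le> z * (4 * (2 * r / \<rho>))"
    using z b G r rp by (intro mult_left_mono mult_mono) auto
  also have "\<dots> = 8 * r * (z / \<rho>)" by simp
  also have "\<dots> \<le> 8 * r * (4 * b / a)" using zr r by (intro mult_left_mono) auto
  finally have 1: "Kg * (z * ((3 + z) * G)) \<le> Kg * (b * (32 * r / a))"
    using Kg by (intro mult_left_mono) (auto simp: field_simps)
  have 2: "Kg * (z * \<alpha>) \<le> Kg * (b * 1)" using Kg z \<alpha> by (intro mult_left_mono mult_mono) auto
  have "z * (2 * z / \<rho>) = 2 * z * (z / \<rho>)" by simp
  also have "\<dots> \<le> (2 * 1) * (4 * b / a)" using z b zr rp by (intro mult_mono) auto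
  finally have 3: "z * (2 * z / \<rho>) \<le> b * (8 / a)" by (simp add: mult.commute)
  have "z * (Kg * (\<alpha> + (3 + z) * G) + 2 * z / \<rho>) \<le> b * (Kg * (1 + 32 * r / a) + 8 / a)"
    using 1 2 3 by (simp add: algebra_simps)
  also have "\<dots> < \<alpha> / 2" by (rule b(3))
  finally show ?thesis using z by (simp add: field_simps)
qed

text \<open>\<open>c5\<close> bounds the \<psi> term by c5 M1 (1 + 1/\<zeta>), and \<open>c7\<close>
  compares this with \<alpha> and \<open>a\<close>. The slope counts as large above exp (c8 M1^2):
  the summands of \<open>c8\<close> yield c7 M1^2 exp (k M1^2) < sqrt w, w \<ge> 16 r M1 / a, and w
  \<ge> 2.\<close>

definition c5 where "c5 = Kg * (1 + 2 * k + 8 * r + a * (1 + 1 / b))"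
definition c7 where "c7 = 2 * c5 / \<alpha> * (1 + 2 / a)"
definition c8 where "c8 = 2 * c7 + 2 * (1 + k) + 16 * r / a + 2"

lemma c_nonneg: "c5 \<ge> 0" "c7 \<ge> 0" "c8 \<ge> 2"
proof -
  show c5: "c5 \<ge> 0" unfolding c5_def using Kg k_ge r a_pos b by (intro mult_nonneg_nonneg add_nonneg_nonneg) auto
  show c7: "c7 \<ge> 0" unfolding c7_def using c5 \<alpha> a_pos by (intro mult_nonneg_nonneg) auto
  show "c8 \<ge> 2" unfolding c8_def using c7 k_ge r a_pos by (smt (verit) divide_nonneg_pos)
qed

lemma large_slope:
  assumes w: "exp (c8 * M1\<^sup>2) \<le> w"
  shows "w \<ge> 2" "w \<ge> 16 * r * M1 / a"
proof -
  have M2: "1 \<le> M1\<^sup>2" "M1 \<le> M1\<^sup>2" using M1 by (simp_all add: self_le_power)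
  have "2 * 1 \<le> c8 * M1\<^sup>2" using c_nonneg M2 by (intro mult_mono) auto
  then have "1 + 1 \<le> exp (c8 * M1\<^sup>2)" using exp_ge_add_one_self[of "c8 * M1\<^sup>2"] by linarith
  then show "w \<ge> 2" using w by simp
  have "16 * r / a \<le> c8" unfolding c8_def using c_nonneg k_ge by simp
  moreover have "16 * r / a \<ge> 0" using r a_pos by simp
  ultimately have "16 * r / a * M1 \<le> c8 * M1\<^sup>2" using M2 M1 by (intro mult_mono) auto
  also have "\<dots> \<le> exp (c8 * M1\<^sup>2)" using exp_ge_add_one_self[of "c8 * M1\<^sup>2"] by linarith
  finally show "w \<ge> 16 * r * M1 / a" using w by simp
qed

text \<open>There is no lower bound on \<open>\<zeta>\<close> independent of w, only
  \<open>inv\<close>. As \<alpha> \<le> 1/2, it costs at most sqrt w, and the other sqrt w outweighs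
  exp (m z) \<le> exp (k M1^2). This is where the threshold acquires the square of the height in its
  exponent.\<close>

lemma large_slope_dominates:
  assumes w: "exp (c8 * M1\<^sup>2) \<le> w" and z: "0 < z" "z \<le> M1" and zeta: "\<zeta> > 0"
    and inv: "1 / \<zeta> \<le> w powr \<alpha> * exp (m * z) / (a / 2)"
    and G: "0 \<le> G" "G \<le> 2 * r / \<zeta>" and V: "V = m + \<beta>1 z / \<zeta>"
  shows "Kg * (\<alpha> + (3 + z) * G + 2 * V) < \<alpha> * w / (2 * z)"
proof -
  have w2: "w \<ge> 2" by (rule large_slope(1)[OF w])
  have M2: "1 \<le> M1\<^sup>2" using M1 by simp
  define e where "e = exp (k * M1\<^sup>2)"
  have e1: "e \<ge> 1" unfolding e_def using k_ge M2 by simp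
  have sw: "sqrt w \<ge> 1" using w2 by simp
  have 1: "1 / \<zeta> \<le> (2 / a) * (sqrt w * e)"
  proof -
    have "w powr \<alpha> \<le> w powr (1/2)" using w2 \<alpha> by (intro powr_mono) auto
    then have "w powr \<alpha> \<le> sqrt w" using w2 by (simp add: powr_half_sqrt)
    moreover have "exp (m * z) \<le> e"
    proof -
      have "m * z \<le> m * M1" using m_ge z by (intro mult_left_mono) auto
      then show ?thesis by (simp add: e_def m_def power2_eq_square mult.assoc)
    qed
    ultimately have "w powr \<alpha> * exp (m * z) \<le> sqrt w * e" using w2 by (intro mult_mono) auto
    then have "w powr \<alpha> * exp (m * z) / (a / 2) \<le> sqrt w * e / (a / 2)" using a_pos by (intro divide_right_mono) auto
    then show ?thesis using inv by (simp add: mult.commute)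
  qed
  have "1 * 1 \<le> sqrt w * e" using sw e1 by (intro mult_mono) auto
  then have zz: "1 + 1 / \<zeta> \<le> (1 + 2 / a) * (sqrt w * e)" using 1 by (simp add: algebra_simps)
  have "(3 + z) * G \<le> (4 * M1) * (2 * r / \<zeta>)" using z M1 G r zeta by (intro mult_mono) auto
  also have "\<dots> = M1 * (8 * r * (1 / \<zeta>))" by simp
  finally have g1: "(3 + z) * G \<le> M1 * (8 * r * (1 / \<zeta>))" .
  have g2: "2 * (\<beta>1 z / \<zeta>) \<le> M1 * (a * (1 + 1 / b) * (1 / \<zeta>))"
  proof -
    have "2 * \<beta>1 z * (1 / \<zeta>) \<le> a * (1 + 1 / b) * (1 / \<zeta>)"
      using \<beta>_bounds(6)[OF z(1)] zeta by (intro mult_right_mono) auto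
    also have "\<dots> \<le> M1 * (a * (1 + 1 / b) * (1 / \<zeta>))"
    proof -
      have "0 \<le> a * (1 + 1 / b) * (1 / \<zeta>)" using a_pos b zeta by simp
      from mult_right_mono[OF M1 this] show ?thesis by simp
    qed
    finally show ?thesis by simp
  qed
  have "\<alpha> + (3 + z) * G + 2 * V \<le> M1 * (1 + 2 * k) + M1 * ((8 * r + a * (1 + 1 / b)) * (1 / \<zeta>))"
    using g1 g2 \<alpha> M1 unfolding V m_def by (simp add: algebra_simps)
  also have "\<dots> \<le> M1 * ((1 + 2 * k + 8 * r + a * (1 + 1 / b)) * (1 + 1 / \<zeta>))"
  proof -
    have "0 \<le> (1 + 2 * k) * (1 / \<zeta>)" "0 \<le> 8 * r + a * (1 + 1 / b)"
      using k_ge zeta r a_pos b by (auto intro!: mult_nonneg_nonneg add_nonneg_nonneg divide_nonneg_pos)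
    then have "(1 + 2 * k) + (8 * r + a * (1 + 1 / b)) * (1 / \<zeta>) \<le> (1 + 2 * k + 8 * r + a * (1 + 1 / b)) * (1 + 1 / \<zeta>)"
      by (simp add: algebra_simps)
    then have "M1 * ((1 + 2 * k) + (8 * r + a * (1 + 1 / b)) * (1 / \<zeta>)) \<le> M1 * ((1 + 2 * k + 8 * r + a * (1 + 1 / b)) * (1 + 1 / \<zeta>))"
      using M1 by (intro mult_left_mono) auto
    then show ?thesis by (simp only: distrib_left)
  qed
  finally have "Kg * (\<alpha> + (3 + z) * G + 2 * V) \<le> Kg * (M1 * ((1 + 2 * k + 8 * r + a * (1 + 1 / b)) * (1 + 1 / \<zeta>)))"
    using Kg by (intro mult_left_mono)
  also have "\<dots> = c5 * M1 * (1 + 1 / \<zeta>)" by (simp add: c5_def)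
  finally have q: "Kg * (\<alpha> + (3 + z) * G + 2 * V) \<le> c5 * M1 * (1 + 1 / \<zeta>)" .
  have "2 * z * (Kg * (\<alpha> + (3 + z) * G + 2 * V)) \<le> 2 * M1 * (c5 * M1 * (1 + 1 / \<zeta>))"
  proof (rule mult_mono)
    have "0 \<le> V" using V m_ge \<beta>_bounds(4)[OF z(1)] a_pos M1 zeta
      by (smt (verit) divide_nonneg_nonneg)
    then show "0 \<le> Kg * (\<alpha> + (3 + z) * G + 2 * V)"
      using Kg \<alpha> z G by (intro mult_nonneg_nonneg add_nonneg_nonneg) auto
  qed (use z q M1 in auto)
  also have "\<dots> = 2 * c5 * M1\<^sup>2 * (1 + 1 / \<zeta>)" by (simp add: power2_eq_square)
  also have "\<dots> \<le> 2 * c5 * M1\<^sup>2 * ((1 + 2 / a) * (sqrt w * e))"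
    using zz c_nonneg by (intro mult_left_mono) auto
  also have "\<dots> = \<alpha> * ((c7 * (M1\<^sup>2 * e)) * sqrt w)"
  proof -
    have ac: "\<alpha> * c7 = 2 * c5 * (1 + 2 / a)" using \<alpha> by (simp add: c7_def)
    have "2 * c5 * M1\<^sup>2 * ((1 + 2 / a) * (sqrt w * e)) = 2 * c5 * (1 + 2 / a) * (M1\<^sup>2 * (sqrt w * e))"
      by (simp only: mult_ac)
    also have "\<dots> = \<alpha> * ((c7 * (M1\<^sup>2 * e)) * sqrt w)" unfolding ac[symmetric] by (simp only: mult_ac)
    finally show ?thesis .
  qed
  also have "\<dots> < \<alpha> * (sqrt w * sqrt w)"
  proof -
    have "c7 < exp (c7 * M1\<^sup>2)"
    proof -
      have "c7 * 1 \<le> c7 * M1\<^sup>2" using c_nonneg M2 by (intro mult_left_mono) auto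
      then show ?thesis using exp_ge_add_one_self[of "c7 * M1\<^sup>2"] by linarith
    qed
    moreover have "M1\<^sup>2 * e \<le> exp (M1\<^sup>2) * e"
    proof (rule mult_right_mono)
      show "M1\<^sup>2 \<le> exp (M1\<^sup>2)" using exp_ge_add_one_self[of "M1\<^sup>2"] by linarith
    qed (use e1 in simp)
    moreover have "0 < M1\<^sup>2 * e" using M1 e1 by simp
    ultimately have "c7 * (M1\<^sup>2 * e) < exp (c7 * M1\<^sup>2) * (exp (M1\<^sup>2) * e)"
      using c_nonneg by (intro mult_less_le_imp_less) auto
    also have "\<dots> = exp ((c7 + 1 + k) * M1\<^sup>2)" by (simp add: e_def exp_add[symmetric] algebra_simps)
    also have "\<dots> \<le> exp (c8 * M1\<^sup>2 / 2)"
    proof -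
      have "c7 + 1 + k \<le> c8 / 2" unfolding c8_def using r a_pos by simp
      then have "(c7 + 1 + k) * M1\<^sup>2 \<le> c8 / 2 * M1\<^sup>2" by (rule mult_right_mono) simp
      then show ?thesis by simp
    qed
    also have "\<dots> = sqrt (exp (c8 * M1\<^sup>2))"
    proof -
      have "exp (c8 * M1\<^sup>2) = (exp (c8 * M1\<^sup>2 / 2))\<^sup>2" by (simp add: exp_double[symmetric])
      then show ?thesis by simp
    qed
    also have "\<dots> \<le> sqrt w" using w by simp
    finally have "c7 * (M1\<^sup>2 * e) < sqrt w" .
    then have "(c7 * (M1\<^sup>2 * e)) * sqrt w < sqrt w * sqrt w" using sw by (intro mult_strict_right_mono) auto
    then show ?thesis using \<alpha> by (intro mult_strict_left_mono)
  qed
  also have "\<dots> = \<alpha> * w" using w2 by simp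
  finally have "2 * z * (Kg * (\<alpha> + (3 + z) * G + 2 * V)) < \<alpha> * w" .
  then show ?thesis using z by (simp add: field_simps)
qed

end

lemma barrier_constants_exist:
  fixes r Kg \<kappa> :: real
  assumes r: "r > 0" and Kg: "Kg \<ge> 0" and \<kappa>: "\<kappa> > 0"
  obtains \<alpha> b k where "\<And>M1. M1 \<ge> 1 \<Longrightarrow> barrier r Kg \<kappa> \<alpha> b k (r\<^sup>2 / 2) M1"
proof -
  define a where "a = r\<^sup>2 / 2"
  have a: "a > 0" using r by (simp add: a_def)
  define \<alpha> where "\<alpha> = min (1/64) (\<kappa> / (128 * (1 + 2 * Kg)))"
  have \<alpha>: "\<alpha> > 0" "\<alpha> \<le> 1/64" "128 * (1 + 2 * Kg) * \<alpha> \<le> \<kappa>"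
  proof -
    have p: "128 * (1 + 2 * Kg) > 0" using Kg by simp
    then show "\<alpha> > 0" using \<kappa> by (simp add: \<alpha>_def)
    show "\<alpha> \<le> 1/64" unfolding \<alpha>_def by (rule min.cobounded1)
    have "\<alpha> \<le> \<kappa> / (128 * (1 + 2 * Kg))" by (simp add: \<alpha>_def)
    then show "128 * (1 + 2 * Kg) * \<alpha> \<le> \<kappa>" unfolding pos_le_divide_eq[OF p] by (simp add: mult.commute)
  qed
  define P where "P = Kg * (1 + 32 * r / a) + 8 / a"
  have P: "P > 0" unfolding P_def using Kg r a by (intro add_nonneg_pos mult_nonneg_nonneg) auto
  define Q where "Q = 512 * \<alpha> * (6 * Kg * r + (2 + 2 * Kg * r))"
  have "6 * Kg * r \<ge> 0" "2 * Kg * r \<ge> 0" using Kg r by auto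
  then have Q: "Q > 0" unfolding Q_def using \<alpha>(1) by (intro mult_pos_pos) auto
  define b where "b = min 1 (min (\<alpha> / (4 * P)) (\<kappa> * a / Q))"
  have b: "b > 0" "b \<le> 1" "b * P < \<alpha> / 2" "Q * b \<le> \<kappa> * a"
  proof -
    show "b > 0" "b \<le> 1" using \<alpha> P Q \<kappa> a by (auto simp: b_def)
    have "b \<le> \<alpha> / (4 * P)" by (simp add: b_def)
    then have "b * P \<le> \<alpha> / 4" using P by (simp add: field_simps)
    then show "b * P < \<alpha> / 2" using \<alpha> by linarith
    have "b \<le> \<kappa> * a / Q" by (simp add: b_def)
    then show "Q * b \<le> \<kappa> * a" using Q by (simp add: field_simps)
  qed
  define T where "T = 2 * \<alpha> * (6 * Kg * r / b + (2 + 2 * Kg * r))"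
  define k where "k = max (1 / b) (T / (\<kappa> * a))"
  have k: "k * b \<ge> 1" "T \<le> \<kappa> * a * k"
  proof -
    have "1 / b \<le> k" by (simp add: k_def)
    then show "k * b \<ge> 1" using b by (simp add: field_simps)
    have "T / (\<kappa> * a) \<le> k" by (simp add: k_def)
    then show "T \<le> \<kappa> * a * k" using \<kappa> a by (simp add: field_simps)
  qed
  have "barrier r Kg \<kappa> \<alpha> b k a M1" if "M1 \<ge> 1" for M1
    by unfold_locales (use assms that \<alpha> b k in \<open>simp_all add: a_def[symmetric] P_def Q_def T_def\<close>)
  then show ?thesis using that unfolding a_def by blast
qed

section \<open>The gradient estimate\<close>

lemma ln_wfun_powr:
  assumes "X > 0"
  shows "ln (wfun p powr \<alpha> * X) = \<alpha> / 2 * ln (1 + p \<bullet> p) + ln X"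
proof -
  have w: "wfun p > 0" by (rule wfun_pos)
  have "ln (1 + p \<bullet> p) = ln ((wfun p)\<^sup>2)" by (simp add: wfun_square)
  also have "\<dots> = 2 * ln (wfun p)" using w by (simp add: ln_realpow)
  finally show ?thesis using w assms by (simp add: ln_mult ln_powr)
qed

context curvature_function
begin

text \<open>The maximum point \<open>x0\<close> of \<open>\<Theta>\<close> either has slope below
  the threshold, and comparison with the centre gives the bound, or has large slope, and each of the
  two test functions leads to a contradiction.\<close>

lemma gradient_estimate_at_center:
  fixes u :: "real^'n \<Rightarrow> real" and Du :: "real^'n \<Rightarrow> real^'n" and D2u :: "real^'n \<Rightarrow> real^'n^'n"
    and D\<psi> :: "(real^'n) \<times> real \<times> ((real^'n) \<times> real) \<Rightarrow> ((real^'n) \<times> real \<times> ((real^'n) \<times> real)) \<Rightarrow>\<^sub>L real"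
  defines "A \<equiv> \<lambda>y. curv_mat (u y) (Du y) (D2u y)" and "J \<equiv> \<lambda>y. (y, u y, upnormal (Du y))"
  assumes fin: "\<bar>f0\<bar> \<noteq> \<infinity>" and K0: "K \<ge> 0" and bar: "barrier r (K / gap) (\<delta> / 32) \<alpha> b k a M1"
    and C3: "C3_with (ball 0 r) u Du D2u"
    and upos: "\<And>y. y \<in> ball 0 r \<Longrightarrow> 0 < u y" and uM: "\<And>y. y \<in> ball 0 r \<Longrightarrow> u y \<le> M1"
    and adm: "\<And>y. y \<in> ball 0 r \<Longrightarrow> \<exists>l. eigvals_are (A y) l \<and> l \<in> closure \<Gamma>"
    and eq: "\<And>y. y \<in> ball 0 r \<Longrightarrow> solves_at \<Gamma> f h g (A y) (\<psi> (J y))"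
    and dat: "\<And>y l. y \<in> ball 0 r \<Longrightarrow> eigvals_are (A y) l \<Longrightarrow> l \<in> frontier \<Gamma> \<Longrightarrow> degenerate_data \<Gamma> f h g"
    and \<psi>: "\<And>y. y \<in> ball 0 r \<Longrightarrow> (\<psi> has_derivative blinfun_apply (D\<psi> (J y))) (at (J y))"
    and K: "\<And>y. y \<in> ball 0 r \<Longrightarrow> norm (D\<psi> (J y)) \<le> K"
    and str: "\<And>y. y \<in> ball 0 r \<Longrightarrow> (\<psi> (J y) - real_of_ereal f0) / u y \<le> D\<psi> (J y) (0, 1, 0)"
  shows "\<alpha> * ln (wfun (Du 0)) \<le> (\<alpha> * barrier.c8 r (K / gap) \<alpha> b k a + k) * M1\<^sup>2 + 2"
proof -
  interpret bar: barrier r "K / gap" "\<delta> / 32" \<alpha> b k a M1 by (rule bar)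
  note gp = gap_pos[OF fin]
  let ?B = "ball (0 :: real^'n) r"
  have du: "(u has_derivative (\<lambda>h. Du y \<bullet> h)) (at y)" and d2u: "(Du has_derivative (\<lambda>h. D2u y *v h)) (at y)"
    and d3u: "\<exists>D3. (D2u has_derivative D3) (at y)" if "y \<in> ?B" for y
    using C3 that unfolding C3_with_def by blast+
  \<comment> \<open>As r^2 = 2 a and \<open>\<beta>\<close> is at most \<open>a\<close>, both
    cutoffs are negative on the sphere of radius 9r/10, where |x|^2 = 81a/50 exceeds R + a. The
    maximum over this compact ball is therefore interior, although u is controlled on the open ball
    only.\<close>
  define R where "R = a / 4"
  have R: "R > 0" using bar.a_pos by (simp add: R_def)
  define \<rho> where "\<rho> y = R - y \<bullet> y" for y :: "real^'n"
  define \<zeta> where "\<zeta> y = \<rho> y + bar.\<beta> (u y)" for y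
  define \<Theta> where "\<Theta> y = wfun (Du y) powr \<alpha> * max (2 * \<rho> y) (exp (bar.m * u y) * \<zeta> y)" for y
  define \<rho>0 where "\<rho>0 = 9 * r / 10"
  have \<rho>0: "0 < \<rho>0" "\<rho>0 < r" using bar.r by (auto simp: \<rho>0_def)
  have sub: "cball 0 \<rho>0 \<subseteq> ?B" using \<rho>0 by auto
  have cu: "continuous_on ?B u" and cDu: "continuous_on ?B Du"
    using has_derivative_continuous[OF du] has_derivative_continuous[OF d2u]
    by (auto intro!: continuous_at_imp_continuous_on)
  have "continuous_on {0<..} bar.\<beta>"
    using DERIV_isCont[OF bar.\<beta>_derivative(1)] by (auto intro!: continuous_at_imp_continuous_on)
  then have cb: "continuous_on ?B (\<lambda>y. bar.\<beta> (u y))"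
    by (rule continuous_on_compose2[OF _ cu]) (use upos in auto)
  have c\<rho>: "continuous_on ?B \<rho>" unfolding \<rho>_def[abs_def] by (intro continuous_intros)
  have c\<zeta>: "continuous_on ?B \<zeta>" unfolding \<zeta>_def[abs_def] by (intro continuous_intros cb c\<rho>)
  have wne: "wfun p \<noteq> 0" for p :: "real^'n" using wfun_pos[of p] by simp
  have cw: "continuous_on ?B (\<lambda>y. wfun (Du y))"
    unfolding wfun_def by (intro continuous_intros cDu)
  have "continuous_on ?B \<Theta>"
    unfolding \<Theta>_def[abs_def] using wne by (intro continuous_intros cw cu c\<rho> c\<zeta>) auto
  then have c\<Theta>: "continuous_on (cball 0 \<rho>0) \<Theta>" by (rule continuous_on_subset[OF _ sub])
  obtain x0 where x0: "x0 \<in> cball 0 \<rho>0" and mx: "\<And>y. y \<in> cball 0 \<rho>0 \<Longrightarrow> \<Theta> y \<le> \<Theta> x0"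
    using continuous_attains_sup[OF compact_cball _ c\<Theta>] \<rho>0 by force
  have w1: "wfun (Du y) powr \<alpha> \<ge> 1" for y using wfun_ge_1[of "Du y"] bar.\<alpha> by (simp add: ge_one_powr_ge_zero)
  have \<Theta>0: "wfun (Du 0) powr \<alpha> * (2 * R) \<le> \<Theta> x0"
  proof -
    have "wfun (Du 0) powr \<alpha> * (2 * R) \<le> \<Theta> 0"
      unfolding \<Theta>_def using w1[of 0] by (intro mult_left_mono) (auto simp: \<rho>_def)
    then show ?thesis using mx[of 0] \<rho>0 by simp
  qed
  have \<Theta>pos: "\<Theta> x0 \<ge> 2 * R"
  proof -
    have "1 * (2 * R) \<le> wfun (Du 0) powr \<alpha> * (2 * R)" using R by (intro mult_right_mono w1) auto
    then show ?thesis using \<Theta>0 by simp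
  qed
  have x0B: "x0 \<in> ?B" using x0 sub by auto
  define z where "z = u x0"
  define w where "w = wfun (Du x0)"
  have z: "0 < z" "z \<le> M1" using upos[OF x0B] uM[OF x0B] by (auto simp: z_def)
  have w: "w > 0" "w \<ge> 1" by (simp_all add: w_def wfun_pos wfun_ge_1)
  have wp: "w powr \<alpha> > 0" using w by simp
  have ra: "r\<^sup>2 = 2 * a" by (simp add: bar.a)
  have interior: "x0 \<in> ball 0 \<rho>0"
  proof (rule ccontr)
    assume "x0 \<notin> ball 0 \<rho>0"
    then have "norm x0 = \<rho>0" using x0 by simp
    then have "x0 \<bullet> x0 = \<rho>0\<^sup>2" by (simp add: power2_norm_eq_inner[symmetric])
    also have "\<dots> = 81 / 100 * r\<^sup>2" by (simp add: \<rho>0_def power2_eq_square)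
    finally have xx: "x0 \<bullet> x0 = 81 / 50 * a" by (simp add: ra)
    then have "\<rho> x0 < 0" "\<zeta> x0 < 0"
      using bar.a_pos bar.\<beta>_bounds(2)[OF z] by (auto simp: \<rho>_def \<zeta>_def R_def z_def)
    then have "max (2 * \<rho> x0) (exp (bar.m * u x0) * \<zeta> x0) < 0" by (simp add: mult_less_0_iff)
    then have "\<Theta> x0 < 0" unfolding \<Theta>_def using wp by (simp add: w_def mult_less_0_iff)
    then show False using \<Theta>pos R by simp
  qed
  show ?thesis
  proof (cases "w < exp (bar.c8 * M1\<^sup>2)")
    \<comment> \<open>The second factor of \<open>\<Theta>\<close> is at most 6 R exp (k M1^2),
      against at least 2 R at the centre; the quotient 3 is absorbed by exp 2.\<close>
    case True
    have "w powr \<alpha> \<le> exp (bar.c8 * M1\<^sup>2) powr \<alpha>" using True w bar.\<alpha> by (intro powr_mono2) auto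
    then have wa: "w powr \<alpha> \<le> exp (\<alpha> * bar.c8 * M1\<^sup>2)" by (simp add: powr_def mult_ac)
    have e1: "exp (bar.m * z) \<le> exp (k * M1\<^sup>2)"
    proof -
      have "bar.m * z \<le> bar.m * M1" using bar.m_ge z by (intro mult_left_mono) auto
      then show ?thesis by (simp add: bar.m_def power2_eq_square mult.assoc)
    qed
    have e2: "exp (k * M1\<^sup>2) \<ge> 1" using bar.k_ge by simp
    have "\<rho> x0 \<le> R" by (simp add: \<rho>_def)
    moreover have "bar.\<beta> (u x0) \<le> 4 * R" using bar.\<beta>_bounds(2)[OF z] by (simp add: R_def z_def)
    ultimately have "\<zeta> x0 \<le> 6 * R" "2 * \<rho> x0 \<le> 6 * R" using R by (auto simp: \<zeta>_def)
    then have "exp (bar.m * z) * \<zeta> x0 \<le> exp (k * M1\<^sup>2) * (6 * R)" "2 * \<rho> x0 \<le> exp (k * M1\<^sup>2) * (6 * R)"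
    proof -
      assume le: "\<zeta> x0 \<le> 6 * R" "2 * \<rho> x0 \<le> 6 * R"
      have "exp (bar.m * z) * \<zeta> x0 \<le> exp (bar.m * z) * (6 * R)" using le by simp
      also have "\<dots> \<le> exp (k * M1\<^sup>2) * (6 * R)" using e1 R by simp
      finally show "exp (bar.m * z) * \<zeta> x0 \<le> exp (k * M1\<^sup>2) * (6 * R)" .
      have "1 * (6 * R) \<le> exp (k * M1\<^sup>2) * (6 * R)" using e2 R by (intro mult_right_mono) auto
      with le(2) show "2 * \<rho> x0 \<le> exp (k * M1\<^sup>2) * (6 * R)" unfolding mult_1_left by (rule order_trans)
    qed
    then have "\<Theta> x0 \<le> w powr \<alpha> * (exp (k * M1\<^sup>2) * (6 * R))"
      unfolding \<Theta>_def w_def z_def using w1[of x0] by (intro mult_left_mono) auto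
    also have "\<dots> \<le> exp (\<alpha> * bar.c8 * M1\<^sup>2) * (exp (k * M1\<^sup>2) * (6 * R))"
      using wa R by (intro mult_right_mono) auto
    also have "\<dots> = (exp (\<alpha> * bar.c8 * M1\<^sup>2) * exp (k * M1\<^sup>2) * 3) * (2 * R)" by simp
    finally have "wfun (Du 0) powr \<alpha> * (2 * R) \<le> (exp (\<alpha> * bar.c8 * M1\<^sup>2) * exp (k * M1\<^sup>2) * 3) * (2 * R)"
      by (rule order_trans[OF \<Theta>0])
    then have "wfun (Du 0) powr \<alpha> \<le> exp (\<alpha> * bar.c8 * M1\<^sup>2) * exp (k * M1\<^sup>2) * 3"
      by (rule mult_right_le_imp_le) (use R in simp)
    also have "\<dots> \<le> exp (\<alpha> * bar.c8 * M1\<^sup>2) * exp (k * M1\<^sup>2) * exp 2"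
      using exp_ge_add_one_self[of 2] by simp
    also have "\<dots> = exp ((\<alpha> * bar.c8 + k) * M1\<^sup>2 + 2)" by (simp add: exp_add[symmetric] algebra_simps)
    finally have "ln (wfun (Du 0) powr \<alpha>) \<le> ln (exp ((\<alpha> * bar.c8 + k) * M1\<^sup>2 + 2))"
      using wfun_pos[of "Du 0"] by (intro ln_mono) auto
    then show ?thesis using wfun_pos[of "Du 0"] by (simp add: ln_powr)
  next
    case False
    then have wl: "exp (bar.c8 * M1\<^sup>2) \<le> w" by simp
    have w2: "w \<ge> 2" and wr: "w \<ge> 16 * r * M1 / a" using bar.large_slope[OF wl] by auto
    have wsq: "w\<^sup>2 = 1 + Du x0 \<bullet> Du x0" by (simp add: w_def wfun_square)
    obtain D3 where D3: "(D2u has_derivative D3) (at x0)" using d3u[OF x0B] by blast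
    have nx: "norm x0 \<le> r" using x0B by simp
    have near: "\<exists>d>0. \<forall>y\<in>ball x0 d. y \<in> cball 0 \<rho>0 \<and> 0 < F y"
      if F: "continuous_on ?B F" "F x0 > 0" for F :: "real^'n \<Rightarrow> real"
    proof -
      have "open (?B \<inter> F -` {0<..})" by (rule continuous_open_preimage[OF F(1)]) auto
      then have "open ((?B \<inter> F -` {0<..}) \<inter> ball 0 \<rho>0)" by (rule open_Int) simp
      moreover have "x0 \<in> (?B \<inter> F -` {0<..}) \<inter> ball 0 \<rho>0" using F(2) x0B interior by simp
      ultimately obtain d where "d > 0" "ball x0 d \<subseteq> (?B \<inter> F -` {0<..}) \<inter> ball 0 \<rho>0"
        unfolding open_contains_ball by blast
      then show ?thesis by (intro exI[of _ d]) auto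
    qed
    have False
    proof (cases "exp (bar.m * z) * \<zeta> x0 \<le> 2 * \<rho> x0")
      case act: True
      have \<Theta>x: "\<Theta> x0 = w powr \<alpha> * (2 * \<rho> x0)" using act by (simp add: \<Theta>_def w_def z_def)
      have \<rho>pos: "\<rho> x0 > 0"
      proof -
        have "0 < \<Theta> x0" using \<Theta>pos R by linarith
        then have "0 < w powr \<alpha> * (2 * \<rho> x0)" unfolding \<Theta>x .
        then show ?thesis using wp by (simp add: zero_less_mult_iff)
      qed
      obtain d where d: "d > 0" and dd: "\<And>y. y \<in> ball x0 d \<Longrightarrow> y \<in> cball 0 \<rho>0 \<and> 0 < \<rho> y"
        using near[OF c\<rho> \<rho>pos] by blast
      \<comment> \<open>The test function active at \<open>x0\<close> never exceeds
        \<open>\<Theta>\<close> and equals it at \<open>x0\<close>. So it has a local maximum there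
        by itself, and it is smooth although \<open>\<Theta>\<close> is not.\<close>
      have max: "y \<in> ?B \<and> R - y \<bullet> y + 0 > 0 \<and>
        \<alpha> / 2 * ln (1 + Du y \<bullet> Du y) + 0 * u y + ln (R - y \<bullet> y + 0)
        \<le> \<alpha> / 2 * ln (1 + Du x0 \<bullet> Du x0) + 0 * u x0 + ln (R - x0 \<bullet> x0 + 0)" if y: "y \<in> ball x0 d" for y
      proof -
        have yr: "\<rho> y > 0" and yc: "y \<in> cball 0 \<rho>0" using dd[OF y] by auto
        have "wfun (Du y) powr \<alpha> * (2 * \<rho> y) \<le> \<Theta> y"
          unfolding \<Theta>_def using w1[of y] by (intro mult_left_mono) auto
        also have "\<dots> \<le> wfun (Du x0) powr \<alpha> * (2 * \<rho> x0)" using mx[OF yc] \<Theta>x by (simp add: w_def)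
        finally have "wfun (Du y) powr \<alpha> * \<rho> y \<le> wfun (Du x0) powr \<alpha> * \<rho> x0" by simp
        then have "ln (wfun (Du y) powr \<alpha> * \<rho> y) \<le> ln (wfun (Du x0) powr \<alpha> * \<rho> x0)"
          using yr wfun_pos[of "Du y"] by (intro ln_mono) auto
        then have "\<alpha> / 2 * ln (1 + Du y \<bullet> Du y) + ln (\<rho> y) \<le> \<alpha> / 2 * ln (1 + Du x0 \<bullet> Du x0) + ln (\<rho> x0)"
          unfolding ln_wfun_powr[OF yr] ln_wfun_powr[OF \<rho>pos] .
        then show ?thesis using yr subsetD[OF sub yc] by (simp add: \<rho>_def)
      qed
      have \<zeta>x: "R - x0 \<bullet> x0 + 0 = \<rho> x0" by (simp add: \<rho>_def)
      have 0: "(0::real) \<le> 0" "((\<lambda>_::real. 0::real) has_real_derivative 0) (at t)" for t by auto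
      obtain H D and \<phi> y c :: "'n \<Rightarrow> real" where est:
        "\<And>i. 0 \<le> \<phi> i" "0 \<le> H" "0 \<le> D" "H * gap \<le> (\<Sum>i\<in>UNIV. \<phi> i) + D" "H = 0 \<Longrightarrow> 0 < (\<Sum>i\<in>UNIV. \<phi> i)"
        "\<alpha> * w * (Du x0 \<bullet> Du x0) * D / z + \<alpha> * (Du x0 \<bullet> Du x0) * (\<Sum>i\<in>UNIV. \<phi> i) / z
          + (\<Sum>i\<in>UNIV. \<phi> i * ((\<alpha> * (y i)\<^sup>2 * (1 + (c i)\<^sup>2) - \<alpha>\<^sup>2 * (y i)\<^sup>2 * (c i)\<^sup>2) / z
               - 2 * \<alpha> * 0 * y i * (c i)\<^sup>2 - z * 0\<^sup>2 * (c i)\<^sup>2 + z * 0 * (c i)\<^sup>2 / \<rho> x0))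
          \<le> w\<^sup>2 * ((0 + 0 / \<rho> x0) * (\<Sum>i\<in>UNIV. \<phi> i) + H * K * (\<alpha> + (3 + z) * (2 * norm x0 / \<rho> x0) + 2 * (0 + 0 / \<rho> x0))
              + 2 * z * (\<Sum>i\<in>UNIV. \<phi> i) / \<rho> x0)"
        by (rule maximum_point_estimate[where \<beta> = "\<lambda>_. 0" and ?\<beta>1.0 = "\<lambda>_. 0" and R = R, OF fin open_ball x0B upos du d2u D3 adm[unfolded A_def] eq[unfolded A_def J_def]
              dat[OF x0B, unfolded A_def] \<psi>[OF x0B, unfolded J_def] K[OF x0B, unfolded J_def] str[OF x0B, unfolded J_def] bar.\<alpha>(1) 0(1) 0(2) 0(2) 0(1) d max,
              unfolded \<zeta>x w_def[symmetric] z_def[symmetric]]) blast+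
      have ineq: "\<alpha> / (2 * z) \<le> K / gap * (\<alpha> + (3 + z) * (2 * norm x0 / \<rho> x0)) + 2 * z / \<rho> x0"
      proof (rule maximum_estimate_without_height[OF est(1-3) gp est(4,5)])
        show "\<alpha> * w * (Du x0 \<bullet> Du x0) * D / z + \<alpha> * (Du x0 \<bullet> Du x0) * (\<Sum>i\<in>UNIV. \<phi> i) / z
          + (\<Sum>i\<in>UNIV. \<phi> i * ((\<alpha> * (y i)\<^sup>2 * (1 + (c i)\<^sup>2) - \<alpha>\<^sup>2 * (y i)\<^sup>2 * (c i)\<^sup>2) / z))
          \<le> w\<^sup>2 * (H * K * (\<alpha> + (3 + z) * (2 * norm x0 / \<rho> x0)) + 2 * z * (\<Sum>i\<in>UNIV. \<phi> i) / \<rho> x0)"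
          using est(6) by simp
      qed (use bar.\<alpha> z \<rho>pos w2 wsq K0 in auto)
      have \<beta>z: "bar.\<beta> z > 0" by (rule bar.\<beta>_bounds(1)[OF z(1)])
      \<comment> \<open>As exp (m z) \<ge> 1, the active cutoff satisfies \<rho> \<ge> \<beta>(z).
        But \<rho> \<le> a/4, which forces z \<le> b, and then \<rho> \<ge> a z / (4 b).\<close>
      have "1 * \<zeta> x0 \<le> exp (bar.m * z) * \<zeta> x0"
        using \<rho>pos \<beta>z bar.m_ge z by (intro mult_right_mono) (auto simp: \<zeta>_def z_def)
      then have "\<rho> x0 \<ge> bar.\<beta> z" using act by (simp add: \<zeta>_def z_def)
      then have \<rho>low: "(a / 2) * (z / (b + z)) \<le> \<rho> x0" using bar.\<beta>_bounds(3)[OF z(1)] by simp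
      also have "\<rho> x0 \<le> a / 4" by (simp add: \<rho>_def R_def)
      also have "a / 4 = (a / 2) * (1 / 2)" by simp
      finally have "z / (b + z) \<le> 1 / 2" by (rule mult_left_le_imp_le) (use bar.a_pos in simp)
      then have zb: "z \<le> b" using z bar.b by (simp add: field_simps)
      have "a * z / (4 * b) \<le> (a / 2) * (z / (b + z))"
      proof -
        have "z / (2 * b) \<le> z / (b + z)" using zb z bar.b by (intro divide_left_mono) auto
        then have "(a / 2) * (z / (2 * b)) \<le> (a / 2) * (z / (b + z))" using bar.a_pos by (intro mult_left_mono) auto
        then show ?thesis by simp
      qed
      then have "a * z / (4 * b) \<le> \<rho> x0" using \<rho>low by simp
      from bar.cutoff_estimate[OF z(1) zb this, of "2 * norm x0 / \<rho> x0"] ineq nx \<rho>pos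
      show False by (simp add: divide_right_mono)
    next
      case act: False
      have \<Theta>x: "\<Theta> x0 = w powr \<alpha> * (exp (bar.m * z) * \<zeta> x0)" using act by (simp add: \<Theta>_def w_def z_def)
      have \<zeta>pos: "\<zeta> x0 > 0"
      proof -
        have "0 < \<Theta> x0" using \<Theta>pos R by linarith
        then have "0 < w powr \<alpha> * (exp (bar.m * z) * \<zeta> x0)" unfolding \<Theta>x .
        then show ?thesis using wp by (simp add: zero_less_mult_iff)
      qed
      obtain d where d: "d > 0" and dd: "\<And>y. y \<in> ball x0 d \<Longrightarrow> y \<in> cball 0 \<rho>0 \<and> 0 < \<zeta> y"
        using near[OF c\<zeta> \<zeta>pos] by blast
      have max: "y \<in> ?B \<and> R - y \<bullet> y + bar.\<beta> (u y) > 0 \<and>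
        \<alpha> / 2 * ln (1 + Du y \<bullet> Du y) + bar.m * u y + ln (R - y \<bullet> y + bar.\<beta> (u y))
        \<le> \<alpha> / 2 * ln (1 + Du x0 \<bullet> Du x0) + bar.m * u x0 + ln (R - x0 \<bullet> x0 + bar.\<beta> (u x0))" if y: "y \<in> ball x0 d" for y
      proof -
        have yr: "\<zeta> y > 0" and yc: "y \<in> cball 0 \<rho>0" using dd[OF y] by auto
        have "wfun (Du y) powr \<alpha> * (exp (bar.m * u y) * \<zeta> y) \<le> \<Theta> y"
          unfolding \<Theta>_def using w1[of y] by (intro mult_left_mono) auto
        also have "\<dots> \<le> wfun (Du x0) powr \<alpha> * (exp (bar.m * u x0) * \<zeta> x0)" using mx[OF yc] \<Theta>x by (simp add: w_def z_def)
        finally have "ln (wfun (Du y) powr \<alpha> * (exp (bar.m * u y) * \<zeta> y)) \<le> ln (wfun (Du x0) powr \<alpha> * (exp (bar.m * u x0) * \<zeta> x0))"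
          using yr wfun_pos[of "Du y"] by (intro ln_mono) auto
        moreover have "ln (wfun (Du v) powr \<alpha> * (exp (bar.m * u v) * \<zeta> v))
            = \<alpha> / 2 * ln (1 + Du v \<bullet> Du v) + bar.m * u v + ln (R - v \<bullet> v + bar.\<beta> (u v))" if "\<zeta> v > 0" for v
        proof -
          have "exp (bar.m * u v) * \<zeta> v > 0" using that by simp
          from ln_wfun_powr[OF this, of "Du v" \<alpha>] show ?thesis using that by (simp add: ln_mult \<zeta>_def \<rho>_def)
        qed
        ultimately show ?thesis using yr \<zeta>pos yc sub by (auto simp: \<zeta>_def \<rho>_def)
      qed
      have \<zeta>x: "R - x0 \<bullet> x0 + bar.\<beta> z = \<zeta> x0" by (simp add: \<rho>_def \<zeta>_def z_def)
      have m0: "bar.m \<ge> 0" using bar.m_ge by simp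
      have b10: "bar.\<beta>1 (u x0) \<ge> 0"
        using order_trans[OF _ bar.\<beta>_bounds(4)[OF z(1)]] bar.a_pos bar.M1 by (simp add: z_def)
      define V where "V = bar.m + bar.\<beta>1 z / \<zeta> x0"
      define G where "G = 2 * norm x0 / \<zeta> x0"
      obtain H D and \<phi> y c :: "'n \<Rightarrow> real" where est:
        "\<And>i. 0 \<le> \<phi> i" "0 \<le> H" "0 \<le> D" "H * gap \<le> (\<Sum>i\<in>UNIV. \<phi> i) + D" "H = 0 \<Longrightarrow> 0 < (\<Sum>i\<in>UNIV. \<phi> i)"
        "(\<Sum>i\<in>UNIV. (c i)\<^sup>2) = Du x0 \<bullet> Du x0"
        "\<alpha> * (\<Sum>i\<in>UNIV. (c i)\<^sup>2 * y i) = - z * (V * (Du x0 \<bullet> Du x0) - 2 * (x0 \<bullet> Du x0) / \<zeta> x0)"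
        "\<And>i. y i < - 1 \<Longrightarrow> 2 * \<delta> * (\<Sum>i\<in>UNIV. \<phi> i) \<le> \<phi> i"
        "\<alpha> * w * (Du x0 \<bullet> Du x0) * D / z + \<alpha> * (Du x0 \<bullet> Du x0) * (\<Sum>i\<in>UNIV. \<phi> i) / z
          + (\<Sum>i\<in>UNIV. \<phi> i * ((\<alpha> * (y i)\<^sup>2 * (1 + (c i)\<^sup>2) - \<alpha>\<^sup>2 * (y i)\<^sup>2 * (c i)\<^sup>2) / z
               - 2 * \<alpha> * bar.m * y i * (c i)\<^sup>2 - z * bar.m\<^sup>2 * (c i)\<^sup>2 + z * bar.\<beta>2 z * (c i)\<^sup>2 / \<zeta> x0))
          \<le> w\<^sup>2 * (V * (\<Sum>i\<in>UNIV. \<phi> i) + H * K * (\<alpha> + (3 + z) * G + 2 * V) + 2 * z * (\<Sum>i\<in>UNIV. \<phi> i) / \<zeta> x0)"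
        by (rule maximum_point_estimate[where \<beta> = bar.\<beta> and ?\<beta>1.0 = bar.\<beta>1 and R = R, OF fin open_ball x0B upos du d2u D3 adm[unfolded A_def] eq[unfolded A_def J_def]
              dat[OF x0B, unfolded A_def] \<psi>[OF x0B, unfolded J_def] K[OF x0B, unfolded J_def] str[OF x0B, unfolded J_def] bar.\<alpha>(1) m0
              bar.\<beta>_derivative(1) bar.\<beta>_derivative(2)[OF upos[OF x0B]] b10 d max,
              unfolded w_def[symmetric] z_def[symmetric], unfolded \<zeta>x, folded V_def G_def], (assumption | (rule that; assumption))+)
      have G: "0 \<le> G" "G \<le> 2 * r / \<zeta> x0"
        using \<zeta>pos nx by (auto simp: G_def intro!: divide_right_mono)
      have Vb: "a / (2 * M1) / \<zeta> x0 \<le> V"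
      proof -
        have "a / (2 * M1) / \<zeta> x0 \<le> bar.\<beta>1 z / \<zeta> x0"
          using bar.\<beta>_bounds(4)[OF z(1)] \<zeta>pos by (intro divide_right_mono) auto
        then show ?thesis using m0 by (simp add: V_def)
      qed
      have V0: "V \<ge> 0"
      proof -
        have "0 \<le> a / (2 * M1) / \<zeta> x0" using bar.a_pos bar.M1 \<zeta>pos by simp
        then show ?thesis using Vb by linarith
      qed
      have zV: "1/16 \<le> z * V"
        using bar.height_slope[OF z(1), of "\<rho> x0"] act \<zeta>pos by (simp add: V_def \<zeta>_def z_def)
      have small2: "V + 2 * z * bar.m\<^sup>2 + z * \<bar>bar.\<beta>2 z\<bar> / \<zeta> x0 + 2 * z / \<zeta> x0 + K / gap * (\<alpha> + (3 + z) * G + 2 * V)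
           < \<delta> / 32 * z * V\<^sup>2 / \<alpha>"
        by (rule bar.height_estimate[OF z(1) \<zeta>pos G V_def zV])
      \<comment> \<open>\<open>\<Theta>\<close> at \<open>x0\<close> is at least its value at the
        centre, hence at least 2 R = a/2.\<close>
      have inv: "1 / \<zeta> x0 \<le> w powr \<alpha> * exp (bar.m * z) / (a / 2)"
      proof -
        have "a / 2 \<le> (w powr \<alpha> * exp (bar.m * z)) * \<zeta> x0" using \<Theta>pos \<Theta>x by (simp add: R_def)
        then show ?thesis using \<zeta>pos bar.a_pos by (simp add: field_simps)
      qed
      have small1: "K / gap * (\<alpha> + (3 + z) * G + 2 * V) < \<alpha> * w / (2 * z)"
        by (rule bar.large_slope_dominates[OF wl z \<zeta>pos inv G V_def])
      \<comment> \<open>The position term is at most 2 r |Du| / \<zeta>. Since V \<ge> a / (2 M1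
        \<zeta>) and |Du| \<ge> w/2 \<ge> 8 r M1 / a, half of V |Du|^2 covers it; the factor
        1/\<zeta> occurs on both sides.\<close>
      have T: "2 * (x0 \<bullet> Du x0) / \<zeta> x0 \<le> V * (Du x0 \<bullet> Du x0) / 2"
      proof -
        have "w\<^sup>2 / 4 \<le> Du x0 \<bullet> Du x0"
        proof -
          have "2 * 2 \<le> w * w" using w2 by (intro mult_mono) auto
          then show ?thesis using wsq by (simp add: power2_eq_square)
        qed
        then have "(w / 2)\<^sup>2 \<le> (norm (Du x0))\<^sup>2" by (simp add: power2_norm_eq_inner power_divide)
        then have "w / 2 \<le> norm (Du x0)" by (rule power2_le_imp_le) simp
        then have nD: "8 * r * M1 / a \<le> norm (Du x0)" using wr by simp
        have "(a / (2 * M1)) * (8 * r * M1 / a) = 4 * r" using bar.a_pos bar.M1 by simp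
        moreover have "(a / (2 * M1)) * (8 * r * M1 / a) \<le> (a / (2 * M1)) * norm (Du x0)"
          using nD bar.a_pos bar.M1 by (intro mult_left_mono) auto
        ultimately have "4 * r \<le> (a / (2 * M1)) * norm (Du x0)" by simp
        then have "4 * r / \<zeta> x0 \<le> (a / (2 * M1)) * norm (Du x0) / \<zeta> x0" using \<zeta>pos by (intro divide_right_mono) auto
        also have "\<dots> = (a / (2 * M1) / \<zeta> x0) * norm (Du x0)" by simp
        also have "\<dots> \<le> V * norm (Du x0)" using Vb by (intro mult_right_mono) auto
        finally have rV: "4 * r / \<zeta> x0 \<le> V * norm (Du x0)" .
        have "x0 \<bullet> Du x0 \<le> r * norm (Du x0)"
          using norm_cauchy_schwarz[of x0 "Du x0"] nx by (meson mult_right_mono norm_ge_zero order_trans)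
        then have "2 * (x0 \<bullet> Du x0) / \<zeta> x0 \<le> 2 * (r * norm (Du x0)) / \<zeta> x0" using \<zeta>pos by (intro divide_right_mono) auto
        also have "\<dots> = (4 * r / \<zeta> x0) * norm (Du x0) / 2" by simp
        also have "\<dots> \<le> (V * norm (Du x0)) * norm (Du x0) / 2" using rV by (intro divide_right_mono mult_right_mono) auto
        also have "\<dots> = V * (Du x0 \<bullet> Du x0) / 2" by (simp add: power2_norm_eq_inner[symmetric] power2_eq_square)
        finally show ?thesis .
      qed
      show False
      proof (rule maximum_contradiction_with_height[OF est(1-3) gp est(4-8) delta(1) est(9) bar.\<alpha>(1) _ z(1) \<zeta>pos w2 wsq K0 _ _ T small1 small2])
        show "\<alpha> \<le> 1/4" "4 * \<alpha> \<le> z * V" using bar.\<alpha> zV by auto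
        show "0 \<le> \<alpha> + (3 + z) * G + 2 * V" using bar.\<alpha> z G V0 by simp
      qed
    qed
    then show ?thesis ..
  qed
qed

end

theorem theorem1:
  fixes f :: "real^'n \<Rightarrow> real" and \<Gamma> :: "(real^'n) set"
    and Df :: "real^'n \<Rightarrow> ((real^'n) \<Rightarrow>\<^sub>L real)"
    and \<delta> r :: real
  assumes r_pos: "r > 0"
    and cone: "admissible_cone \<Gamma>"
    and f_sym: "\<forall>l\<in>\<Gamma>. \<forall>\<sigma>. \<sigma> permutes (UNIV::'n set) \<longrightarrow> f (\<chi> i. l$(\<sigma> i)) = f l"
    and f_C1: "\<forall>l\<in>\<Gamma>. (f has_derivative blinfun_apply (Df l)) (at l)" "continuous_on \<Gamma> Df"
    and f_i: "\<forall>l\<in>\<Gamma>. \<forall>i. Df l (axis i 1) \<ge> 0"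
    and f_ii: "concave_on \<Gamma> f"
    and f_iii: "0 < \<delta>" "\<delta> < 1/2"
      "\<forall>l\<in>\<Gamma>. \<forall>j. l$j < 0 \<longrightarrow> Df l (axis j 1) > 2 * \<delta> * (\<Sum>i\<in>UNIV. Df l (axis i 1))"
    and f_iv: "\<forall>l\<in>\<Gamma>. strict_mono_on {0<..} (\<lambda>t. f (t *\<^sub>R l))"
  shows "\<forall>K0 K1 :: real. \<forall>(h :: real \<Rightarrow> real) (g :: real^'n \<Rightarrow> real).
    \<exists>C>0. \<forall>(u :: real^'n \<Rightarrow> real) Du D2u
        (\<psi> :: (real^'n) \<times> real \<times> ((real^'n) \<times> real) \<Rightarrow> real) D\<psi>.
      (C3_with (ball 0 r) u Du D2u
       \<and> (\<forall>x\<in>ball 0 r. u x > 0)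
       \<and> bdd_above (u ` ball 0 r)
       \<comment> \<open>psi is C^1 (on the region u > 0)\<close>
       \<and> (\<forall>p. fst (snd p) > 0 \<longrightarrow> (\<psi> has_derivative blinfun_apply (D\<psi> p)) (at p))
       \<and> continuous_on {p. fst (snd p) > 0} D\<psi>
       \<comment> \<open>bounds for |psi| and |D psi| on the values (x, u(x), nu(x))\<close>
       \<and> (\<forall>x\<in>ball 0 r. \<bar>\<psi> (x, u x, upnormal (Du x))\<bar> \<le> K0
                      \<and> norm (D\<psi> (x, u x, upnormal (Du x))) \<le> K1)
       \<comment> \<open>admissibility\<close>
       \<and> (\<forall>x\<in>ball 0 r. \<exists>l. eigvals_are (curv_mat (u x) (Du x) (D2u x)) l \<and> l \<in> closure \<Gamma>)
       \<comment> \<open>the equation, with the degenerate form on the boundary of the cone\<close>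
       \<and> (\<forall>x\<in>ball 0 r. \<forall>l. eigvals_are (curv_mat (u x) (Du x) (D2u x)) l \<longrightarrow>
            (l \<in> \<Gamma> \<longrightarrow> f l = \<psi> (x, u x, upnormal (Du x))) \<and>
            (l \<in> frontier \<Gamma> \<longrightarrow>
               Limsup (at l within \<Gamma>) (\<lambda>m. ereal (g m)) = ereal (h (\<psi> (x, u x, upnormal (Du x))))))
       \<comment> \<open>hypotheses on h and g, needed when degenerate points occur\<close>
       \<and> ((\<exists>x\<in>ball 0 r. \<exists>l. eigvals_are (curv_mat (u x) (Du x) (D2u x)) l \<and> l \<in> frontier \<Gamma>) \<longrightarrow>
            strict_mono h \<and> h C1_differentiable_on UNIV
            \<and> (\<forall>l\<in>\<Gamma>. g l = h (f l))
            \<and> (\<exists>Dg :: real^'n \<Rightarrow> ((real^'n) \<Rightarrow>\<^sub>L real).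
                 (\<forall>l\<in>closure \<Gamma> - (frontier pos_cone \<inter> frontier \<Gamma>).
                    (g has_derivative blinfun_apply (Dg l)) (at l within (closure \<Gamma> - (frontier pos_cone \<inter> frontier \<Gamma>))))
                 \<and> continuous_on (closure \<Gamma> - (frontier pos_cone \<inter> frontier \<Gamma>)) Dg
                 \<and> (\<forall>l\<in>frontier \<Gamma> - frontier pos_cone. (\<Sum>i\<in>UNIV. Dg l (axis i 1)) > 0)))
       \<comment> \<open>condition (v)\<close>
       \<and> (\<exists>L. ((\<lambda>t. ereal (f (\<chi> i. t))) \<longlongrightarrow> L) at_top
              \<and> (SUP x\<in>ball 0 r. ereal (\<psi> (x, u x, upnormal (Du x)))) < L)
       \<comment> \<open>structure condition on psi\<close>
       \<and> (\<forall>x z \<nu>. z > 0 \<longrightarrow>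
            ereal (D\<psi> (x, z, \<nu>) (0, 1, 0))
              - (ereal (\<psi> (x, z, \<nu>)) - Limsup (at 0 within \<Gamma>) (\<lambda>m. ereal (f m))) / ereal z \<ge> 0))
      \<longrightarrow> norm (Du 0) \<le> exp (C * (Sup (u ` ball 0 r) + (Sup (u ` ball 0 r))^2 / r^2 + 1))"
proof (intro allI, goal_cases)
  case (1 K0 K1 h g)
  interpret cf: curvature_function f \<Gamma> Df \<delta>
    by unfold_locales (use cone f_C1 f_i f_ii f_iii f_iv in auto)
  show ?case
  proof (cases "\<bar>cf.f0\<bar> = \<infinity>")
    case True
    have "cf.f0 \<noteq> \<infinity>" using cf.f0_le[OF cf.one_in_cone] by auto
    then have inf: "Limsup (at 0 within \<Gamma>) (\<lambda>m. ereal (f m)) = - \<infinity>"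
      using True unfolding cf.f0_def by auto
    \<comment> \<open>If f(0) is minus infinity, the left-hand side of the condition on \<psi> is
      minus infinity as well. No \<psi> satisfies it, and any constant will do.\<close>
    have no: "\<not> (\<forall>x z \<nu>. z > 0 \<longrightarrow>
            ereal (D\<psi> (x, z, \<nu>) (0, 1, 0))
              - (ereal (\<psi> (x, z, \<nu>)) - Limsup (at 0 within \<Gamma>) (\<lambda>m. ereal (f m))) / ereal z \<ge> 0)"
      for \<psi> :: "(real^'n) \<times> real \<times> ((real^'n) \<times> real) \<Rightarrow> real"
        and D\<psi> :: "(real^'n) \<times> real \<times> ((real^'n) \<times> real) \<Rightarrow> ((real^'n) \<times> real \<times> ((real^'n) \<times> real)) \<Rightarrow>\<^sub>L real"
    proof
      assume "\<forall>x z \<nu>. z > 0 \<longrightarrow>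
            ereal (D\<psi> (x, z, \<nu>) (0, 1, 0))
              - (ereal (\<psi> (x, z, \<nu>)) - Limsup (at 0 within \<Gamma>) (\<lambda>m. ereal (f m))) / ereal z \<ge> 0"
      from this[rule_format, of 1 0 0] show False unfolding inf by simp
    qed
    show ?thesis
      by (intro exI[of _ 1] conjI allI impI) (simp, elim conjE, erule notE[OF no])
  next
    case fin: False
    note gap = cf.gap_pos[OF fin]
    obtain \<alpha> b k where bar: "\<And>M1. M1 \<ge> 1 \<Longrightarrow> barrier r (\<bar>K1\<bar> / cf.gap) (\<delta> / 32) \<alpha> b k (r\<^sup>2 / 2) M1"
      using barrier_constants_exist[of r "\<bar>K1\<bar> / cf.gap" "\<delta> / 32"] r_pos gap f_iii(1) by auto
    define c8 where "c8 = barrier.c8 r (\<bar>K1\<bar> / cf.gap) \<alpha> b k (r\<^sup>2 / 2)"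
    \<comment> \<open>The instance with height bound 1 only supplies the facts about \<alpha>,
      \<open>k\<close> and \<open>c8\<close>, which do not depend on the height.\<close>
    interpret b1: barrier r "\<bar>K1\<bar> / cf.gap" "\<delta> / 32" \<alpha> b k "r\<^sup>2 / 2" 1 by (rule bar) simp
    have pos: "\<alpha> > 0" "k > 0" "c8 \<ge> 0"
      using b1.\<alpha>(1) b1.k_ge b1.c_nonneg(3) by (auto simp: c8_def)
    \<comment> \<open>The first factor collects the estimate at the centre divided by \<alpha>. The
      second comes from (M + 1)^2 \<le> 2 (1 + r^2) (M + M^2/r^2 + 1), where M + 1 is used as the
      height bound so that it is at least 1.\<close>
    define C where "C = (c8 + (k + 2) / \<alpha>) * (2 * (1 + r\<^sup>2))"
    have coeff: "c8 + (k + 2) / \<alpha> > 0" using pos by (intro add_nonneg_pos) auto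
    have "0 < 2 * (1 + r\<^sup>2)" by (simp add: add_pos_nonneg)
    with coeff have C: "C > 0" unfolding C_def by (rule mult_pos_pos)
    have bound: "norm (Du 0) \<le> exp (C * (Sup (u ` ball 0 r) + (Sup (u ` ball 0 r))^2 / r^2 + 1))"
      if C3: "C3_with (ball 0 r) u Du D2u"
        and upos: "\<And>x. x \<in> ball 0 r \<Longrightarrow> u x > 0" and bdd: "bdd_above (u ` ball 0 r)"
        and \<psi>: "\<And>p. fst (snd p) > 0 \<Longrightarrow> (\<psi> has_derivative blinfun_apply (D\<psi> p)) (at p)"
        and K: "\<And>x. x \<in> ball 0 r \<Longrightarrow> norm (D\<psi> (x, u x, upnormal (Du x))) \<le> K1"
        and adm: "\<And>x. x \<in> ball 0 r \<Longrightarrow> \<exists>l. eigvals_are (curv_mat (u x) (Du x) (D2u x)) l \<and> l \<in> closure \<Gamma>"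
        and eq: "\<And>x. x \<in> ball 0 r \<Longrightarrow> solves_at \<Gamma> f h g (curv_mat (u x) (Du x) (D2u x)) (\<psi> (x, u x, upnormal (Du x)))"
        and dat: "\<And>x l. x \<in> ball 0 r \<Longrightarrow> eigvals_are (curv_mat (u x) (Du x) (D2u x)) l \<Longrightarrow> l \<in> frontier \<Gamma> \<Longrightarrow> degenerate_data \<Gamma> f h g"
        and str: "\<And>x z \<nu>. z > 0 \<Longrightarrow> ereal (D\<psi> (x, z, \<nu>) (0, 1, 0)) - (ereal (\<psi> (x, z, \<nu>)) - cf.f0) / ereal z \<ge> 0"
      for u :: "real^'n \<Rightarrow> real" and Du D2u and \<psi> :: "(real^'n) \<times> real \<times> ((real^'n) \<times> real) \<Rightarrow> real" and D\<psi>
    proof -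
      define M where "M = Sup (u ` ball 0 r)"
      have uM: "u x \<le> M" if "x \<in> ball 0 r" for x
        unfolding M_def using bdd that by (intro cSup_upper) auto
      have "0 < u 0" using upos r_pos by simp
      also have "u 0 \<le> M" using uM r_pos by simp
      finally have M: "M > 0" .
      have uM1: "u x \<le> M + 1" if "x \<in> ball 0 r" for x using uM[OF that] by simp
      have str': "(\<psi> (x, u x, upnormal (Du x)) - real_of_ereal cf.f0) / u x
          \<le> D\<psi> (x, u x, upnormal (Du x)) (0, 1, 0)" if "x \<in> ball 0 r" for x
      proof -
        obtain c where c: "cf.f0 = ereal c" using fin by (cases cf.f0) auto
        show ?thesis using str[OF upos[OF that], of x "upnormal (Du x)"] upos[OF that] unfolding c by simp
      qed
      have K': "norm (D\<psi> (x, u x, upnormal (Du x))) \<le> \<bar>K1\<bar>" if "x \<in> ball 0 r" for x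
        using K[OF that] by simp
      have \<psi>': "(\<psi> has_derivative blinfun_apply (D\<psi> (x, u x, upnormal (Du x)))) (at (x, u x, upnormal (Du x)))"
        if "x \<in> ball 0 r" for x
        by (rule \<psi>) (simp add: upos[OF that])
      have "\<alpha> * ln (wfun (Du 0)) \<le> (\<alpha> * c8 + k) * (M + 1)\<^sup>2 + 2"
        unfolding c8_def
        by (rule cf.gradient_estimate_at_center[where \<psi> = \<psi> and D\<psi> = D\<psi>, OF fin _ bar C3 upos uM1 adm eq dat \<psi>' K' str'])
          (use M in simp_all)
      also have "\<dots> \<le> (\<alpha> * c8 + k + 2) * (M + 1)\<^sup>2"
        using M by (simp add: distrib_right)
      also have "\<dots> = \<alpha> * ((c8 + (k + 2) / \<alpha>) * (M + 1)\<^sup>2)" using pos by (simp add: field_simps)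
      finally have "ln (wfun (Du 0)) \<le> (c8 + (k + 2) / \<alpha>) * (M + 1)\<^sup>2"
        using pos(1) by (simp only: mult_le_cancel_left_pos)
      also have "\<dots> \<le> (c8 + (k + 2) / \<alpha>) * (2 * (1 + r\<^sup>2) * (M + M\<^sup>2 / r\<^sup>2 + 1))"
      proof (rule mult_left_mono)
        have "0 \<le> (M - 1)\<^sup>2" by simp
        then have "(M + 1)\<^sup>2 \<le> 2 * (M\<^sup>2 + 1)" by (simp add: power2_eq_square algebra_simps)
        also have "\<dots> \<le> 2 * ((1 + r\<^sup>2) * (M + M\<^sup>2 / r\<^sup>2 + 1))"
        proof -
          have "(1 + r\<^sup>2) * (M + M\<^sup>2 / r\<^sup>2 + 1) = (M\<^sup>2 + 1) + ((1 + r\<^sup>2) * M + M\<^sup>2 / r\<^sup>2 + r\<^sup>2)"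
            using r_pos by (simp add: field_simps)
          moreover have "0 \<le> (1 + r\<^sup>2) * M + M\<^sup>2 / r\<^sup>2 + r\<^sup>2" using M by simp
          ultimately have "M\<^sup>2 + 1 \<le> (1 + r\<^sup>2) * (M + M\<^sup>2 / r\<^sup>2 + 1)" by (simp only: le_add_same_cancel1)
          then show ?thesis by (rule mult_left_mono) simp
        qed
        finally show "(M + 1)\<^sup>2 \<le> 2 * (1 + r\<^sup>2) * (M + M\<^sup>2 / r\<^sup>2 + 1)" unfolding mult.assoc .
      qed (use coeff in simp)
      also have "\<dots> = C * (M + M\<^sup>2 / r\<^sup>2 + 1)" unfolding C_def by (simp only: mult.assoc)
      finally have ln: "ln (wfun (Du 0)) \<le> C * (M + M\<^sup>2 / r\<^sup>2 + 1)" .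
      have "norm (Du 0) \<le> wfun (Du 0)"
        by (rule power2_le_imp_le) (simp_all add: wfun_square power2_norm_eq_inner wfun_pos less_imp_le)
      also have "\<dots> = exp (ln (wfun (Du 0)))" by (simp add: wfun_pos)
      also have "\<dots> \<le> exp (C * (M + M\<^sup>2 / r\<^sup>2 + 1))" using ln by simp
      finally show ?thesis by (simp add: M_def)
    qed
    show ?thesis
    proof (intro exI[of _ C] conjI allI impI C, elim conjE, goal_cases)
      case prems: (1 u Du D2u \<psi> D\<psi>)
      show ?case
      proof (rule bound[where \<psi> = \<psi> and D\<psi> = D\<psi> and D2u = D2u])
        show "solves_at \<Gamma> f h g (curv_mat (u x) (Du x) (D2u x)) (\<psi> (x, u x, upnormal (Du x)))"
          if "x \<in> ball 0 r" for x
          using prems that unfolding solves_at_def by blast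
        show "degenerate_data \<Gamma> f h g"
          if "x \<in> ball 0 r" "eigvals_are (curv_mat (u x) (Du x) (D2u x)) l" "l \<in> frontier \<Gamma>" for x l
          using prems that unfolding degenerate_data_def by blast
      qed (use prems in \<open>auto simp: cf.f0_def\<close>)
    qed
  qed
qed

end
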